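(* There exists a unique solution $(u_{hp},\boldsymbol p_{hp},\boldsymbol\lambda_{hp})\in V_{hp}\times Q_{hp}\times\Lambda_{hp}$ of the discrete mixed problem $$a((u_{hp},\boldsymbol p_{hp}),(v_{hp},\boldsymbol q_{hp}))+(\boldsymbol\lambda_{hp},\boldsymbol q_{hp})_{0,\Omega}=\ell(v_{hp})\quad\forall\,(v_{hp},\boldsymbol q_{hp})\in V_{hp}\times Q_{hp},$$ $$(\boldsymbol\mu_{hp}-\boldsymbol\lambda_{hp},\boldsymbol p_{hp})_{0,\Omega}\le0\quad\forall\,\boldsymbol\mu_{hp}\in\Lambda_{hp}.$$ Moreover, it holds $$\|(u_{hp},\boldsymbol p_{hp})\|\le\frac1\alpha\Big(\|f\|_{V^*}+c_{tr}\|g\|_{-\frac12,\Gamma_N}\Big),\qquad \|\boldsymbol\lambda_{hp}\|_{0,\Omega}\le\frac{c_a}\alpha\Big(\|f\|_{V^*}+c_{tr}\|g\|_{-\frac12,\Gamma_N}\Big).$$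
   Context: Let $d\in\{2,3\}$ and let $\Omega\subset\mathbb R^d$ be a bounded polygonal (polyhedral) domain with Lipschitz boundary $\Gamma$, $\Gamma_D\subseteq\Gamma$ a part of positive surface measure, $\Gamma_N:=\Gamma\setminus\overline{\Gamma_D}$. Let $\mathbb S_d$ be the symmetric real $d\times d$ matrices and $\mathbb S_{d,0}:=\{\boldsymbol\tau\in\mathbb S_d:\operatorname{tr}\boldsymbol\tau=0\}$; $\boldsymbol\sigma:\boldsymbol\tau$ is the Frobenius inner product and $|\cdot|_F$ the Frobenius norm. $(\cdot,\cdot)_{0,\Omega}$ and $\|\cdot\|_{0,\Omega}$ are the $L^2(\Omega)$ inner product and norm (scalar, vector or matrix valued). $\mathbb C,\mathbb H$ are fourth-order tensor fields with entries in $L^\infty(\Omega)$, with $\mathbb C_{ijkl}=\mathbb C_{jilk}=\mathbb C_{klij}$, $\mathbb H_{ijkl}=\mathbb H_{jilk}=\mathbb H_{klij}$, and there are $c_e,c_h>0$ with $(\mathbb C\boldsymbol\tau):\boldsymbol\tau\ge c_e|\boldsymbol\tau|_F^2$, $(\mathbb H\boldsymbol\tau):\boldsymbol\tau\ge c_h|\boldsymbol\tau|_F^2$ for all $\boldsymbol\tau\in L^2(\Omega,\mathbb S_d)$. $\sigma_y>0$ is a constant. $\boldsymbol\varepsilon(u):=\frac12(\nabla u+(\nabla u)^\top)$ and $\boldsymbol\sigma(u,\boldsymbol p):=\mathbb C(\boldsymbol\varepsilon(u)-\boldsymbol p)$. $V:=\{v\in H^1(\Omega,\mathbb R^d): v|_{\Gamma_D}=0\}$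 with norm $\|v\|_{1,\Omega}:=(\|v\|_{0,\Omega}^2+\|\boldsymbol\varepsilon(v)\|_{0,\Omega}^2)^{1/2}$, $Q:=L^2(\Omega,\mathbb S_{d,0})$, and $\|(v,\boldsymbol q)\|^2:=\|v\|_{1,\Omega}^2+\|\boldsymbol q\|_{0,\Omega}^2$. $\|\cdot\|_{\frac12,\Gamma_N}$ is the standard trace norm on the space of traces of $V$ on $\Gamma_N$, $H^{-1/2}(\Gamma_N,\mathbb R^d)$ is the dual of that space with dual norm $\|\cdot\|_{-\frac12,\Gamma_N}$, and $c_{tr}>0$ is a constant with $\|v\|_{\frac12,\Gamma_N}\le c_{tr}\|v\|_{1,\Omega}$ for all $v\in V$. Given $f\in V^*$, $g\in H^{-1/2}(\Gamma_N,\mathbb R^d)$, let $$a((u,\boldsymbol p),(v,\boldsymbol q)):=(\boldsymbol\sigma(u,\boldsymbol p),\boldsymbol\varepsilon(v)-\boldsymbol q)_{0,\Omega}+(\mathbb H\boldsymbol p,\boldsymbol q)_{0,\Omega},\qquad \ell(v):=\langle f,v\rangle_\Omega+\langle g,v\rangle_{\Gamma_N};$$ $c_a,\alpha>0$ are constants with $a((u,\boldsymbol p),(v,\boldsymbol q))\le c_a\|(u,\boldsymbol p)\|\,\|(v,\boldsymbol q)\|$ and $\alpha\|(v,\boldsymbol q)\|^2\le a((v,\boldsymbol q),(v,\boldsymbol q))$ on $V\times Q$. $\mathcal T_h$ is a locally quasi-uniform finite element mesh of $\Omega$ of quadrilaterals ($d=2$) or hexahedra ($d=3$); $\widehat T:=[-1,1]^d$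 and $F_T:\widehat T\to T$ is the bi-/tri-linear bijective mapping of $T\in\mathcal T_h$. Each $T$ carries a polynomial degree $p_T\ge1$ (comparable on neighboring elements). $\mathbb P_k(\widehat T)$ denotes the tensor-product polynomials of degree at most $k$ in each variable. It is assumed that $\det\nabla F_T\in\mathbb P_1(\widehat T)$ whenever $p_T\ge2$. Let $\hat x_{k,T}\in\widehat T$, $1\le k\le n_T:=p_T^d$, be the tensor-product Gauss quadrature points ($p_T$ Gauss–Legendre points per direction). Define $$V_{hp}:=\{v_{hp}\in V: v_{hp}|_T\circ F_T\in(\mathbb P_{p_T}(\widehat T))^d\ \forall T\in\mathcal T_h\},\qquad Q_{hp}:=\{\boldsymbol q_{hp}\in Q:\boldsymbol q_{hp}|_T\circ F_T\in(\mathbb P_{p_T-1}(\widehat T))^{d\times d}\ \forall T\in\mathcal T_h\},$$ $$\Lambda_{hp}:=\{\boldsymbol\mu_{hp}\in Q_{hp}:|\boldsymbol\mu_{hp}(F_T(\hat x_{k,T}))|_F\le\sigma_y\ \text{for all }1\le k\le n_T,\ T\in\mathcal T_h\}$$ (on each $T$, $\boldsymbol\mu_{hp}$ is evaluated via its restriction to $T$). *)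

theory Defs
  imports
    "HOL-Analysis.Analysis"
    "HOL-Computational_Algebra.Polynomial"
begin

text \<open>
  Elements of Lebesgue and Sobolev spaces are represented by functions; all notions below are
  invariant under modification on null sets of \<open>\<Omega>\<close>, and equality in these spaces is
  equality almost everywhere.
\<close>

definition L2 :: "'a measure \<Rightarrow> ('a \<Rightarrow> 'b::euclidean_space) set" where
  "L2 M = {f \<in> borel_measurable M. integrable M (\<lambda>x. (norm (f x))\<^sup>2)}"

definition L2_inner :: "'a measure \<Rightarrow> ('a \<Rightarrow> 'b::euclidean_space) \<Rightarrow> ('a \<Rightarrow> 'b) \<Rightarrow> real" where
  "L2_inner M f g = (LINT x|M. f x \<bullet> g x)"

definition L2_norm :: "'a measure \<Rightarrow> ('a \<Rightarrow> 'b::euclidean_space) \<Rightarrow> real" where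
  "L2_norm M f = sqrt (LINT x|M. (norm (f x))\<^sup>2)"

definition Linfty :: "'a measure \<Rightarrow> ('a \<Rightarrow> real) set" where
  "Linfty M = {f \<in> borel_measurable M. \<exists>K. AE x in M. \<bar>f x\<bar> \<le> K}"

definition bounded_functional ::
  "('a \<Rightarrow> 'b::real_vector) set \<Rightarrow> (('a \<Rightarrow> 'b) \<Rightarrow> real) \<Rightarrow> (('a \<Rightarrow> 'b) \<Rightarrow> real) \<Rightarrow> bool" where
  "bounded_functional S N F \<longleftrightarrow>
     (\<forall>v\<in>S. \<forall>w\<in>S. F (\<lambda>x. v x + w x) = F v + F w) \<and>
     (\<forall>v\<in>S. \<forall>c. F (\<lambda>x. c *\<^sub>R v x) = c * F v) \<and>
     (\<exists>K. \<forall>v\<in>S. \<bar>F v\<bar> \<le> K * N v)"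

definition dual_norm ::
  "('a \<Rightarrow> 'b::real_vector) set \<Rightarrow> (('a \<Rightarrow> 'b) \<Rightarrow> real) \<Rightarrow> (('a \<Rightarrow> 'b) \<Rightarrow> real) \<Rightarrow> real" where
  "dual_norm S N F = (SUP v\<in>{v \<in> S. N v \<le> 1}. \<bar>F v\<bar>)"

definition hausdorff_content :: "nat \<Rightarrow> real \<Rightarrow> 'a::metric_space set \<Rightarrow> ennreal" where
  "hausdorff_content s \<delta> A =
     (INF U\<in>{U :: nat \<Rightarrow> 'a set. A \<subseteq> (\<Union>i. U i) \<and> (\<forall>i. bounded (U i) \<and> diameter (U i) \<le> \<delta>)}.
        (\<Sum>i. ennreal (unit_ball_vol (real s) * (diameter (U i) / 2) ^ s)))"

text \<open>
  The \<open>s\<close>-dimensional Hausdorff measure, \<open>s \<ge> 1\<close>, on the Borel sets. The outer measure is a metric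
  outer measure, hence countably additive on Borel sets, so that \<^const>\<open>measure_of\<close> takes its
  values. With the factor above it is the surface measure for \<open>s = d - 1\<close>.
\<close>

definition hausdorff_measure :: "nat \<Rightarrow> 'a::metric_space measure" where
  "hausdorff_measure s =
     measure_of UNIV (sets borel) (\<lambda>A. SUP \<delta>\<in>{0<..}. hausdorff_content s \<delta> A)"

definition surface_measure :: "(real^'n::finite) measure" where
  "surface_measure = hausdorff_measure (CARD('n) - 1)"

definition surface_on :: "(real^'n::finite) set \<Rightarrow> (real^'n) measure" where
  "surface_on S = restrict_space surface_measure S"

definition polyhedral_domain :: "(real^'n::finite) set \<Rightarrow> bool" where
  "polyhedral_domain \<Omega> \<longleftrightarrow>
     open \<Omega> \<and> connected \<Omega> \<and> \<Omega> \<noteq> {} \<and> bounded \<Omega> \<and>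
     (\<exists>\<F>. finite \<F> \<and> (\<forall>P\<in>\<F>. polytope P \<and> aff_dim P = int CARD('n) - 1) \<and> frontier \<Omega> = \<Union>\<F>)"

text \<open>
  Locally, \<open>\<Omega>\<close> lies on one side of the graph of a Lipschitz function over the hyperplane
  orthogonal to a unit vector \<open>e\<close>.
\<close>

definition lipschitz_boundary :: "(real^'n::finite) set \<Rightarrow> bool" where
  "lipschitz_boundary \<Omega> \<longleftrightarrow>
     (\<forall>x\<in>frontier \<Omega>. \<exists>U e \<gamma> L. open U \<and> x \<in> U \<and> norm e = 1 \<and> L-lipschitz_on UNIV \<gamma> \<and>
        \<Omega> \<inter> U = {y \<in> U. y \<bullet> e < \<gamma> (y - (y \<bullet> e) *\<^sub>R e)})"

text \<open>The family \<open>D\<close> collects the partial derivatives of all orders.\<close>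

definition smooth :: "(real^'n::finite \<Rightarrow> real) \<Rightarrow> bool" where
  "smooth \<phi> \<longleftrightarrow>
     (\<exists>D :: 'n list \<Rightarrow> real^'n \<Rightarrow> real. D [] = \<phi> \<and>
        (\<forall>is x. (D is has_derivative (\<lambda>h. \<Sum>i\<in>UNIV. h $ i * D (i # is) x)) (at x)))"

definition test_function :: "(real^'n::finite) set \<Rightarrow> (real^'n \<Rightarrow> real) \<Rightarrow> bool" where
  "test_function \<Omega> \<phi> \<longleftrightarrow>
     smooth \<phi> \<and> compact (closure {x. \<phi> x \<noteq> 0}) \<and> closure {x. \<phi> x \<noteq> 0} \<subseteq> \<Omega>"

definition has_weak_gradient ::
  "(real^'n::finite) set \<Rightarrow> (real^'n \<Rightarrow> real^'n) \<Rightarrow> (real^'n \<Rightarrow> real^'n^'n) \<Rightarrow> bool" where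
  "has_weak_gradient \<Omega> v G \<longleftrightarrow>
     G \<in> L2 (lebesgue_on \<Omega>) \<and>
     (\<forall>\<phi>. test_function \<Omega> \<phi> \<longrightarrow> (\<forall>i j.
        (LINT x|lebesgue_on \<Omega>. v x $ i * frechet_derivative \<phi> (at x) (axis j 1)) =
        - (LINT x|lebesgue_on \<Omega>. G x $ i $ j * \<phi> x)))"

definition H1 :: "(real^'n::finite) set \<Rightarrow> (real^'n \<Rightarrow> real^'n) set" where
  "H1 \<Omega> = {v \<in> L2 (lebesgue_on \<Omega>). \<exists>G. has_weak_gradient \<Omega> v G}"

text \<open>For \<open>v \<in> H1 \<Omega>\<close> the weak gradient is unique up to null sets.\<close>

definition weak_gradient ::
  "(real^'n::finite) set \<Rightarrow> (real^'n \<Rightarrow> real^'n) \<Rightarrow> real^'n \<Rightarrow> real^'n^'n" where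
  "weak_gradient \<Omega> v = (SOME G. has_weak_gradient \<Omega> v G)"

definition strain ::
  "(real^'n::finite) set \<Rightarrow> (real^'n \<Rightarrow> real^'n) \<Rightarrow> real^'n \<Rightarrow> real^'n^'n" where
  "strain \<Omega> v x = (1/2) *\<^sub>R (weak_gradient \<Omega> v x + transpose (weak_gradient \<Omega> v x))"

definition norm_1 :: "(real^'n::finite) set \<Rightarrow> (real^'n \<Rightarrow> real^'n) \<Rightarrow> real" where
  "norm_1 \<Omega> v =
     sqrt ((L2_norm (lebesgue_on \<Omega>) v)\<^sup>2 + (L2_norm (lebesgue_on \<Omega>) (strain \<Omega> v))\<^sup>2)"

text \<open>
  The trace operator from \<open>H1 \<Omega>\<close> to \<open>L2 (surface_on (frontier \<Omega>))\<close>, as the continuous extension of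
  the restriction to the boundary of functions that are smooth up to the boundary.
\<close>

definition has_trace ::
  "(real^'n::finite) set \<Rightarrow> (real^'n \<Rightarrow> real^'n) \<Rightarrow> (real^'n \<Rightarrow> real^'n) \<Rightarrow> bool" where
  "has_trace \<Omega> v z \<longleftrightarrow>
     z \<in> L2 (surface_on (frontier \<Omega>)) \<and>
     (\<exists>\<phi> :: nat \<Rightarrow> real^'n \<Rightarrow> real^'n.
        (\<forall>n i. smooth (\<lambda>x. \<phi> n x $ i)) \<and>
        (\<lambda>n. \<integral>\<^sup>+ x. ennreal ((norm (\<phi> n x - v x))\<^sup>2) \<partial>lebesgue_on \<Omega>) \<longlonglongrightarrow> 0 \<and>
        (\<lambda>n. \<integral>\<^sup>+ x. ennreal ((norm (jacobian (\<phi> n) (at x) - weak_gradient \<Omega> v x))\<^sup>2)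
               \<partial>lebesgue_on \<Omega>) \<longlonglongrightarrow> 0 \<and>
        (\<lambda>n. \<integral>\<^sup>+ x. ennreal ((norm (\<phi> n x - z x))\<^sup>2) \<partial>surface_on (frontier \<Omega>)) \<longlonglongrightarrow> 0)"

definition boundary_trace ::
  "(real^'n::finite) set \<Rightarrow> (real^'n \<Rightarrow> real^'n) \<Rightarrow> real^'n \<Rightarrow> real^'n" where
  "boundary_trace \<Omega> v = (SOME z. has_trace \<Omega> v z)"

definition V_space :: "(real^'n::finite) set \<Rightarrow> (real^'n) set \<Rightarrow> (real^'n \<Rightarrow> real^'n) set" where
  "V_space \<Omega> \<Gamma>D =
     {v \<in> H1 \<Omega>. \<exists>z. has_trace \<Omega> v z \<and> (AE x in surface_on \<Gamma>D. z x = 0)}"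

definition neumann_part :: "(real^'n::finite) set \<Rightarrow> (real^'n) set \<Rightarrow> (real^'n) set" where
  "neumann_part \<Omega> \<Gamma>D = frontier \<Omega> - closure \<Gamma>D"

definition has_neumann_trace ::
  "(real^'n::finite) set \<Rightarrow> (real^'n) set \<Rightarrow> (real^'n \<Rightarrow> real^'n) \<Rightarrow> (real^'n \<Rightarrow> real^'n) \<Rightarrow> bool" where
  "has_neumann_trace \<Omega> \<Gamma>D v w \<longleftrightarrow>
     (\<exists>z. has_trace \<Omega> v z \<and> (AE x in surface_on (neumann_part \<Omega> \<Gamma>D). w x = z x))"

definition trace_space :: "(real^'n::finite) set \<Rightarrow> (real^'n) set \<Rightarrow> (real^'n \<Rightarrow> real^'n) set" where
  "trace_space \<Omega> \<Gamma>D = {w. \<exists>v\<in>V_space \<Omega> \<Gamma>D. has_neumann_trace \<Omega> \<Gamma>D v w}"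

text \<open>The trace (quotient) norm: the smallest norm of an extension in \<open>V_space \<Omega> \<Gamma>D\<close>.\<close>

definition trace_norm ::
  "(real^'n::finite) set \<Rightarrow> (real^'n) set \<Rightarrow> (real^'n \<Rightarrow> real^'n) \<Rightarrow> real" where
  "trace_norm \<Omega> \<Gamma>D w = (INF v\<in>{v \<in> V_space \<Omega> \<Gamma>D. has_neumann_trace \<Omega> \<Gamma>D v w}. norm_1 \<Omega> v)"

definition sym_matrices :: "(real^'n::finite^'n) set" where
  "sym_matrices = {\<tau>. transpose \<tau> = \<tau>}"

definition deviatoric_matrices :: "(real^'n::finite^'n) set" where
  "deviatoric_matrices = {\<tau> \<in> sym_matrices. trace \<tau> = 0}"

definition Q_space :: "(real^'n::finite) set \<Rightarrow> (real^'n \<Rightarrow> real^'n^'n) set" where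
  "Q_space \<Omega> = {q \<in> L2 (lebesgue_on \<Omega>). AE x in lebesgue_on \<Omega>. q x \<in> deviatoric_matrices}"

definition norm_VQ ::
  "(real^'n::finite) set \<Rightarrow> (real^'n \<Rightarrow> real^'n) \<Rightarrow> (real^'n \<Rightarrow> real^'n^'n) \<Rightarrow> real" where
  "norm_VQ \<Omega> v q = sqrt ((norm_1 \<Omega> v)\<^sup>2 + (L2_norm (lebesgue_on \<Omega>) q)\<^sup>2)"

definition tensor_apply :: "real^'n::finite^'n^'n^'n \<Rightarrow> real^'n^'n \<Rightarrow> real^'n^'n" where
  "tensor_apply A \<tau> = (\<chi> i j. \<Sum>k\<in>UNIV. \<Sum>l\<in>UNIV. A $ i $ j $ k $ l * \<tau> $ k $ l)"

definition material_tensor ::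
  "(real^'n::finite) set \<Rightarrow> real \<Rightarrow> (real^'n \<Rightarrow> real^'n^'n^'n^'n) \<Rightarrow> bool" where
  "material_tensor \<Omega> c A \<longleftrightarrow>
     (\<forall>i j k l. (\<lambda>x. A x $ i $ j $ k $ l) \<in> Linfty (lebesgue_on \<Omega>)) \<and>
     (AE x in lebesgue_on \<Omega>. \<forall>i j k l.
        A x $ i $ j $ k $ l = A x $ j $ i $ l $ k \<and> A x $ i $ j $ k $ l = A x $ k $ l $ i $ j) \<and>
     (\<forall>\<tau>\<in>L2 (lebesgue_on \<Omega>). (AE x in lebesgue_on \<Omega>. \<tau> x \<in> sym_matrices) \<longrightarrow>
        (AE x in lebesgue_on \<Omega>. tensor_apply (A x) (\<tau> x) \<bullet> \<tau> x \<ge> c * (norm (\<tau> x))\<^sup>2))"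

definition stress ::
  "(real^'n::finite) set \<Rightarrow> (real^'n \<Rightarrow> real^'n^'n^'n^'n) \<Rightarrow>
     (real^'n \<Rightarrow> real^'n) \<Rightarrow> (real^'n \<Rightarrow> real^'n^'n) \<Rightarrow> real^'n \<Rightarrow> real^'n^'n" where
  "stress \<Omega> \<C> u p x = tensor_apply (\<C> x) (strain \<Omega> u x - p x)"

definition a_form ::
  "(real^'n::finite) set \<Rightarrow> (real^'n \<Rightarrow> real^'n^'n^'n^'n) \<Rightarrow> (real^'n \<Rightarrow> real^'n^'n^'n^'n) \<Rightarrow>
     (real^'n \<Rightarrow> real^'n) \<times> (real^'n \<Rightarrow> real^'n^'n) \<Rightarrow>
     (real^'n \<Rightarrow> real^'n) \<times> (real^'n \<Rightarrow> real^'n^'n) \<Rightarrow> real" where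
  "a_form \<Omega> \<C> \<H> = (\<lambda>(u, p) (v, q).
     L2_inner (lebesgue_on \<Omega>) (stress \<Omega> \<C> u p) (\<lambda>x. strain \<Omega> v x - q x) +
     L2_inner (lebesgue_on \<Omega>) (\<lambda>x. tensor_apply (\<H> x) (p x)) q)"

definition load ::
  "(real^'n::finite) set \<Rightarrow> ((real^'n \<Rightarrow> real^'n) \<Rightarrow> real) \<Rightarrow> ((real^'n \<Rightarrow> real^'n) \<Rightarrow> real) \<Rightarrow>
     (real^'n \<Rightarrow> real^'n) \<Rightarrow> real" where
  "load \<Omega> f g v = f v + g (boundary_trace \<Omega> v)"

definition ref_cell :: "(real^'n::finite) set" where
  "ref_cell = cbox (- 1) 1"

definition tensor_polys :: "nat \<Rightarrow> (real^'n::finite \<Rightarrow> real) set" where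
  "tensor_polys k =
     {P. \<exists>c :: ('n \<Rightarrow> nat) \<Rightarrow> real. \<forall>x.
        P x = (\<Sum>\<alpha>\<in>{\<alpha>. \<forall>i. \<alpha> i \<le> k}. c \<alpha> * (\<Prod>i\<in>UNIV. (x $ i) ^ \<alpha> i))}"

text \<open>
  Roots of the Legendre polynomial of degree \<open>n\<close>, which by Rodrigues' formula is a nonzero multiple
  of the \<open>n\<close>-th derivative of \<open>(x^2 - 1)^n\<close>.
\<close>

definition gauss_legendre_nodes :: "nat \<Rightarrow> real set" where
  "gauss_legendre_nodes n = {t. poly ((pderiv ^^ n) ([:- 1, 0, 1:] ^ n)) t = 0}"

definition gauss_points :: "nat \<Rightarrow> (real^'n::finite) set" where
  "gauss_points n = {x. \<forall>i. x $ i \<in> gauss_legendre_nodes n}"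

text \<open>
  \<open>F T\<close> is a multilinear polynomial map on the whole space, mapping the reference cell bijectively
  onto \<open>T\<close>.
\<close>

definition fe_mesh ::
  "(real^'n::finite) set \<Rightarrow> (real^'n) set set \<Rightarrow> ((real^'n) set \<Rightarrow> real^'n \<Rightarrow> real^'n) \<Rightarrow> bool" where
  "fe_mesh \<Omega> \<T> F \<longleftrightarrow>
     finite \<T> \<and> \<Union>\<T> = closure \<Omega> \<and>
     (\<forall>T\<in>\<T>. \<forall>T'\<in>\<T>. T \<noteq> T' \<longrightarrow> interior T \<inter> interior T' = {}) \<and>
     (\<forall>T\<in>\<T>. (\<forall>i. (\<lambda>x. F T x $ i) \<in> tensor_polys 1) \<and> bij_betw (F T) ref_cell T)"

definition comparable_on_neighbors :: "real \<Rightarrow> 'a set set \<Rightarrow> ('a set \<Rightarrow> real) \<Rightarrow> bool" where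
  "comparable_on_neighbors \<kappa> \<T> h \<longleftrightarrow> (\<forall>T\<in>\<T>. \<forall>T'\<in>\<T>. T \<inter> T' \<noteq> {} \<longrightarrow> h T \<le> \<kappa> * h T')"

text \<open>
  \<open>represents_on \<Omega> F T P w\<close>: the restriction of \<open>w\<close> to \<open>T\<close>, composed with \<open>F T\<close>, is \<open>P\<close> (in the
  almost everywhere sense). A tensor-product polynomial \<open>P\<close> is determined by \<open>w\<close>; its value at a
  point \<open>y\<close> of the reference cell is the value of the restriction of \<open>w\<close> to \<open>T\<close> at \<open>F T y\<close>.
\<close>

definition represents_on ::
  "(real^'n::finite) set \<Rightarrow> ((real^'n) set \<Rightarrow> real^'n \<Rightarrow> real^'n) \<Rightarrow> (real^'n) set \<Rightarrow>
     (real^'n \<Rightarrow> 'b) \<Rightarrow> (real^'n \<Rightarrow> 'b) \<Rightarrow> bool" where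
  "represents_on \<Omega> F T P w \<longleftrightarrow>
     (AE x in lebesgue_on \<Omega>. x \<in> T \<longrightarrow> w x = P (the_inv_into ref_cell (F T) x))"

definition V_hp ::
  "(real^'n::finite) set \<Rightarrow> (real^'n) set \<Rightarrow> (real^'n) set set \<Rightarrow>
     ((real^'n) set \<Rightarrow> real^'n \<Rightarrow> real^'n) \<Rightarrow> ((real^'n) set \<Rightarrow> nat) \<Rightarrow> (real^'n \<Rightarrow> real^'n) set" where
  "V_hp \<Omega> \<Gamma>D \<T> F deg = {v \<in> V_space \<Omega> \<Gamma>D. \<forall>T\<in>\<T>. \<exists>P.
     (\<forall>i. (\<lambda>y. P y $ i) \<in> tensor_polys (deg T)) \<and> represents_on \<Omega> F T P v}"

definition Q_hp ::
  "(real^'n::finite) set \<Rightarrow> (real^'n) set set \<Rightarrow>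
     ((real^'n) set \<Rightarrow> real^'n \<Rightarrow> real^'n) \<Rightarrow> ((real^'n) set \<Rightarrow> nat) \<Rightarrow> (real^'n \<Rightarrow> real^'n^'n) set" where
  "Q_hp \<Omega> \<T> F deg = {q \<in> Q_space \<Omega>. \<forall>T\<in>\<T>. \<exists>P.
     (\<forall>i j. (\<lambda>y. P y $ i $ j) \<in> tensor_polys (deg T - 1)) \<and> represents_on \<Omega> F T P q}"

definition Lambda_hp ::
  "(real^'n::finite) set \<Rightarrow> (real^'n) set set \<Rightarrow>
     ((real^'n) set \<Rightarrow> real^'n \<Rightarrow> real^'n) \<Rightarrow> ((real^'n) set \<Rightarrow> nat) \<Rightarrow> real \<Rightarrow>
     (real^'n \<Rightarrow> real^'n^'n) set" where
  "Lambda_hp \<Omega> \<T> F deg \<sigma>y = {\<mu> \<in> Q_hp \<Omega> \<T> F deg. \<forall>T\<in>\<T>. \<exists>P.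
     (\<forall>i j. (\<lambda>y. P y $ i $ j) \<in> tensor_polys (deg T - 1)) \<and> represents_on \<Omega> F T P \<mu> \<and>
     (\<forall>y\<in>gauss_points (deg T). norm (P y) \<le> \<sigma>y)}"

definition discrete_solution ::
  "(real^'n::finite) set \<Rightarrow> (real^'n) set \<Rightarrow>
     (real^'n \<Rightarrow> real^'n^'n^'n^'n) \<Rightarrow> (real^'n \<Rightarrow> real^'n^'n^'n^'n) \<Rightarrow>
     ((real^'n \<Rightarrow> real^'n) \<Rightarrow> real) \<Rightarrow> ((real^'n \<Rightarrow> real^'n) \<Rightarrow> real) \<Rightarrow> real \<Rightarrow>
     (real^'n) set set \<Rightarrow> ((real^'n) set \<Rightarrow> real^'n \<Rightarrow> real^'n) \<Rightarrow> ((real^'n) set \<Rightarrow> nat) \<Rightarrow>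
     (real^'n \<Rightarrow> real^'n) \<Rightarrow> (real^'n \<Rightarrow> real^'n^'n) \<Rightarrow> (real^'n \<Rightarrow> real^'n^'n) \<Rightarrow> bool" where
  "discrete_solution \<Omega> \<Gamma>D \<C> \<H> f g \<sigma>y \<T> F deg u p lam \<longleftrightarrow>
     u \<in> V_hp \<Omega> \<Gamma>D \<T> F deg \<and> p \<in> Q_hp \<Omega> \<T> F deg \<and> lam \<in> Lambda_hp \<Omega> \<T> F deg \<sigma>y \<and>
     (\<forall>v\<in>V_hp \<Omega> \<Gamma>D \<T> F deg. \<forall>q\<in>Q_hp \<Omega> \<T> F deg.
        a_form \<Omega> \<C> \<H> (u, p) (v, q) + L2_inner (lebesgue_on \<Omega>) lam q = load \<Omega> f g v) \<and>
     (\<forall>\<mu>\<in>Lambda_hp \<Omega> \<T> F deg \<sigma>y. L2_inner (lebesgue_on \<Omega>) (\<lambda>x. \<mu> x - lam x) p \<le> 0)"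

end

theory Submission
  imports Defs "HOL-Library.Function_Algebras"
begin

text \<open>
  The multiplier can be eliminated. On \<open>X = V_hp \<times> Q_hp\<close> the form \<open>a\<close> is an inner product (up to
  functions vanishing almost everywhere), so every \<open>\<lambda>\<close> in \<open>\<Lambda>_hp\<close> determines the state \<open>x\<^sub>\<lambda>\<close> in \<open>X\<close>
  that solves the equation of the mixed problem: the Riesz representative of the load minus the
  representative of the functional \<open>(\<lambda>, \<cdot>)\<close>. The inequality of the mixed problem says precisely
  that \<open>\<lambda>\<close> minimises \<open>a x\<^sub>\<lambda> x\<^sub>\<lambda>\<close> over the convex set \<open>\<Lambda>_hp\<close>: representing \<open>(\<lambda>, \<cdot>)\<close> in \<open>X\<close>, one
  projects the representative of the load onto the image of \<open>\<Lambda>_hp\<close>. Testing with \<open>(0, \<lambda>)\<close> bounds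
  \<open>\<lambda>\<close> by \<open>ca\<close> times the norm of \<open>x\<^sub>\<lambda>\<close>, so minimising sequences are bounded, and in finite
  dimension they have convergent subsequences. Theorem \<open>mixed_problem_solvable\<close> is this argument in
  an abstract setting. Uniqueness and both bounds come from testing with the solution itself, with
  the difference of two solutions, and with \<open>(0, \<lambda>)\<close>.

  Two points need care. The first is that \<open>a\<close> is bilinear and the load linear on function
  representatives: strains are built from a chosen weak gradient and loads from a chosen trace.
  Weak gradients are unique almost everywhere by the fundamental lemma of the calculus of variations
  (\<open>fundamental_lemma_of_variations\<close>), for which explicit smooth bump functions on boxes are
  constructed. A trace of the zero function has trace norm zero, so the surface load does not see
  which trace is chosen (\<open>load_linear_bounded\<close>).

  The second is that \<open>\<Lambda>_hp\<close> is closed, although its constraint concerns values of polynomials at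
  Gauss points, whose continuity in the \<open>L2\<close> norm is not evident. The minimisation
  therefore runs over pairs \<open>(\<lambda>, P)\<close> of a multiplier and its local polynomials, with the inner
  product \<open>multiplier_form\<close> that adds the Gauss point values to the \<open>L2\<close> product. In it the
  constraint is visibly closed, and it is itself the bound on the second component of a minimising
  sequence.
\<close>

section \<open>Finite-dimensional semi-inner product spaces\<close>

text \<open>
  With pointwise operations, spaces of functions and of pairs of functions become subspaces in the
  sense of \<^const>\<open>subspace\<close>.
\<close>

instantiation "fun" :: (type, real_vector) real_vector
begin

definition "c *\<^sub>R f = (\<lambda>x. c *\<^sub>R f x)"

instance
  by standard (simp_all add: fun_eq_iff scaleR_fun_def algebra_simps)

end

lemma scaleR_fun_apply [simp]: "(c *\<^sub>R f) x = c *\<^sub>R f x"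
  by (simp add: scaleR_fun_def)

lemma sum_fun_apply: "(\<Sum>j\<in>J. f j) x = (\<Sum>j\<in>J. f j x)"
  by (induction J rule: infinite_finite_induct) auto

text \<open>
  Gaussian elimination of one unknown: if row \<open>i\<close> has a nonzero entry in column \<open>k\<close>, it expresses
  the unknown \<open>k\<close> by the others, and substitution leaves one equation and one unknown fewer.
\<close>

lemma homogeneous_system_nontrivial:
  fixes M :: "'i \<Rightarrow> 'j \<Rightarrow> real"
  assumes "finite I" "finite J" "card I < card J"
  shows "\<exists>a. (\<exists>j\<in>J. a j \<noteq> 0) \<and> (\<forall>i\<in>I. (\<Sum>j\<in>J. a j * M i j) = 0)"
  using assms
proof (induction I arbitrary: J M rule: finite_induct)
  case empty
  then have "J \<noteq> {}" by auto
  then show ?case by (intro exI[of _ "\<lambda>_. 1"]) auto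
next
  case (insert i I)
  show ?case
  proof (cases "\<forall>j\<in>J. M i j = 0")
    case True
    have "card I < card J" using insert by auto
    from insert.IH[OF insert.prems(1) this, of M] True show ?thesis
      by (auto intro!: sum.neutral)
  next
    case False
    then obtain k where k: "k \<in> J" "M i k \<noteq> 0" by auto
    define M' where "M' i' j = M i' j - M i' k * M i j / M i k" for i' j
    have "card I < card (J - {k})" using insert k by auto
    from insert.IH[OF _ this, of M'] insert.prems obtain a
      where a: "\<exists>j\<in>J-{k}. a j \<noteq> 0" "\<And>i'. i' \<in> I \<Longrightarrow> (\<Sum>j\<in>J-{k}. a j * M' i' j) = 0" by auto
    define s where "s = (\<Sum>j\<in>J-{k}. a j * M i j)"
    define a' where "a' = a(k := - s / M i k)"
    have split: "(\<Sum>j\<in>J. a' j * M i' j) = (\<Sum>j\<in>J-{k}. a j * M i' j) - s / M i k * M i' k" for i'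
    proof -
      have "(\<Sum>j\<in>J. a' j * M i' j) = a' k * M i' k + (\<Sum>j\<in>J-{k}. a' j * M i' j)"
        using insert.prems k by (simp add: sum.remove)
      moreover have "(\<Sum>j\<in>J-{k}. a' j * M i' j) = (\<Sum>j\<in>J-{k}. a j * M i' j)"
        by (intro sum.cong) (auto simp: a'_def)
      ultimately show ?thesis by (simp add: a'_def)
    qed
    have "(\<Sum>j\<in>J. a' j * M i' j) = 0" if "i' \<in> I" for i'
    proof -
      have "0 = (\<Sum>j\<in>J-{k}. a j * M i' j) - (\<Sum>j\<in>J-{k}. a j * M i j) * (M i' k / M i k)"
        using a(2)[OF that] by (simp add: M'_def algebra_simps sum_subtractf sum_distrib_left)
      then show ?thesis by (simp add: split s_def)
    qed
    moreover have "(\<Sum>j\<in>J. a' j * M i j) = 0" using k by (simp add: split s_def)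
    moreover have "\<exists>j\<in>J. a' j \<noteq> 0" using a(1) by (auto simp: a'_def)
    ultimately show ?thesis by blast
  qed
qed

text \<open>
  Bolzano--Weierstrass for finitely many real coordinates, refining the subsequence once per
  coordinate.
\<close>

lemma simultaneous_convergent_subsequence:
  fixes f :: "nat \<Rightarrow> 'e \<Rightarrow> real"
  assumes "finite E" "\<And>n e. e \<in> E \<Longrightarrow> \<bar>f n e\<bar> \<le> C"
  shows "\<exists>r l. strict_mono (r :: nat \<Rightarrow> nat) \<and> (\<forall>e\<in>E. (\<lambda>n. f (r n) e) \<longlonglongrightarrow> l e)"
  using assms
proof (induction E rule: finite_induct)
  case empty
  show ?case by (intro exI[of _ id]) (auto simp: strict_mono_def)
next
  case (insert e E)
  then obtain r l where r: "strict_mono r" "\<forall>e\<in>E. (\<lambda>n. f (r n) e) \<longlonglongrightarrow> l e" by auto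
  have "bounded (range (\<lambda>n. f (r n) e))"
    using insert.prems by (auto simp: bounded_iff)
  from bounded_imp_convergent_subsequence[OF this]
  obtain m s where s: "strict_mono s" "((\<lambda>n. f (r n) e) \<circ> s) \<longlonglongrightarrow> m" by auto
  have "(\<lambda>n. f ((r \<circ> s) n) e') \<longlonglongrightarrow> (l(e := m)) e'" if "e' \<in> insert e E" for e'
  proof (cases "e' = e")
    case True then show ?thesis using s by (simp add: o_def)
  next
    case False
    with that r(2) have "(\<lambda>n. f (r n) e') \<longlonglongrightarrow> l e'" by auto
    from LIMSEQ_subseq_LIMSEQ[OF this s(1)] False show ?thesis by (auto simp: o_def)
  qed
  moreover have "strict_mono (r \<circ> s)" using r s by (simp add: strict_mono_o)
  ultimately show ?case by blast
qed

text \<open>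
  The \<open>L2\<close> product and \<open>a\<close> vanish on functions that are zero almost everywhere, so they are only
  semidefinite on functions. Working with carriers and semidefinite forms avoids quotient types.
\<close>

locale semi_inner =
  fixes X :: "'x::real_vector set" and B :: "'x \<Rightarrow> 'x \<Rightarrow> real"
  assumes subspace: "subspace X"
    and add_left: "\<And>x y z. x \<in> X \<Longrightarrow> y \<in> X \<Longrightarrow> z \<in> X \<Longrightarrow> B (x + y) z = B x z + B y z"
    and scale_left: "\<And>c x z. x \<in> X \<Longrightarrow> z \<in> X \<Longrightarrow> B (c *\<^sub>R x) z = c * B x z"
    and sym: "\<And>x y. x \<in> X \<Longrightarrow> y \<in> X \<Longrightarrow> B x y = B y x"
    and nonneg: "\<And>x. x \<in> X \<Longrightarrow> 0 \<le> B x x"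
begin

lemma mem [intro]: "x \<in> X \<Longrightarrow> y \<in> X \<Longrightarrow> x + y \<in> X" "x \<in> X \<Longrightarrow> c *\<^sub>R x \<in> X"
  "x \<in> X \<Longrightarrow> y \<in> X \<Longrightarrow> x - y \<in> X" "0 \<in> X"
  using subspace by (auto simp: subspace_add subspace_scale subspace_diff subspace_0)

lemma mem_sum: "(\<And>e. e \<in> E \<Longrightarrow> f e \<in> X) \<Longrightarrow> (\<Sum>e\<in>E. f e) \<in> X"
  using subspace by (rule subspace_sum)

lemma add_right: "x \<in> X \<Longrightarrow> y \<in> X \<Longrightarrow> z \<in> X \<Longrightarrow> B z (x + y) = B z x + B z y"
  by (metis add_left mem(1) sym)

lemma scale_right: "x \<in> X \<Longrightarrow> z \<in> X \<Longrightarrow> B z (c *\<^sub>R x) = c * B z x"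
  by (metis scale_left mem(2) sym)

lemma zero_left: "x \<in> X \<Longrightarrow> B 0 x = 0"
  using scale_left[of x x 0] by simp

lemma diff_left: "x \<in> X \<Longrightarrow> y \<in> X \<Longrightarrow> z \<in> X \<Longrightarrow> B (x - y) z = B x z - B y z"
  using add_left[of "x - y" y z] by (auto simp: mem)

lemma diff_right: "x \<in> X \<Longrightarrow> y \<in> X \<Longrightarrow> z \<in> X \<Longrightarrow> B z (x - y) = B z x - B z y"
  using add_right[of "x - y" y z] by (auto simp: mem)

lemma sum_left: "z \<in> X \<Longrightarrow> (\<And>e. e \<in> E \<Longrightarrow> f e \<in> X) \<Longrightarrow> B (\<Sum>e\<in>E. f e) z = (\<Sum>e\<in>E. B (f e) z)"
  by (induction E rule: infinite_finite_induct) (auto simp: zero_left add_left mem_sum)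

lemma expand: "x \<in> X \<Longrightarrow> y \<in> X \<Longrightarrow> B (x + t *\<^sub>R y) (x + t *\<^sub>R y) = B x x + 2 * t * B x y + t\<^sup>2 * B y y"
  by (simp add: mem add_left add_right scale_left scale_right sym[of y x] power2_eq_square algebra_simps)

lemma Cauchy_Schwarz:
  assumes "x \<in> X" "y \<in> X"
  shows "\<bar>B x y\<bar> \<le> sqrt (B x x) * sqrt (B y y)"
proof -
  have pos: "0 \<le> B x x + 2 * t * B x y + t\<^sup>2 * B y y" for t
    using nonneg[of "x + t *\<^sub>R y"] assms by (simp add: expand mem)
  have "(B x y)\<^sup>2 \<le> B x x * B y y"
  proof (cases "B y y = 0")
    case True
    have "B x y = 0"
    proof (rule ccontr)
      assume "B x y \<noteq> 0"
      then have "2 * (- (B x x + 1) / (2 * B x y)) * B x y = - (B x x + 1)" by simp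
      with pos[of "- (B x x + 1) / (2 * B x y)"] have "0 \<le> B x x - (B x x + 1) + 0"
        unfolding True by (metis diff_conv_add_uminus mult_zero_right)
      then show False by simp
    qed
    then show ?thesis using True by simp
  next
    case False
    then have "B y y > 0" using nonneg[OF assms(2)] by simp
    with pos[of "- B x y / B y y"] show ?thesis
      by (simp add: field_simps power2_eq_square)
  qed
  then have "sqrt ((B x y)\<^sup>2) \<le> sqrt (B x x * B y y)" by (rule real_sqrt_le_mono)
  then show ?thesis by (simp add: real_sqrt_mult)
qed

lemma null_left: "x \<in> X \<Longrightarrow> y \<in> X \<Longrightarrow> B x x = 0 \<Longrightarrow> B x y = 0"
  using Cauchy_Schwarz[of x y] by simp

definition orthonormal :: "'x set \<Rightarrow> bool" where
  "orthonormal E \<longleftrightarrow> finite E \<and> E \<subseteq> X \<and> (\<forall>e\<in>E. \<forall>e'\<in>E. B e e' = (if e = e' then 1 else 0))"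

text \<open>
  Coordinates \<open>\<kappa>\<close> in \<open>I\<close> that detect null vectors bound the dimension. The coordinates of each
  vector may be picked by choice, as polynomial coefficients of functions known up to null sets
  are; what counts is that a vanishing combination of coordinates comes with a null combination of
  the vectors. More than \<open>card I\<close> orthonormal vectors would admit such a combination with a
  nonzero coefficient, and pairing it with the vectors shows that all coefficients vanish.
\<close>

lemma orthonormal_card_le:
  fixes \<kappa> :: "'x \<Rightarrow> 'i \<Rightarrow> real"
  assumes "finite I"
    and null: "\<And>J a. finite J \<Longrightarrow> J \<subseteq> X \<Longrightarrow> \<forall>i\<in>I. (\<Sum>x\<in>J. a x * \<kappa> x i) = 0 \<Longrightarrow>
      B (\<Sum>x\<in>J. a x *\<^sub>R x) (\<Sum>x\<in>J. a x *\<^sub>R x) = 0"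
    and E: "orthonormal E"
  shows "card E \<le> card I"
proof (rule ccontr)
  assume "\<not> card E \<le> card I"
  then obtain a where a: "\<exists>e\<in>E. a e \<noteq> 0" "\<forall>i\<in>I. (\<Sum>e\<in>E. a e * \<kappa> e i) = 0"
    using homogeneous_system_nontrivial[OF \<open>finite I\<close>, of E "\<lambda>i e. \<kappa> e i"] E
    by (auto simp: orthonormal_def)
  define s where "s = (\<Sum>e\<in>E. a e *\<^sub>R e)"
  have EX: "e \<in> X" if "e \<in> E" for e using E that by (auto simp: orthonormal_def)
  have "B s s = 0" unfolding s_def using E a(2) by (intro null) (auto simp: orthonormal_def)
  moreover have "s \<in> X" unfolding s_def using EX by (auto intro!: mem_sum)
  ultimately have "B s e = 0" if "e \<in> E" for e using null_left EX that by blast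
  moreover have "B s e = a e" if "e \<in> E" for e
  proof -
    have "B s e = (\<Sum>e'\<in>E. a e' * B e' e)"
      unfolding s_def using EX that by (subst sum_left) (auto simp: scale_left)
    also have "\<dots> = (\<Sum>e'\<in>E. if e' = e then a e' else 0)"
      using E that by (intro sum.cong) (auto simp: orthonormal_def)
    finally show ?thesis using E that by (simp add: orthonormal_def)
  qed
  ultimately show False using a(1) by auto
qed

end

locale finite_semi_inner = semi_inner +
  assumes rank: "\<exists>N. \<forall>E. orthonormal E \<longrightarrow> card E \<le> N"
begin

text \<open>
  An orthonormal family of maximal size is a basis up to null vectors: a residual of positive
  length, normalised, would enlarge the family.
\<close>

lemma orthonormal_basis:
  obtains E where "orthonormal E"
    "\<And>x y. x \<in> X \<Longrightarrow> y \<in> X \<Longrightarrow> B x y = (\<Sum>e\<in>E. B x e * B y e)"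
proof -
  obtain N where "\<And>E. orthonormal E \<Longrightarrow> card E \<le> N" using rank by auto
  moreover have "orthonormal {}" by (simp add: orthonormal_def)
  ultimately obtain E where E: "orthonormal E" "\<And>E'. orthonormal E' \<Longrightarrow> card E' \<le> card E"
    using ex_has_greatest_nat[of orthonormal "{}" card "Suc N"] by (meson le_imp_less_Suc)
  have EX: "e \<in> X" if "e \<in> E" for e using E that by (auto simp: orthonormal_def)
  have fin: "finite E" using E by (simp add: orthonormal_def)
  have expansion: "B x y = (\<Sum>e\<in>E. B x e * B y e)" if "x \<in> X" "y \<in> X" for x y
  proof -
    define p where "p = (\<Sum>e\<in>E. B x e *\<^sub>R e)"
    define r where "r = x - p"
    have pX: "p \<in> X" unfolding p_def using EX by (auto intro!: mem_sum)
    then have rX: "r \<in> X" unfolding r_def using that by auto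
    have p: "B p z = (\<Sum>e\<in>E. B x e * B z e)" if "z \<in> X" for z
    proof -
      have "B (B x e *\<^sub>R e) z = B x e * B z e" if "e \<in> E" for e
        using sym[of z e] EX[OF that] \<open>z \<in> X\<close> by (simp add: scale_left)
      then show ?thesis unfolding p_def using EX that by (subst sum_left) auto
    qed
    have orth: "B r e = 0" if "e \<in> E" for e
    proof -
      have "B p e = (\<Sum>e'\<in>E. B x e' * B e e')" using p EX[OF that] by simp
      also have "\<dots> = (\<Sum>e'\<in>E. if e' = e then B x e' else 0)"
        using E that by (intro sum.cong) (auto simp: orthonormal_def)
      also have "\<dots> = B x e" using fin that by simp
      finally show ?thesis using that EX \<open>x \<in> X\<close> pX by (simp add: r_def diff_left)
    qed
    have "B r r = 0"
    proof (rule ccontr)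
      assume "B r r \<noteq> 0"
      then have pos: "B r r > 0" using nonneg[OF rX] by simp
      define u where "u = (1 / sqrt (B r r)) *\<^sub>R r"
      have uX: "u \<in> X" using rX by (auto simp: u_def)
      have "B u u = 1" using pos rX by (simp add: u_def scale_left scale_right mem)
      moreover have ue: "B u e = 0" if "e \<in> E" for e
        using orth[OF that] rX EX that by (simp add: u_def scale_left)
      moreover have "u \<notin> E"
      proof
        assume "u \<in> E" from ue[OF this] \<open>B u u = 1\<close> show False by simp
      qed
      moreover have "B e u = 0" if "e \<in> E" for e
        using ue[OF that] sym[OF uX EX[OF that]] by simp
      ultimately have "orthonormal (insert u E)"
        using E(1) uX by (auto simp: orthonormal_def)
      from E(2)[OF this] \<open>u \<notin> E\<close> fin show False by simp
    qed
    then have "B r y = 0" using null_left rX that by auto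
    then show ?thesis using that pX p by (simp add: r_def diff_left)
  qed
  from that[OF E(1) expansion] show ?thesis .
qed

lemma Riesz_representation:
  assumes add: "\<And>x y. x \<in> X \<Longrightarrow> y \<in> X \<Longrightarrow> L (x + y) = L x + L y"
    and scale: "\<And>c x. x \<in> X \<Longrightarrow> L (c *\<^sub>R x) = c * L x"
    and null: "\<And>x. x \<in> X \<Longrightarrow> B x x = 0 \<Longrightarrow> L x = 0"
  shows "\<exists>r\<in>X. \<forall>x\<in>X. B r x = L x"
proof -
  obtain E where E: "orthonormal E" and exp: "\<And>x y. x \<in> X \<Longrightarrow> y \<in> X \<Longrightarrow> B x y = (\<Sum>e\<in>E. B x e * B y e)"
    using orthonormal_basis by blast
  have EX: "e \<in> X" if "e \<in> E" for e using E that by (auto simp: orthonormal_def)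
  have L_sum: "L (\<Sum>e\<in>F. f e) = (\<Sum>e\<in>F. L (f e))" if "finite F" "\<And>e. e \<in> F \<Longrightarrow> f e \<in> X" for F :: "'a set" and f
    using that scale[of 0 0] by (induction F) (auto simp: add mem_sum mem)
  define r where "r = (\<Sum>e\<in>E. L e *\<^sub>R e)"
  have "B r x = L x" if x: "x \<in> X" for x
  proof -
    define p where "p = (\<Sum>e\<in>E. B x e *\<^sub>R e)"
    have pX: "p \<in> X" unfolding p_def using EX by (auto intro!: mem_sum)
    have pe: "B p e = B x e" if "e \<in> E" for e
    proof -
      have "B p e = (\<Sum>e'\<in>E. B x e' * B e' e)"
        unfolding p_def using EX that by (subst sum_left) (auto simp: scale_left)
      also have "\<dots> = (\<Sum>e'\<in>E. if e' = e then B x e' else 0)"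
        using E that by (intro sum.cong) (auto simp: orthonormal_def)
      finally show ?thesis using E that by (simp add: orthonormal_def)
    qed
    have "B (x - p) e = 0" if "e \<in> E" for e
      using pe[OF that] EX[OF that] x pX by (simp add: diff_left)
    then have "B (x - p) (x - p) = 0"
      using exp[of "x - p" "x - p"] x pX by (simp add: mem)
    then have "L (x - p) = 0" using null x pX by blast
    moreover have "L ((x - p) + p) = L (x - p) + L p" using x pX by (intro add) auto
    ultimately have "L x = L p" by simp
    also have "\<dots> = (\<Sum>e\<in>E. B x e * L e)"
      unfolding p_def using E EX by (subst L_sum) (auto simp: orthonormal_def scale)
    also have "\<dots> = B r x"
    proof -
      have "B (L e *\<^sub>R e) x = B x e * L e" if "e \<in> E" for e
        using sym[of x e] EX[OF that] x by (simp add: scale_left)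
      then show ?thesis unfolding r_def using EX x by (subst sum_left) auto
    qed
    finally show ?thesis by simp
  qed
  moreover have "r \<in> X" unfolding r_def using EX by (auto intro!: mem_sum)
  ultimately show ?thesis by blast
qed

lemma Bolzano_Weierstrass:
  assumes z: "\<And>n. z n \<in> X" and bd: "\<And>n. B (z n) (z n) \<le> C"
  shows "\<exists>r w. strict_mono (r :: nat \<Rightarrow> nat) \<and> w \<in> X \<and> (\<lambda>n. B (z (r n) - w) (z (r n) - w)) \<longlonglongrightarrow> 0"
proof -
  obtain E where E: "orthonormal E" and exp: "\<And>x y. x \<in> X \<Longrightarrow> y \<in> X \<Longrightarrow> B x y = (\<Sum>e\<in>E. B x e * B y e)"
    using orthonormal_basis by blast
  have EX: "e \<in> X" if "e \<in> E" for e using E that by (auto simp: orthonormal_def)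
  have "\<bar>B (z n) e\<bar> \<le> sqrt C" if "e \<in> E" for n e
  proof -
    have "\<bar>B (z n) e\<bar> \<le> sqrt (B (z n) (z n)) * sqrt (B e e)"
      using z EX that by (intro Cauchy_Schwarz)
    also have "\<dots> = sqrt (B (z n) (z n))" using E that by (simp add: orthonormal_def)
    finally show ?thesis using bd[of n] by (meson order_trans real_sqrt_le_mono)
  qed
  moreover have "finite E" using E by (simp add: orthonormal_def)
  ultimately obtain r l where r: "strict_mono r" and l: "\<forall>e\<in>E. (\<lambda>n. B (z (r n)) e) \<longlonglongrightarrow> l e"
    using simultaneous_convergent_subsequence[of E "\<lambda>n. B (z n)" "sqrt C"] by blast
  define w where "w = (\<Sum>e\<in>E. l e *\<^sub>R e)"
  have wX: "w \<in> X" unfolding w_def using EX by (auto intro!: mem_sum)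
  have we: "B w e = l e" if "e \<in> E" for e
  proof -
    have "B w e = (\<Sum>e'\<in>E. l e' * B e' e)"
      unfolding w_def using EX that by (subst sum_left) (auto simp: scale_left)
    also have "\<dots> = (\<Sum>e'\<in>E. if e' = e then l e' else 0)"
      using E that by (intro sum.cong) (auto simp: orthonormal_def)
    finally show ?thesis using E that by (simp add: orthonormal_def)
  qed
  have "B (z (r n) - w) (z (r n) - w) = (\<Sum>e\<in>E. (B (z (r n)) e - l e)\<^sup>2)" for n
    using z wX EX we by (subst exp) (auto simp: diff_left power2_eq_square mem intro!: sum.cong)
  moreover have "(\<lambda>n. \<Sum>e\<in>E. (B (z (r n)) e - l e)\<^sup>2) \<longlonglongrightarrow> (\<Sum>e\<in>E. (l e - l e)\<^sup>2)"
    using l by (intro tendsto_intros) auto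
  ultimately have "(\<lambda>n. B (z (r n) - w) (z (r n) - w)) \<longlonglongrightarrow> 0" by simp
  with r wX show ?thesis by blast
qed

end

text \<open>
  Here \<open>S z\<close> is the state belonging to the multiplier \<open>z\<close>, and \<open>J z\<close> its energy. The hypothesis
  \<open>coercive\<close> bounds multipliers by the energy of their states. A minimiser of \<open>J\<close> over \<open>K\<close> exists by
  compactness, and the inequality is its first-order condition: along the segment from \<open>z\<close> to \<open>w\<close>
  the states form the segment from \<open>S z\<close> to \<open>S w\<close>, and the derivative of the energy at \<open>z\<close> is
  \<open>-2 * b (w - z) (S z)\<close>.
\<close>

theorem mixed_problem_solvable:
  fixes X :: "'x::real_vector set" and Z :: "'z::real_vector set"
  assumes "finite_semi_inner X a" "finite_semi_inner Z n"
    and L_add: "\<And>x y. x \<in> X \<Longrightarrow> y \<in> X \<Longrightarrow> L (x + y) = L x + L y"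
    and L_scale: "\<And>c x. x \<in> X \<Longrightarrow> L (c *\<^sub>R x) = c * L x"
    and L_null: "\<And>x. x \<in> X \<Longrightarrow> a x x = 0 \<Longrightarrow> L x = 0"
    and b_add1: "\<And>z w x. z \<in> Z \<Longrightarrow> w \<in> Z \<Longrightarrow> x \<in> X \<Longrightarrow> b (z + w) x = b z x + b w x"
    and b_scale1: "\<And>c z x. z \<in> Z \<Longrightarrow> x \<in> X \<Longrightarrow> b (c *\<^sub>R z) x = c * b z x"
    and b_add2: "\<And>z x y. z \<in> Z \<Longrightarrow> x \<in> X \<Longrightarrow> y \<in> X \<Longrightarrow> b z (x + y) = b z x + b z y"
    and b_scale2: "\<And>c z x. z \<in> Z \<Longrightarrow> x \<in> X \<Longrightarrow> b z (c *\<^sub>R x) = c * b z x"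
    and b_bound: "\<And>z x. z \<in> Z \<Longrightarrow> x \<in> X \<Longrightarrow> \<bar>b z x\<bar> \<le> \<beta> * sqrt (n z z) * sqrt (a x x)"
    and K: "K \<subseteq> Z" "K \<noteq> {}" "convex K"
    and K_closed: "\<And>k z. (\<And>i::nat. k i \<in> K) \<Longrightarrow> z \<in> Z \<Longrightarrow>
        (\<lambda>i. n (k i - z) (k i - z)) \<longlonglongrightarrow> 0 \<Longrightarrow> z \<in> K"
    and coercive: "\<And>z x. z \<in> K \<Longrightarrow> x \<in> X \<Longrightarrow> \<forall>y\<in>X. a x y + b z y = L y \<Longrightarrow>
        n z z \<le> \<gamma> + \<delta> * a x x" and \<delta>: "0 \<le> \<delta>"
  shows "\<exists>z\<in>K. \<exists>x\<in>X. (\<forall>y\<in>X. a x y + b z y = L y) \<and> (\<forall>w\<in>K. b (w - z) x \<le> 0)"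
proof -
  interpret a: finite_semi_inner X a by fact
  interpret n: finite_semi_inner Z n by fact
  have "\<exists>x\<in>X. \<forall>y\<in>X. a x y = L y - b z y" if "z \<in> Z" for z
  proof (rule a.Riesz_representation)
    show "L x - b z x = 0" if "x \<in> X" "a x x = 0" for x
      using L_null[OF that] b_bound[OF \<open>z \<in> Z\<close> that(1)] that(2) by simp
  qed (use that in \<open>auto simp: L_add L_scale b_add2 b_scale2 algebra_simps\<close>)
  then obtain S where S: "\<And>z. z \<in> Z \<Longrightarrow> S z \<in> X"
      "\<And>z y. z \<in> Z \<Longrightarrow> y \<in> X \<Longrightarrow> a (S z) y = L y - b z y"
    by metis
  define J where "J z = a (S z) (S z)" for z
  have Jpos: "0 \<le> J z" if "z \<in> Z" for z unfolding J_def by (rule a.nonneg[OF S(1)[OF that]])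
  have bdiff: "b (w - z) x = b w x - b z x" if "w \<in> Z" "z \<in> Z" "x \<in> X" for w z x
    using b_add1[of "w - z" z x] that by (simp add: n.mem)
  define m where "m = (INF z\<in>K. J z)"
  have bdd: "bdd_below (J ` K)" using Jpos K(1) by (auto intro!: bdd_belowI[of _ 0])
  have "\<exists>z\<in>K. J z < m + 1 / real (Suc i)" for i
    using K(2) bdd cINF_less_iff[of K J "m + 1 / real (Suc i)"] by (auto simp: m_def)
  then obtain k where k: "\<And>i. k i \<in> K" "\<And>i. J (k i) < m + 1 / real (Suc i)" by metis
  have kZ: "k i \<in> Z" for i using k K by auto
  have m_le: "m \<le> J z" if "z \<in> K" for z unfolding m_def using bdd that by (rule cINF_lower)
  have Jk: "(\<lambda>i. J (k i)) \<longlonglongrightarrow> m"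
  proof (rule real_tendsto_sandwich[where f = "\<lambda>i. m" and h = "\<lambda>i. m + 1 / real (Suc i)"])
    show "(\<lambda>i. m + 1 / real (Suc i)) \<longlonglongrightarrow> m"
      using tendsto_add[OF tendsto_const LIMSEQ_inverse_real_of_nat, of m] by (simp add: inverse_eq_divide)
    show "(\<lambda>i. m) \<longlonglongrightarrow> m" by simp
    show "\<forall>\<^sub>F i in sequentially. m \<le> J (k i)" using m_le k(1) by simp
    show "\<forall>\<^sub>F i in sequentially. J (k i) \<le> m + 1 / real (Suc i)"
      using k(2) by (intro always_eventually allI less_imp_le)
  qed
  have "n (k i) (k i) \<le> \<gamma> + \<delta> * (m + 1)" for i
  proof -
    have "n (k i) (k i) \<le> \<gamma> + \<delta> * J (k i)"
      unfolding J_def by (rule coercive[OF k(1) S(1)[OF kZ]]) (simp add: S(2)[OF kZ])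
    also have "J (k i) \<le> m + 1" using k(2)[of i] by (rule order.trans[OF less_imp_le]) simp
    finally show ?thesis using \<delta> by (simp add: mult_left_mono)
  qed
  from n.Bolzano_Weierstrass[of k, OF kZ this] obtain r z where r: "strict_mono r" and z: "z \<in> Z"
    and lim: "(\<lambda>i. n (k (r i) - z) (k (r i) - z)) \<longlonglongrightarrow> 0" by blast
  have zK: "z \<in> K" by (rule K_closed[OF _ z lim]) (rule k)
  have SX: "S z \<in> X" "S (k i) \<in> X" for i using S z kZ by auto
  define e where "e i = S (k (r i)) - S z" for i
  have eX: "e i \<in> X" for i unfolding e_def using SX by auto
  \<comment> \<open>testing the equation of the error with the error itself shows that \<open>S\<close> is Lipschitz\<close>
  have e_le: "sqrt (a (e i) (e i)) \<le> \<bar>\<beta>\<bar> * sqrt (n (k (r i) - z) (k (r i) - z))" for i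
  proof -
    let ?s = "sqrt (a (e i) (e i))" and ?t = "sqrt (n (k (r i) - z) (k (r i) - z))"
    have "a (e i) (e i) = - b (k (r i) - z) (e i)"
      unfolding e_def[of i, symmetric] using SX eX[of i] z kZ
      by (subst (1) e_def) (simp add: a.diff_left S bdiff)
    also have "\<dots> \<le> \<beta> * ?t * ?s" using b_bound[of "k (r i) - z" "e i"] eX kZ z by (auto simp: n.mem abs_le_iff)
    also have "\<dots> \<le> \<bar>\<beta>\<bar> * ?t * ?s"
      using n.nonneg[of "k (r i) - z"] a.nonneg[OF eX] kZ z
      by (intro mult_right_mono) (auto simp: n.mem)
    finally have *: "?s * ?s \<le> (\<bar>\<beta>\<bar> * ?t) * ?s" using a.nonneg[OF eX] by simp
    have "0 \<le> \<bar>\<beta>\<bar> * ?t" using n.nonneg[of "k (r i) - z"] kZ z by (auto simp: n.mem)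
    show ?thesis
    proof (cases "?s = 0")
      case False
      then have "?s > 0" using a.nonneg[OF eX[of i]] by simp
      from mult_right_le_imp_le[OF * this] show ?thesis .
    qed (use \<open>0 \<le> \<bar>\<beta>\<bar> * ?t\<close> in simp)
  qed
  have e0: "(\<lambda>i. sqrt (a (e i) (e i))) \<longlonglongrightarrow> 0"
  proof (rule real_tendsto_sandwich[where f = "\<lambda>i. 0" and h = "\<lambda>i. \<bar>\<beta>\<bar> * sqrt (n (k (r i) - z) (k (r i) - z))"])
    show "(\<lambda>i. \<bar>\<beta>\<bar> * sqrt (n (k (r i) - z) (k (r i) - z))) \<longlonglongrightarrow> 0"
      using tendsto_mult_left[OF tendsto_real_sqrt[OF lim], of "\<bar>\<beta>\<bar>"] by simp
    show "(\<lambda>i. 0::real) \<longlonglongrightarrow> 0" by simp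
  qed (use e_le a.nonneg[OF eX] in auto)
  have "(\<lambda>i. J (k (r i))) \<longlonglongrightarrow> J z"
  proof (rule LIM_zero_cancel, rule Lim_null_comparison)
    show "\<forall>\<^sub>F i in sequentially. norm (J (k (r i)) - J z)
        \<le> 2 * (sqrt (J z) * sqrt (a (e i) (e i))) + (sqrt (a (e i) (e i)))\<^sup>2"
    proof (rule always_eventually, rule allI)
      fix i
      have "J (k (r i)) = a (S z + 1 *\<^sub>R e i) (S z + 1 *\<^sub>R e i)" by (simp add: J_def e_def)
      also have "\<dots> = J z + 2 * a (S z) (e i) + a (e i) (e i)"
        using SX eX by (subst a.expand) (auto simp: J_def)
      finally show "norm (J (k (r i)) - J z)
          \<le> 2 * (sqrt (J z) * sqrt (a (e i) (e i))) + (sqrt (a (e i) (e i)))\<^sup>2"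
        using a.Cauchy_Schwarz[OF SX(1) eX[of i]] a.nonneg[OF eX[of i]] by (simp add: J_def)
    qed
    have "(\<lambda>i. 2 * (sqrt (J z) * sqrt (a (e i) (e i))) + (sqrt (a (e i) (e i)))\<^sup>2)
        \<longlonglongrightarrow> 2 * (sqrt (J z) * 0) + 0\<^sup>2"
      by (intro tendsto_intros e0)
    then show "(\<lambda>i. 2 * (sqrt (J z) * sqrt (a (e i) (e i))) + (sqrt (a (e i) (e i)))\<^sup>2) \<longlonglongrightarrow> 0"
      by simp
  qed
  moreover have "(\<lambda>i. J (k (r i))) \<longlonglongrightarrow> m" using LIMSEQ_subseq_LIMSEQ[OF Jk r] by (simp add: o_def)
  ultimately have Jz: "J z = m" by (rule LIMSEQ_unique)
  have "b (w - z) (S z) \<le> 0" if w: "w \<in> K" for w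
  proof -
    have wZ: "w \<in> Z" using w K by auto
    define d where "d = S w - S z"
    have dX: "d \<in> X" using S wZ z by (auto simp: d_def)
    have var: "0 \<le> 2 * a (S z) d + t * a d d" if t: "0 < t" "t \<le> 1" for t
    proof -
      define zt where "zt = z + t *\<^sub>R (w - z)"
      have "zt = (1 - t) *\<^sub>R z + t *\<^sub>R w" by (simp add: zt_def algebra_simps)
      then have ztK: "zt \<in> K" using convexD[OF K(3) zK w, of "1 - t" t] t by simp
      then have ztZ: "zt \<in> Z" using K by auto
      define y where "y = S z + t *\<^sub>R d"
      have yX: "y \<in> X" using SX dX by (auto simp: y_def)
      have "a (S zt) x = a y x" if "x \<in> X" for x
      proof -
        have "b zt x = b z x + t * (b w x - b z x)"
          unfolding zt_def using z wZ that by (simp add: b_add1 b_scale1 bdiff n.mem)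
        moreover have "a y x = a (S z) x + t * (a (S w) x - a (S z) x)"
          unfolding y_def d_def using SX S(1)[OF wZ] that
          by (simp add: a.add_left a.scale_left a.diff_left a.mem)
        ultimately show ?thesis
          unfolding S(2)[OF ztZ that] S(2)[OF z that] S(2)[OF wZ that] by (simp add: algebra_simps)
      qed
      then have "a (S zt) (S zt) = a y y"
        using a.sym S ztZ yX by metis
      then have "J z \<le> a y y" using m_le[OF ztK] Jz by (simp add: J_def)
      also have "\<dots> = J z + 2 * t * a (S z) d + t\<^sup>2 * a d d"
        using SX dX by (simp add: y_def a.expand J_def)
      finally have "0 \<le> t * (2 * a (S z) d + t * a d d)" by (simp add: power2_eq_square algebra_simps)
      then show ?thesis using t by (simp add: zero_le_mult_iff)
    qed
    have "0 \<le> 2 * a (S z) d"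
    proof (rule tendsto_lowerbound)
      show "((\<lambda>t. 2 * a (S z) d + t * a d d) \<longlongrightarrow> 2 * a (S z) d) (at_right 0)"
        by (rule tendsto_eq_intros refl | simp)+
      show "\<forall>\<^sub>F t in at_right 0. 0 \<le> 2 * a (S z) d + t * a d d"
        unfolding eventually_at_right_field using var by (intro exI[of _ 1]) auto
    qed simp
    moreover have "a (S z) d = - b (w - z) (S z)"
      unfolding d_def using SX S wZ z a.sym[of "S z" "S w - S z"] by (simp add: a.diff_left bdiff a.mem)
    ultimately show ?thesis by simp
  qed
  moreover have "\<forall>y\<in>X. a (S z) y + b z y = L y" using S z by simp
  ultimately show ?thesis using zK SX by blast
qed

section \<open>Smooth bump functions and the fundamental lemma\<close>

text \<open>
  The partial derivatives of all orders are obtained by recursion on the list of indices, choosing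
  first derivatives within \<open>S\<close> at each step.
\<close>

lemma smooth_if_derivatives_in:
  fixes S :: "(real^'n::finite \<Rightarrow> real) set"
  assumes "\<phi> \<in> S"
    and S: "\<And>f. f \<in> S \<Longrightarrow> \<exists>g. (\<forall>i. g i \<in> S) \<and>
      (\<forall>x. (f has_derivative (\<lambda>h. \<Sum>i\<in>UNIV. h $ i * g i x)) (at x))"
  shows "smooth \<phi>"
proof -
  let ?P = "\<lambda>f g. (\<forall>i. g i \<in> S) \<and> (\<forall>x. (f has_derivative (\<lambda>h. \<Sum>i\<in>UNIV. h $ i * g i x)) (at x))"
  define G where "G f = (SOME g. ?P f g)" for f
  have "?P f (G f)" if "f \<in> S" for f
    unfolding G_def using S[OF that] by (rule someI_ex)
  then have G: "\<And>f i. f \<in> S \<Longrightarrow> G f i \<in> S"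
    "\<And>f x. f \<in> S \<Longrightarrow> (f has_derivative (\<lambda>h. \<Sum>i\<in>UNIV. h $ i * G f i x)) (at x)"
    by blast+
  define D where "D = (\<lambda>is. foldr (\<lambda>i f. G f i) is \<phi>)"
  have "D is \<in> S" for "is" by (induction "is") (auto simp: D_def assms(1) G(1))
  then have "(D is has_derivative (\<lambda>h. \<Sum>i\<in>UNIV. h $ i * D (i # is) x)) (at x)" for "is" x
    using G(2)[of "D is" x] by (simp add: D_def)
  then show ?thesis unfolding smooth_def by (intro exI[of _ D]) (simp add: D_def)
qed

lemma smooth_partial_derivatives:
  assumes "smooth \<phi>"
  obtains g where "\<And>i. smooth (g i)"
    "\<And>x. (\<phi> has_derivative (\<lambda>h. \<Sum>i\<in>UNIV. h $ i * g i x)) (at x)"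
proof -
  obtain D where D: "D [] = \<phi>"
    "\<And>is x. (D is has_derivative (\<lambda>h. \<Sum>i\<in>UNIV. h $ i * D (i # is) x)) (at x)"
    using assms unfolding smooth_def by blast
  have "smooth (D [i])" for i
    unfolding smooth_def by (intro exI[of _ "\<lambda>is. D (is @ [i])"]) (use D(2) in force)
  then show ?thesis using that[of "\<lambda>i. D [i]"] D(2)[of "[]"] by (simp add: D(1))
qed

lemma smooth_continuous_on: "smooth \<phi> \<Longrightarrow> continuous_on A \<phi>"
  by (meson smooth_partial_derivatives has_derivative_at_withinI has_derivative_continuous_on)

text \<open>
  The functions \<open>P(1/t) * exp (-c/t)\<close>, extended by zero to \<open>t \<le> 0\<close>. Admitting a polynomial factor
  makes the family closed under differentiation.
\<close>

definition flat :: "real \<Rightarrow> real poly \<Rightarrow> real \<Rightarrow> real" where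
  "flat c P t = (if t > 0 then poly P (1 / t) * exp (- c / t) else 0)"

definition flat_deriv :: "real \<Rightarrow> real poly \<Rightarrow> real poly" where
  "flat_deriv c P = [:0, 0, 1:] * (smult c P - pderiv P)"

lemma poly_times_exp_tendsto_0:
  assumes "c > 0"
  shows "((\<lambda>s. poly P s * exp (- (c * s))) \<longlongrightarrow> (0::real)) at_top"
proof -
  have "((\<lambda>s. coeff P i * s ^ i * exp (- (c * s))) \<longlongrightarrow> 0) at_top" for i
  proof -
    have "filterlim (\<lambda>s. c * s) at_top at_top"
      using assms by (intro filterlim_tendsto_pos_mult_at_top[OF tendsto_const _ filterlim_ident])
    from filterlim_compose[OF tendsto_power_div_exp_0 this]
    have "((\<lambda>s. (c * s) ^ i / exp (c * s)) \<longlongrightarrow> 0) at_top" .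
    from tendsto_mult_left[OF this, of "coeff P i / c ^ i"] show ?thesis
      using assms by (simp add: power_mult_distrib exp_minus field_simps)
  qed
  then have "((\<lambda>s. \<Sum>i\<le>degree P. coeff P i * s ^ i * exp (- (c * s))) \<longlongrightarrow> (\<Sum>i\<le>degree P. 0)) at_top"
    by (intro tendsto_sum) auto
  then show ?thesis by (simp add: poly_altdef sum_distrib_right)
qed

lemma flat_has_derivative:
  assumes "c > 0"
  shows "(flat c P has_real_derivative flat c (flat_deriv c P) t) (at t)"
proof -
  consider "t > 0" | "t < 0" | "t = 0" by linarith
  then show ?thesis
  proof cases
    case 1
    have inv: "((\<lambda>t. 1 / t) has_real_derivative - (1 / t)\<^sup>2) (at t)"
      using DERIV_inverse'[OF DERIV_ident, of t UNIV] 1 by (simp add: inverse_eq_divide power2_eq_square)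
    have "((\<lambda>t. - c / t) has_real_derivative c * (1 / t)\<^sup>2) (at t)"
      using DERIV_cmult[OF inv, of "- c"] by simp
    from DERIV_chain2[OF DERIV_exp this]
    have "((\<lambda>t. exp (- c / t)) has_real_derivative exp (- c / t) * (c * (1 / t)\<^sup>2)) (at t)" .
    from DERIV_mult[OF DERIV_chain2[OF poly_DERIV inv] this]
    have "((\<lambda>t. poly P (1 / t) * exp (- c / t)) has_real_derivative
        poly (pderiv P) (1 / t) * - (1 / t)\<^sup>2 * exp (- c / t) + exp (- c / t) * (c * (1 / t)\<^sup>2) * poly P (1 / t)) (at t)" .
    also have "poly (pderiv P) (1 / t) * - (1 / t)\<^sup>2 * exp (- c / t) + exp (- c / t) * (c * (1 / t)\<^sup>2) * poly P (1 / t)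
        = flat c (flat_deriv c P) t"
    proof -
      have "poly (flat_deriv c P) y = y\<^sup>2 * (c * poly P y - poly (pderiv P) y)" for y
        by (simp add: flat_deriv_def power2_eq_square)
      then show ?thesis using 1 by (simp add: flat_def right_diff_distrib left_diff_distrib mult_ac)
    qed
    finally have "((\<lambda>t. poly P (1 / t) * exp (- c / t)) has_real_derivative flat c (flat_deriv c P) t) (at t)" .
    then show ?thesis
      by (rule has_field_derivative_transform_within_open[of _ _ _ "{0<..}"])
         (use 1 in \<open>auto simp: flat_def\<close>)
  next
    case 2
    have "((\<lambda>t. 0) has_real_derivative flat c (flat_deriv c P) t) (at t)"
      using 2 by (simp add: flat_def)
    then show ?thesis
      by (rule has_field_derivative_transform_within_open[of _ _ _ "{..<0}"])
         (use 2 in \<open>auto simp: flat_def\<close>)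
  next
    case 3
    have "((\<lambda>h. flat c P h / h) \<longlongrightarrow> 0) (at 0)"
    proof (rule filterlim_split_at)
      have "((\<lambda>h. 0) \<longlongrightarrow> (0::real)) (at_left 0)" by simp
      then show "((\<lambda>h. flat c P h / h) \<longlongrightarrow> 0) (at_left 0)"
        by (rule Lim_transform_eventually) (auto simp: eventually_at_filter flat_def)
      have "((\<lambda>h. poly (pCons 0 P) (inverse h) * exp (- (c * inverse h))) \<longlongrightarrow> 0) (at_right 0)"
        by (rule filterlim_compose[OF poly_times_exp_tendsto_0[OF assms] filterlim_inverse_at_top_right])
      then show "((\<lambda>h. flat c P h / h) \<longlongrightarrow> 0) (at_right 0)"
        by (rule Lim_transform_eventually) (auto simp: eventually_at_filter flat_def field_simps)
    qed
    then show ?thesis by (simp add: 3 DERIV_def flat_def)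
  qed
qed

text \<open>
  Products of one-dimensional functions are smooth, but their higher derivatives are unwieldy. It is
  enough that the algebra generated by the flat functions of the coordinates is closed under partial
  derivatives.
\<close>

inductive_set flat_algebra :: "real \<Rightarrow> (real^'n::finite \<Rightarrow> real) set" for c where
  const: "(\<lambda>x. k) \<in> flat_algebra c"
| flat: "(\<lambda>x. flat c P (s * x $ i + b)) \<in> flat_algebra c"
| add: "f \<in> flat_algebra c \<Longrightarrow> g \<in> flat_algebra c \<Longrightarrow> (\<lambda>x. f x + g x) \<in> flat_algebra c"
| mult: "f \<in> flat_algebra c \<Longrightarrow> g \<in> flat_algebra c \<Longrightarrow> (\<lambda>x. f x * g x) \<in> flat_algebra c"

lemma flat_algebra_derivative:
  fixes f :: "real^'n::finite \<Rightarrow> real"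
  assumes "c > 0" "f \<in> flat_algebra c"
  shows "\<exists>g. (\<forall>i. g i \<in> flat_algebra c) \<and>
    (\<forall>x. (f has_derivative (\<lambda>h. \<Sum>i\<in>UNIV. h $ i * g i x)) (at x))"
  using assms(2)
proof induction
  case (const k)
  show ?case by (intro exI[of _ "\<lambda>i x. 0"]) (simp add: flat_algebra.const)
next
  case (flat P s i b)
  define g where "g j = (\<lambda>x::real^'n. (if j = i then s else 0) * flat c (flat_deriv c P) (s * x $ i + b))" for j
  have "g j \<in> flat_algebra c" for j
    unfolding g_def by (intro flat_algebra.intros)
  moreover have "((\<lambda>x. flat c P (s * x $ i + b)) has_derivative (\<lambda>h. \<Sum>j\<in>UNIV. h $ j * g j x)) (at x)" for x
  proof -
    have "(flat c P has_derivative (\<lambda>y. flat c (flat_deriv c P) (s * x $ i + b) * y)) (at (s * x $ i + b))"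
      using flat_has_derivative[OF \<open>c > 0\<close>] by (simp add: has_field_derivative_def)
    moreover have "((\<lambda>x. s * x $ i + b) has_derivative (\<lambda>h. s * h $ i)) (at x)"
      by (auto intro!: derivative_eq_intros bounded_linear_imp_has_derivative bounded_linear_vec_nth)
    ultimately have "((\<lambda>x. flat c P (s * x $ i + b)) has_derivative
        (\<lambda>h. flat c (flat_deriv c P) (s * x $ i + b) * (s * h $ i))) (at x)"
      using diff_chain_at[of "\<lambda>x. s * x $ i + b" _ x "flat c P"] by (simp add: o_def)
    moreover have "(\<Sum>j\<in>UNIV. h $ j * g j x) = flat c (flat_deriv c P) (s * x $ i + b) * (s * h $ i)" for h :: "real^'n"
      unfolding g_def by (subst sum.mono_neutral_right[of _ "{i}"]) auto
    ultimately show ?thesis by simp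
  qed
  ultimately show ?case by blast
next
  case (add f1 f2)
  then obtain g1 g2 where g: "\<forall>i. g1 i \<in> flat_algebra c" "\<forall>i. g2 i \<in> flat_algebra c"
    "\<And>x. (f1 has_derivative (\<lambda>h. \<Sum>i\<in>UNIV. h $ i * g1 i x)) (at x)"
    "\<And>x. (f2 has_derivative (\<lambda>h. \<Sum>i\<in>UNIV. h $ i * g2 i x)) (at x)" by blast
  show ?case
  proof (intro exI[of _ "\<lambda>i x. g1 i x + g2 i x"] conjI allI)
    show "((\<lambda>x. f1 x + f2 x) has_derivative (\<lambda>h. \<Sum>i\<in>UNIV. h $ i * (g1 i x + g2 i x))) (at x)" for x
      using has_derivative_add[OF g(3,4)] by (simp add: distrib_left sum.distrib)
  qed (use g in \<open>auto intro: flat_algebra.intros\<close>)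
next
  case (mult f1 f2)
  then obtain g1 g2 where g: "\<forall>i. g1 i \<in> flat_algebra c" "\<forall>i. g2 i \<in> flat_algebra c"
    "\<And>x. (f1 has_derivative (\<lambda>h. \<Sum>i\<in>UNIV. h $ i * g1 i x)) (at x)"
    "\<And>x. (f2 has_derivative (\<lambda>h. \<Sum>i\<in>UNIV. h $ i * g2 i x)) (at x)" by blast
  show ?case
  proof (intro exI[of _ "\<lambda>i x. f1 x * g2 i x + g1 i x * f2 x"] conjI allI)
    show "((\<lambda>x. f1 x * f2 x) has_derivative (\<lambda>h. \<Sum>i\<in>UNIV. h $ i * (f1 x * g2 i x + g1 i x * f2 x))) (at x)" for x
      using has_derivative_mult[OF g(3,4)]
      by (simp add: distrib_left sum.distrib sum_distrib_left sum_distrib_right mult_ac)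
  qed (use g mult in \<open>auto intro!: flat_algebra.intros\<close>)
qed

definition bump :: "real \<Rightarrow> real^'n::finite \<Rightarrow> real^'n \<Rightarrow> real^'n \<Rightarrow> real" where
  "bump c a b x = (\<Prod>i\<in>UNIV. flat c 1 (x $ i - a $ i) * flat c 1 (b $ i - x $ i))"

lemma smooth_bump:
  assumes "c > 0" shows "smooth (bump c a b)"
proof (rule smooth_if_derivatives_in)
  have *: "(\<lambda>x. \<Prod>i\<in>I. flat c 1 (x $ i - a $ i) * flat c 1 (b $ i - x $ i)) \<in> flat_algebra c" for I
  proof (induction I rule: infinite_finite_induct)
    case (insert i I)
    have "(\<lambda>x. flat c 1 (1 * x $ i + (- a $ i)) * flat c 1 ((-1) * x $ i + b $ i)) \<in> flat_algebra c"
      by (intro flat_algebra.intros)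
    from flat_algebra.mult[OF this insert.IH] insert.hyps show ?case by simp
  qed (auto intro: flat_algebra.const)
  show "bump c a b \<in> flat_algebra c" using *[of UNIV] by (simp add: bump_def[abs_def])
qed (rule flat_algebra_derivative[OF assms])

lemma flat_1: "flat c 1 t = (if t > 0 then exp (- c / t) else 0)"
  by (simp add: flat_def)

lemma bump_nonzero_iff: "bump c a b x \<noteq> 0 \<longleftrightarrow> x \<in> box a b"
  by (auto simp: bump_def flat_1 mem_box_cart)

lemma bump_bounds:
  assumes "c > 0" shows "0 \<le> bump c a b x" "bump c a b x \<le> 1"
  using assms unfolding bump_def
  by (auto simp: flat_1 intro!: prod_nonneg prod_le_1 mult_le_one)

lemma test_function_bump:
  assumes "c > 0" "cbox a b \<subseteq> \<Omega>"
  shows "test_function \<Omega> (bump c a b)"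
proof -
  have "{x. bump c a b x \<noteq> 0} = box a b" by (simp add: bump_nonzero_iff)
  moreover have "closure (box a b) \<subseteq> cbox a b" by (rule closure_minimal[OF box_subset_cbox closed_cbox])
  ultimately show ?thesis unfolding test_function_def
    using assms smooth_bump bounded_box by (auto simp: compact_closure)
qed

text \<open>
  Letting the parameter of \<open>exp (-c/t)\<close> tend to zero makes the bumps increase to the indicator of
  the open box while their support stays fixed.
\<close>

lemma bump_tendsto_indicator:
  "(\<lambda>n. bump (1 / real (Suc n)) a b x) \<longlonglongrightarrow> indicator (box a b) x"
proof (cases "x \<in> box a b")
  case True
  have *: "(\<lambda>n. flat (1 / real (Suc n)) 1 t) \<longlonglongrightarrow> 1" if "t > 0" for t
  proof -
    have "(\<lambda>n. exp (- (1 / real (Suc n)) / t)) \<longlonglongrightarrow> exp (- 0 / t)"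
      by (intro tendsto_intros LIMSEQ_Suc lim_1_over_n) (use that in auto)
    then show ?thesis using that by (simp add: flat_1)
  qed
  have "(\<lambda>n. bump (1 / real (Suc n)) a b x) \<longlonglongrightarrow> (\<Prod>i\<in>(UNIV::'a set). 1 * 1)"
    unfolding bump_def by (intro tendsto_prod tendsto_mult *) (use True in \<open>auto simp: mem_box_cart\<close>)
  then show ?thesis using True by simp
next
  case False
  then have "bump (1 / real (Suc n)) a b x = 0" for n using bump_nonzero_iff by blast
  then show ?thesis using False by simp
qed

text \<open>
  Boxes are an intersection-stable generator of the Borel sets, so the integral vanishes over every
  Borel set by Dynkin's argument.
\<close>

lemma AE_zero_if_box_integrals_zero:
  fixes f :: "'a::euclidean_space \<Rightarrow> real"
  assumes f: "integrable lborel f"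
    and box: "\<And>a b. (LINT x:box a b|lborel. f x) = 0"
  shows "AE x in lborel. f x = 0"
proof -
  have si: "set_integrable lborel A f" if "A \<in> sets borel" for A
    unfolding set_integrable_def using f that by (intro integrable_mult_indicator) auto
  have all: "(LINT x|lborel. f x) = 0"
  proof -
    let ?A = "\<lambda>n. box (- (real n *\<^sub>R One)) (real n *\<^sub>R One) :: 'a set"
    have U: "(\<Union>n. ?A n) = UNIV" by (simp add: UN_box_eq_UNIV)
    have "(\<lambda>n. LINT x:?A n|lborel. f x) \<longlonglongrightarrow> (LINT x:(\<Union>n. ?A n)|lborel. f x)"
      by (intro set_integral_cont_up si) (auto simp: incseq_def U box_def algebra_simps intro: order.strict_trans2 order.strict_trans1)
    then have "(LINT x:(\<Union>n. ?A n)|lborel. f x) = 0"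
      by (simp add: box LIMSEQ_const_iff)
    then show ?thesis by (simp only: U set_lebesgue_integral_def) simp
  qed
  have A: "(LINT x:A|lborel. f x) = 0" if "A \<in> sigma_sets UNIV (range (\<lambda>(a, b). box a b :: 'a set))" for A
  proof (rule sigma_sets_induct_disjoint[OF _ _ that])
    fix A assume A: "A \<in> sigma_sets UNIV (range (\<lambda>(a, b). box a b :: 'a set))"
      "(LINT x:A|lborel. f x) = 0"
    then have "A \<in> sets borel" by (subst borel_eq_box) simp
    then have "(LINT x:(A \<union> (UNIV - A))|lborel. f x) = (LINT x:A|lborel. f x) + (LINT x:(UNIV - A)|lborel. f x)"
      by (intro set_integral_Un si) auto
    then show "(LINT x:(UNIV - A)|lborel. f x) = 0" using A all by (simp add: set_lebesgue_integral_def)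
  next
    fix A :: "nat \<Rightarrow> 'a set"
    assume A: "disjoint_family A" "range A \<subseteq> sigma_sets UNIV (range (\<lambda>(a, b). box a b :: 'a set))"
      "\<And>i. (LINT x:A i|lborel. f x) = 0"
    then have "A i \<in> sets borel" for i by (subst borel_eq_box) auto
    then have "(LINT x:(\<Union>i. A i)|lborel. f x) = (\<Sum>i. LINT x:A i|lborel. f x)"
      using A(1) by (intro lebesgue_integral_countable_add si) (auto simp: disjoint_family_on_def)
    then show "(LINT x:(\<Union>i. A i)|lborel. f x) = 0" using A(3) by simp
  next
    show "Int_stable (range (\<lambda>(a, b). box a b :: 'a set))"
      by (auto simp: Int_stable_def box_Int_box intro!: image_eqI[of _ _ "(_, _)"])
  qed (use box in \<open>auto simp: set_lebesgue_integral_def\<close>)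
  show ?thesis
  proof (rule sigma_finite_measure.density_zero[OF sigma_finite_lborel f])
    fix A :: "'a set" assume "A \<in> sets lborel"
    then have "A \<in> sets borel" by simp
    then have "A \<in> sigma_sets UNIV (range (\<lambda>(a, b). box a b))" by (subst (asm) borel_eq_box) simp
    then show "(LINT x:A|lborel. f x) = 0" by (rule A)
  qed
qed

text \<open>
  By dominated convergence along the bumps, \<open>h\<close> has integral zero over every open box whose closure
  lies in \<open>\<Omega>\<close>. Cutting \<open>h\<close> off outside one such box gives a function on the whole space to which
  the criterion for boxes applies, as the intersection of two boxes is a box. Countably many of these
  boxes cover \<open>\<Omega>\<close>.
\<close>

theorem fundamental_lemma_of_variations:
  fixes h :: "real^'n::finite \<Rightarrow> real"
  assumes "open \<Omega>" and h: "integrable (lebesgue_on \<Omega>) h"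
    and test: "\<And>\<phi>. test_function \<Omega> \<phi> \<Longrightarrow> (LINT x|lebesgue_on \<Omega>. h x * \<phi> x) = 0"
  shows "AE x in lebesgue_on \<Omega>. h x = 0"
proof -
  have O[measurable]: "\<Omega> \<in> sets lebesgue" using assms(1) by auto
  have box0: "(LINT x|lebesgue_on \<Omega>. h x * indicator (box a b) x) = 0" if ab: "cbox a b \<subseteq> \<Omega>" for a b
  proof -
    have "(\<lambda>n. LINT x|lebesgue_on \<Omega>. h x * bump (1 / real (Suc n)) a b x) \<longlonglongrightarrow>
        (LINT x|lebesgue_on \<Omega>. h x * indicator (box a b) x)"
    proof (rule integral_dominated_convergence[where w = "\<lambda>x. norm (h x)"])
      have "continuous_on UNIV (bump (1 / real (Suc n)) a b)" for n
        by (intro smooth_continuous_on smooth_bump) simp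
      then have "bump (1 / real (Suc n)) a b \<in> borel_measurable (lebesgue_on \<Omega>)" for n
        by (intro measurable_restrict_space1 measurable_completion) (simp add: borel_measurable_continuous_onI)
      then show "(\<lambda>x. h x * bump (1 / real (Suc n)) a b x) \<in> borel_measurable (lebesgue_on \<Omega>)" for n
        using h by auto
      have "(indicator (box a b) :: _ \<Rightarrow> real) \<in> borel_measurable (lebesgue_on \<Omega>)"
        by (intro measurable_restrict_space1 measurable_completion) simp
      then show "(\<lambda>x. h x * indicator (box a b) x) \<in> borel_measurable (lebesgue_on \<Omega>)"
        using h by auto
      show "AE x in lebesgue_on \<Omega>. (\<lambda>n. h x * bump (1 / real (Suc n)) a b x) \<longlonglongrightarrow> h x * indicator (box a b) x"
        by (intro AE_I2 tendsto_mult tendsto_const bump_tendsto_indicator)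
      show "AE x in lebesgue_on \<Omega>. norm (h x * bump (1 / real (Suc n)) a b x) \<le> norm (h x)" for n
        using bump_bounds[of "1 / real (Suc n)" a b]
        by (intro AE_I2) (simp add: abs_mult mult_left_le)
    qed (use h in simp)
    moreover have "(LINT x|lebesgue_on \<Omega>. h x * bump (1 / real (Suc n)) a b x) = 0" for n
      using ab by (intro test test_function_bump) auto
    ultimately show ?thesis by (simp add: LIMSEQ_const_iff)
  qed
  have local: "AE x in lebesgue. x \<in> box a b \<longrightarrow> h x = 0" if ab: "cbox a b \<subseteq> \<Omega>" for a b
  proof -
    define f where "f x = (if x \<in> \<Omega> then h x * indicator (box a b) x else 0)" for x
    have "integrable (lebesgue_on \<Omega>) (\<lambda>x. h x * indicator (box a b) x)"
    proof (rule Bochner_Integration.integrable_cong[THEN iffD1])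
      have "box a b \<inter> \<Omega> \<in> sets lebesgue" by (intro sets.Int O) simp
      then show "integrable (lebesgue_on \<Omega>) (\<lambda>x. indicator (box a b \<inter> \<Omega>) x *\<^sub>R h x)"
        by (intro integrable_mult_indicator h) (simp add: sets_restrict_space_iff)
    qed (auto simp: indicator_def)
    then have f: "integrable lebesgue f"
      unfolding f_def by (rule Lebesgue_Measure.integrable_restrict_UNIV[OF O, THEN iffD2])
    \<comment> \<open>the criterion for boxes is stated for Borel functions, whereas \<open>h\<close> is only Lebesgue measurable\<close>
    then obtain f' where f': "f' \<in> borel_measurable lborel" "AE x in lborel. f x = f' x"
      using completion_ex_borel_measurable_real[of f lborel] by auto
    have ae: "AE x in lebesgue. f x = f' x" using f'(2) by (rule AE_completion)
    have f'L: "integrable lebesgue f'"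
      by (rule integrable_cong_AE_imp[OF f]) (use f' ae in \<open>auto intro: measurable_completion\<close>)
    then have f'B: "integrable lborel f'" using f'(1) by (simp add: integrable_completion)
    have "AE x in lborel. f' x = 0"
    proof (rule AE_zero_if_box_integrals_zero[OF f'B])
      fix a' b' :: "real^'n"
      have "\<exists>a2 b2. box a' b' \<inter> box a b = box a2 b2" unfolding box_Int_box by blast
      then obtain a2 b2 where ab2: "box a' b' \<inter> box a b = box a2 b2" by blast
      have sub: "cbox a2 b2 \<subseteq> \<Omega>" if "box a2 b2 \<noteq> {}"
      proof -
        have "box a2 b2 \<subseteq> box a b" using ab2 by blast
        then have "closure (box a2 b2) \<subseteq> closure (box a b)" by (rule closure_mono)
        also have "\<dots> \<subseteq> cbox a b" by (rule closure_minimal[OF box_subset_cbox closed_cbox])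
        finally show ?thesis using that ab by (simp add: closure_box)
      qed
      have "(LINT x:box a' b'|lborel. f' x) = (LINT x|lebesgue. indicator (box a' b') x *\<^sub>R f' x)"
        unfolding set_lebesgue_integral_def using f'(1) by (subst integral_completion) auto
      also have "\<dots> = (LINT x|lebesgue. indicator (box a' b') x *\<^sub>R f x)"
      proof (rule integral_cong_AE)
        have "box a' b' \<in> sets lebesgue" by simp
        then show "(\<lambda>x. indicator (box a' b') x *\<^sub>R f' x) \<in> borel_measurable lebesgue"
          "(\<lambda>x. indicator (box a' b') x *\<^sub>R f x) \<in> borel_measurable lebesgue"
          using f f'L by (blast intro: borel_measurable_integrable integrable_mult_indicator)+
      qed (use ae in auto)
      also have "\<dots> = (LINT x|lebesgue. (if x \<in> \<Omega> then h x * indicator (box a2 b2) x else 0))"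
        by (intro Bochner_Integration.integral_cong) (auto simp: f_def indicator_def ab2[symmetric])
      also have "\<dots> = (LINT x|lebesgue_on \<Omega>. h x * indicator (box a2 b2) x)"
        by (rule Lebesgue_Measure.integral_restrict_UNIV[OF O])
      also have "\<dots> = 0" using box0[OF sub] by (cases "box a2 b2 = {}") auto
      finally show "(LINT x:box a' b'|lborel. f' x) = 0" .
    qed
    then have "AE x in lebesgue. f' x = 0" by (rule AE_completion)
    with ae show ?thesis
      by eventually_elim (use ab box_subset_cbox in \<open>auto simp: f_def indicator_def split: if_splits\<close>)
  qed
  let ?F = "{box a b | a b. cbox a b \<subseteq> \<Omega>}"
  obtain \<D> where D: "\<D> \<subseteq> ?F" "countable \<D>" "\<Union>\<D> = \<Union>?F"
    using Lindelof[of ?F] by auto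
  have cover: "\<Omega> \<subseteq> \<Union>\<D>"
  proof
    fix x assume "x \<in> \<Omega>"
    then obtain a b where "cbox a b \<subseteq> \<Omega>" "x \<in> box a b"
      using open_contains_cbox[OF \<open>open \<Omega>\<close>] by metis
    then show "x \<in> \<Union>\<D>" unfolding D(3) by blast
  qed
  have "AE x in lebesgue. x \<in> X \<longrightarrow> h x = 0" if "X \<in> \<D>" for X
    using D(1) that local by blast
  then have "AE x in lebesgue. \<forall>X\<in>\<D>. x \<in> X \<longrightarrow> h x = 0"
    by (subst AE_ball_countable[OF D(2)]) blast
  then have "AE x in lebesgue. x \<in> \<Omega> \<longrightarrow> h x = 0"
    by eventually_elim (use cover in auto)
  then show ?thesis by (simp add: AE_restrict_space_iff)
qed

section \<open>The space L2\<close>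

lemma norm_add_square_le: "(norm (a + b :: 'b::real_normed_vector))\<^sup>2 \<le> 2 * (norm a)\<^sup>2 + 2 * (norm b)\<^sup>2"
proof -
  have "(norm (a + b))\<^sup>2 \<le> (norm a + norm b)\<^sup>2" by (intro power_mono norm_triangle_ineq) simp
  also have "\<dots> \<le> 2 * (norm a)\<^sup>2 + 2 * (norm b)\<^sup>2"
    using sum_squares_bound[of "norm a" "norm b"] by (simp add: power2_sum)
  finally show ?thesis .
qed

lemma L2_measurable: "f \<in> L2 M \<Longrightarrow> f \<in> borel_measurable M"
  by (simp add: L2_def)

lemma L2_integrable_square: "f \<in> L2 M \<Longrightarrow> integrable M (\<lambda>x. (norm (f x))\<^sup>2)"
  by (simp add: L2_def)

lemma L2_integrable_inner:
  assumes "f \<in> L2 M" "g \<in> L2 M"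
  shows "integrable M (\<lambda>x. f x \<bullet> g x)"
proof (rule Bochner_Integration.integrable_bound)
  show "integrable M (\<lambda>x. (norm (f x))\<^sup>2 + (norm (g x))\<^sup>2)"
    using assms by (simp add: L2_def)
  have "\<bar>f x \<bullet> g x\<bar> \<le> (norm (f x))\<^sup>2 + (norm (g x))\<^sup>2" for x
  proof -
    have "\<bar>f x \<bullet> g x\<bar> \<le> norm (f x) * norm (g x)" by (rule Cauchy_Schwarz_ineq2)
    also have "2 * (norm (f x) * norm (g x)) \<le> (norm (f x))\<^sup>2 + (norm (g x))\<^sup>2"
      using sum_squares_bound[of "norm (f x)" "norm (g x)"] by simp
    finally show ?thesis using mult_nonneg_nonneg[of "norm (f x)" "norm (g x)"] by linarith
  qed
  then show "AE x in M. norm (f x \<bullet> g x) \<le> norm ((norm (f x))\<^sup>2 + (norm (g x))\<^sup>2)" by simp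
qed (use assms in \<open>simp add: borel_measurable_inner L2_measurable\<close>)

lemma L2_subspace: "subspace (L2 M)"
  unfolding subspace_def
proof (intro conjI ballI allI)
  fix f g :: "'a \<Rightarrow> 'b" and c
  assume f: "f \<in> L2 M"
  show "c *\<^sub>R f \<in> L2 M"
    using f by (auto simp: L2_def scaleR_fun_def power_mult_distrib)
  assume g: "g \<in> L2 M"
  have "integrable M (\<lambda>x. (norm (f x + g x))\<^sup>2)"
  proof (rule Bochner_Integration.integrable_bound)
    show "integrable M (\<lambda>x. 2 * (norm (f x))\<^sup>2 + 2 * (norm (g x))\<^sup>2)"
      using f g by (simp add: L2_def)
    show "(\<lambda>x. (norm (f x + g x))\<^sup>2) \<in> borel_measurable M"
      using L2_measurable[OF f] L2_measurable[OF g] by measurable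
  qed (simp add: norm_add_square_le)
  then show "f + g \<in> L2 M" using f g by (auto simp: L2_def plus_fun_def)
qed (auto simp: L2_def zero_fun_def)

lemma L2_semi_inner: "semi_inner (L2 M) (L2_inner M)"
proof
  fix f g h :: "'a \<Rightarrow> 'b" and c
  assume "f \<in> L2 M" "g \<in> L2 M" "h \<in> L2 M"
  then show "L2_inner M (f + g) h = L2_inner M f h + L2_inner M g h"
    by (simp add: L2_inner_def inner_add_left L2_integrable_inner)
next
  fix f g :: "'a \<Rightarrow> 'b"
  show "L2_inner M f g = L2_inner M g f" by (simp add: L2_inner_def inner_commute)
qed (simp_all add: L2_subspace L2_inner_def)

lemma L2_norm_square: "(L2_norm M f)\<^sup>2 = L2_inner M f f"
  by (simp add: L2_norm_def L2_inner_def power2_norm_eq_inner Bochner_Integration.integral_nonneg)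

lemma L2_norm_eq_sqrt: "L2_norm M f = sqrt (L2_inner M f f)"
  by (simp add: L2_norm_def L2_inner_def power2_norm_eq_inner)

lemma L2_inner_self_eq_0_iff:
  assumes "f \<in> L2 M"
  shows "L2_inner M f f = 0 \<longleftrightarrow> (AE x in M. f x = 0)"
proof -
  have "integrable M (\<lambda>x. f x \<bullet> f x)" using assms by (intro L2_integrable_inner)
  then show ?thesis
    unfolding L2_inner_def by (subst integral_nonneg_eq_0_iff_AE) auto
qed

lemma L2_inner_cong:
  assumes "AE x in M. f x = f' x" "AE x in M. g x = g' x"
    and "f \<in> borel_measurable M" "f' \<in> borel_measurable M" "g \<in> borel_measurable M" "g' \<in> borel_measurable M"
  shows "L2_inner M f g = L2_inner M f' g'"
  unfolding L2_inner_def
proof (rule integral_cong_AE)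
  show "AE x in M. f x \<bullet> g x = f' x \<bullet> g' x" using assms(1,2) by eventually_elim simp
qed (use assms in \<open>auto intro: borel_measurable_inner\<close>)

lemma integrable_if_L2:
  assumes "finite_measure M" "f \<in> L2 M"
  shows "integrable M f"
proof (rule Bochner_Integration.integrable_bound)
  interpret finite_measure M by fact
  show "integrable M (\<lambda>x. 1 + (norm (f x))\<^sup>2)" using assms(2) by (simp add: L2_def)
  have "norm (f x) \<le> 1 + (norm (f x))\<^sup>2" for x
  proof -
    have "2 * norm (f x) \<le> (norm (f x))\<^sup>2 + 1"
      using sum_squares_bound[of "norm (f x)" 1] by simp
    then show ?thesis using norm_ge_zero[of "f x"] by linarith
  qed
  then show "AE x in M. norm (f x) \<le> norm (1 + (norm (f x))\<^sup>2)" by simp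
qed (use assms in \<open>simp add: L2_def\<close>)

lemma borel_measurable_bounded_linear:
  "bounded_linear T \<Longrightarrow> f \<in> borel_measurable M \<Longrightarrow> (\<lambda>x. T (f x)) \<in> borel_measurable M"
  by (rule measurable_compose[OF _ borel_measurable_continuous_onI[OF linear_continuous_on]])

section \<open>Smooth functions and their Jacobians\<close>

lemma smooth_add: "smooth \<phi> \<Longrightarrow> smooth \<psi> \<Longrightarrow> smooth (\<lambda>x. \<phi> x + \<psi> x)"
proof -
  assume "smooth \<phi>" "smooth \<psi>"
  then obtain D E where D: "D [] = \<phi>"
    "\<And>is x. (D is has_derivative (\<lambda>h. \<Sum>i\<in>UNIV. h $ i * D (i # is) x)) (at x)"
    and E: "E [] = \<psi>"
    "\<And>is x. (E is has_derivative (\<lambda>h. \<Sum>i\<in>UNIV. h $ i * E (i # is) x)) (at x)"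
    unfolding smooth_def by blast
  have "((\<lambda>x. D is x + E is x) has_derivative
      (\<lambda>h. \<Sum>i\<in>UNIV. h $ i * (D (i # is) x + E (i # is) x))) (at x)" for "is" x
    using has_derivative_add[OF D(2) E(2)] by (simp add: distrib_left sum.distrib)
  then show "smooth (\<lambda>x. \<phi> x + \<psi> x)"
    unfolding smooth_def by (intro exI[of _ "\<lambda>is x. D is x + E is x"]) (simp add: D(1) E(1))
qed

lemma smooth_scale: "smooth \<phi> \<Longrightarrow> smooth (\<lambda>x. c * \<phi> x)"
proof -
  assume "smooth \<phi>"
  then obtain D where D: "D [] = \<phi>"
    "\<And>is x. (D is has_derivative (\<lambda>h. \<Sum>i\<in>UNIV. h $ i * D (i # is) x)) (at x)"
    unfolding smooth_def by blast
  have "((\<lambda>x. c * D is x) has_derivative (\<lambda>h. \<Sum>i\<in>UNIV. h $ i * (c * D (i # is) x))) (at x)" for "is" x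
    using has_derivative_mult_right[OF D(2), of c] by (simp add: sum_distrib_left mult_ac)
  then show "smooth (\<lambda>x. c * \<phi> x)"
    unfolding smooth_def by (intro exI[of _ "\<lambda>is x. c * D is x"]) (simp add: D(1))
qed

lemma smooth_const: "smooth (\<lambda>x. c)"
  unfolding smooth_def by (intro exI[of _ "\<lambda>is x. if is = [] then c else 0"]) auto

lemma smooth_vector_jacobian:
  fixes \<phi> :: "real^'n::finite \<Rightarrow> real^'n"
  assumes "\<And>i. smooth (\<lambda>x. \<phi> x $ i)"
  obtains g where "\<And>i j. smooth (g i j)" "\<And>x. \<phi> differentiable (at x)"
    "\<And>x. jacobian \<phi> (at x) = (\<chi> i j. g i j x)"
proof -
  have "\<forall>i. \<exists>g. (\<forall>j. smooth (g j)) \<and>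
      (\<forall>x. ((\<lambda>x. \<phi> x $ i) has_derivative (\<lambda>h. \<Sum>j\<in>UNIV. h $ j * g j x)) (at x))"
  proof
    fix i show "\<exists>g. (\<forall>j. smooth (g j)) \<and>
      (\<forall>x. ((\<lambda>x. \<phi> x $ i) has_derivative (\<lambda>h. \<Sum>j\<in>UNIV. h $ j * g j x)) (at x))"
      by (rule smooth_partial_derivatives[OF assms[of i]]) blast
  qed
  from choice[OF this] obtain g where g': "\<forall>i. (\<forall>j. smooth (g i j)) \<and>
      (\<forall>x. ((\<lambda>x. \<phi> x $ i) has_derivative (\<lambda>h. \<Sum>j\<in>UNIV. h $ j * g i j x)) (at x))" ..
  then have g: "\<And>i j. smooth (g i j)"
    "\<And>i x. ((\<lambda>x. \<phi> x $ i) has_derivative (\<lambda>h. \<Sum>j\<in>UNIV. h $ j * g i j x)) (at x)"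
    by blast+
  define G where "G x = (\<chi> i j. g i j x)" for x
  have d: "(\<phi> has_derivative (\<lambda>h. G x *v h)) (at x)" for x
  proof -
    have "((\<lambda>x. \<phi> x \<bullet> b) has_derivative (\<lambda>h. (G x *v h) \<bullet> b)) (at x)" if "b \<in> Basis" for b
    proof -
      obtain i where b: "b = axis i 1" using \<open>b \<in> Basis\<close> unfolding Basis_vec_def by auto
      have "(G x *v h) $ i = (\<Sum>j\<in>UNIV. h $ j * g i j x)" for h
        by (simp add: G_def matrix_vector_mult_def mult.commute)
      then show ?thesis using g(2)[of i x] by (simp add: b inner_axis)
    qed
    then show ?thesis by (subst has_derivative_componentwise_within) auto
  qed
  have J: "jacobian \<phi> (at x) = G x" for x
    unfolding jacobian_def frechet_derivative_at[OF d, symmetric] by (rule matrix_of_matrix_vector_mul)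
  show ?thesis
  proof (rule that)
    show "smooth (g i j)" for i j by (rule g(1))
    show "\<phi> differentiable (at x)" for x using d by (auto simp: differentiable_def)
    show "jacobian \<phi> (at x) = (\<chi> i j. g i j x)" for x using J by (simp add: G_def)
  qed
qed

lemma jacobian_add:
  fixes \<phi> \<psi> :: "real^'n::finite \<Rightarrow> real^'n"
  assumes "\<phi> differentiable (at x)" "\<psi> differentiable (at x)"
  shows "jacobian (\<lambda>x. \<phi> x + \<psi> x) (at x) = jacobian \<phi> (at x) + jacobian \<psi> (at x)"
proof -
  have "(\<phi> has_derivative frechet_derivative \<phi> (at x)) (at x)"
    "(\<psi> has_derivative frechet_derivative \<psi> (at x)) (at x)"
    using assms by (simp_all add: frechet_derivative_works)
  from frechet_derivative_at[OF has_derivative_add[OF this], symmetric] show ?thesis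
    by (simp add: jacobian_def matrix_def vec_eq_iff)
qed

lemma jacobian_scale:
  fixes \<phi> :: "real^'n::finite \<Rightarrow> real^'n"
  assumes "\<phi> differentiable (at x)"
  shows "jacobian (\<lambda>x. c *\<^sub>R \<phi> x) (at x) = c *\<^sub>R jacobian \<phi> (at x)"
proof -
  have "(\<phi> has_derivative frechet_derivative \<phi> (at x)) (at x)"
    using assms by (simp add: frechet_derivative_works)
  then have "((\<lambda>x. c *\<^sub>R \<phi> x) has_derivative (\<lambda>h. c *\<^sub>R frechet_derivative \<phi> (at x) h)) (at x)"
    by (rule has_derivative_scaleR_right)
  from frechet_derivative_at[OF this, symmetric] show ?thesis
    by (simp add: jacobian_def matrix_def vec_eq_iff)
qed

section \<open>Weak gradients and strains\<close>

locale bounded_open =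
  fixes \<Omega> :: "(real^'n::finite) set"
  assumes open_domain: "open \<Omega>" and bounded_domain: "bounded \<Omega>"
begin

abbreviation M where "M \<equiv> lebesgue_on \<Omega>"

lemma finite_measure_domain: "finite_measure M"
  using open_domain bounded_domain
  by (intro finite_measure_lebesgue_on bounded_set_imp_lmeasurable) auto

lemma continuous_measurable: "continuous_on UNIV k \<Longrightarrow> (k :: real^'n \<Rightarrow> 'b::topological_space) \<in> borel_measurable M"
  by (intro measurable_restrict_space1 measurable_completion) (simp add: borel_measurable_continuous_onI)

lemma integrable_mult_continuous:
  fixes k :: "real^'n \<Rightarrow> real"
  assumes "integrable M h" "continuous_on UNIV k"
  shows "integrable M (\<lambda>x. h x * k x)"
proof -
  have "compact (closure \<Omega>)" using bounded_domain by (simp add: compact_closure)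
  then have "bounded (k ` closure \<Omega>)"
    using assms(2) by (intro compact_imp_bounded compact_continuous_image continuous_on_subset[OF assms(2)]) auto
  then obtain K where K: "\<And>x. x \<in> closure \<Omega> \<Longrightarrow> \<bar>k x\<bar> \<le> K" by (auto simp: bounded_iff)
  show ?thesis
  proof (rule Bochner_Integration.integrable_bound)
    show "integrable M (\<lambda>x. K * h x)" using assms(1) by simp
    show "(\<lambda>x. h x * k x) \<in> borel_measurable M"
      using assms continuous_measurable by (intro borel_measurable_times) auto
    show "AE x in M. norm (h x * k x) \<le> norm (K * h x)"
    proof (rule AE_I2)
      fix x assume "x \<in> space M"
      then have "x \<in> closure \<Omega>" using closure_subset by auto
      then show "norm (h x * k x) \<le> norm (K * h x)"
        using mult_right_mono[of "\<bar>k x\<bar>" "\<bar>K\<bar>" "\<bar>h x\<bar>"] K[of x] by (simp add: abs_mult mult.commute)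
    qed
  qed
qed

lemma test_function_integrable:
  assumes "test_function \<Omega> \<phi>" "integrable M h"
  shows "integrable M (\<lambda>x. h x * \<phi> x)" "integrable M (\<lambda>x. h x * frechet_derivative \<phi> (at x) (axis j 1))"
proof -
  have s: "smooth \<phi>" using assms(1) by (simp add: test_function_def)
  then show "integrable M (\<lambda>x. h x * \<phi> x)"
    by (intro integrable_mult_continuous assms(2) smooth_continuous_on)
  obtain g where g: "\<And>i. smooth (g i)"
    "\<And>x. (\<phi> has_derivative (\<lambda>h. \<Sum>i\<in>UNIV. h $ i * g i x)) (at x)"
    using smooth_partial_derivatives[OF s] by blast
  have "frechet_derivative \<phi> (at x) (axis j 1) = g j x" for x
    unfolding frechet_derivative_at[OF g(2), symmetric] axis_def
    by (simp add: if_distrib[of "\<lambda>t. t * _"] cong: if_cong)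
  then show "integrable M (\<lambda>x. h x * frechet_derivative \<phi> (at x) (axis j 1))"
    using integrable_mult_continuous[OF assms(2) smooth_continuous_on[OF g(1)]] by simp
qed

lemma L2_component_integrable:
  "v \<in> L2 M \<Longrightarrow> integrable M (\<lambda>x. v x $ i)" for v :: "real^'n \<Rightarrow> real^'m::finite"
  by (rule integrable_bounded_linear[OF bounded_linear_vec_nth integrable_if_L2[OF finite_measure_domain]])

lemma L2_matrix_component_integrable:
  "G \<in> L2 M \<Longrightarrow> integrable M (\<lambda>x. G x $ i $ j)" for G :: "real^'n \<Rightarrow> real^'m::finite^'k::finite"
proof -
  assume G: "G \<in> L2 M"
  have "integrable M G" by (rule integrable_if_L2[OF finite_measure_domain G])
  from integrable_bounded_linear[OF bounded_linear_compose[OF bounded_linear_vec_nth[of j] bounded_linear_vec_nth[of i]] this]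
  show ?thesis .
qed

lemma has_weak_gradient_add:
  assumes "v \<in> L2 M" "w \<in> L2 M" "has_weak_gradient \<Omega> v G" "has_weak_gradient \<Omega> w H"
  shows "has_weak_gradient \<Omega> (v + w) (G + H)"
  unfolding has_weak_gradient_def
proof (intro conjI allI impI)
  have GH: "G \<in> L2 M" "H \<in> L2 M" using assms by (auto simp: has_weak_gradient_def)
  then show "G + H \<in> L2 M" using L2_subspace subspace_add by blast
  fix \<phi> i j assume t: "test_function \<Omega> \<phi>"
  note int = test_function_integrable[OF t]
  show "(LINT x|M. (v + w) x $ i * frechet_derivative \<phi> (at x) (axis j 1)) =
      - (LINT x|M. (G + H) x $ i $ j * \<phi> x)"
    using assms(3,4) t GH
    by (simp add: has_weak_gradient_def distrib_right int L2_component_integrable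
        L2_matrix_component_integrable assms(1,2))
qed

lemma has_weak_gradient_scale:
  assumes "has_weak_gradient \<Omega> v G"
  shows "has_weak_gradient \<Omega> (c *\<^sub>R v) (c *\<^sub>R G)"
  using assms L2_subspace[of M] subspace_scale by (auto simp: has_weak_gradient_def mult.assoc)

text \<open>
  This is what makes \<^const>\<open>weak_gradient\<close>, a choice made separately for each function, linear up
  to null sets.
\<close>

lemma has_weak_gradient_unique:
  assumes "has_weak_gradient \<Omega> v G" "has_weak_gradient \<Omega> v H"
  shows "AE x in M. G x = H x"
proof -
  have GH: "G \<in> L2 M" "H \<in> L2 M" using assms by (auto simp: has_weak_gradient_def)
  have "AE x in M. G x $ i $ j - H x $ i $ j = 0" for i j
  proof (rule fundamental_lemma_of_variations[OF open_domain])
    show "integrable M (\<lambda>x. G x $ i $ j - H x $ i $ j)"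
      using GH by (intro Bochner_Integration.integrable_diff L2_matrix_component_integrable)
    fix \<phi> assume t: "test_function \<Omega> \<phi>"
    let ?l = "LINT x|M. v x $ i * frechet_derivative \<phi> (at x) (axis j 1)"
    have "?l = - (LINT x|M. G x $ i $ j * \<phi> x)" "?l = - (LINT x|M. H x $ i $ j * \<phi> x)"
      using assms t unfolding has_weak_gradient_def by blast+
    then have "(LINT x|M. G x $ i $ j * \<phi> x) = (LINT x|M. H x $ i $ j * \<phi> x)" by linarith
    then show "(LINT x|M. (G x $ i $ j - H x $ i $ j) * \<phi> x) = 0"
      using GH by (simp add: left_diff_distrib test_function_integrable[OF t] L2_matrix_component_integrable)
  qed
  then have "AE x in M. \<forall>i j. G x $ i $ j - H x $ i $ j = 0"
    by (simp add: AE_all_countable)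
  then show ?thesis by eventually_elim (simp add: vec_eq_iff)
qed

lemma weak_gradient: "v \<in> H1 \<Omega> \<Longrightarrow> has_weak_gradient \<Omega> v (weak_gradient \<Omega> v)"
  unfolding H1_def weak_gradient_def by (auto intro: someI[of "has_weak_gradient \<Omega> v"])

lemma H1_L2: "v \<in> H1 \<Omega> \<Longrightarrow> v \<in> L2 M" by (simp add: H1_def)

lemma weak_gradient_L2: "v \<in> H1 \<Omega> \<Longrightarrow> weak_gradient \<Omega> v \<in> L2 M"
  using weak_gradient by (simp add: has_weak_gradient_def)

lemma H1_add: "v \<in> H1 \<Omega> \<Longrightarrow> w \<in> H1 \<Omega> \<Longrightarrow> v + w \<in> H1 \<Omega>"
  using has_weak_gradient_add[OF H1_L2 H1_L2 weak_gradient weak_gradient]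
    subspace_add[OF L2_subspace H1_L2 H1_L2] unfolding H1_def by blast

lemma H1_scale: "v \<in> H1 \<Omega> \<Longrightarrow> c *\<^sub>R v \<in> H1 \<Omega>"
  using has_weak_gradient_scale[OF weak_gradient] subspace_scale[OF L2_subspace H1_L2]
  unfolding H1_def by blast

lemma weak_gradient_add:
  assumes "v \<in> H1 \<Omega>" "w \<in> H1 \<Omega>"
  shows "AE x in M. weak_gradient \<Omega> (v + w) x = weak_gradient \<Omega> v x + weak_gradient \<Omega> w x"
  using has_weak_gradient_unique[OF weak_gradient[OF H1_add[OF assms]]
      has_weak_gradient_add[OF H1_L2 H1_L2 weak_gradient weak_gradient]] assms by simp

lemma weak_gradient_scale:
  assumes "v \<in> H1 \<Omega>"
  shows "AE x in M. weak_gradient \<Omega> (c *\<^sub>R v) x = c *\<^sub>R weak_gradient \<Omega> v x"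
  using has_weak_gradient_unique[OF weak_gradient[OF H1_scale[OF assms]]
      has_weak_gradient_scale[OF weak_gradient]] assms by simp

lemma strain_add:
  assumes "v \<in> H1 \<Omega>" "w \<in> H1 \<Omega>"
  shows "AE x in M. strain \<Omega> (v + w) x = strain \<Omega> v x + strain \<Omega> w x"
  using weak_gradient_add[OF assms]
  by eventually_elim (simp add: strain_def transpose_def vec_eq_iff algebra_simps)

lemma strain_scale:
  assumes "v \<in> H1 \<Omega>"
  shows "AE x in M. strain \<Omega> (c *\<^sub>R v) x = c *\<^sub>R strain \<Omega> v x"
  using weak_gradient_scale[OF assms, of c]
  by eventually_elim (simp add: strain_def transpose_def vec_eq_iff algebra_simps)

lemma strain_L2:
  assumes "v \<in> H1 \<Omega>" shows "strain \<Omega> v \<in> L2 M"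
proof -
  let ?G = "weak_gradient \<Omega> v"
  have G: "?G \<in> L2 M" using weak_gradient_L2[OF assms] .
  have nt: "norm (transpose A) = norm A" for A :: "real^'n^'n"
  proof -
    have n: "(norm A)\<^sup>2 = (\<Sum>i\<in>UNIV. \<Sum>j\<in>UNIV. (A $ i $ j)\<^sup>2)" for A :: "real^'n^'n"
      unfolding power2_norm_eq_inner inner_vec_def by (simp add: power2_eq_square)
    have "(norm (transpose A))\<^sup>2 = (norm A)\<^sup>2"
      unfolding n by (subst sum.swap) (simp add: transpose_def)
    then show ?thesis by simp
  qed
  have "bounded_linear (transpose :: real^'n^'n \<Rightarrow> _)"
    by (intro linear_conv_bounded_linear[THEN iffD1] linearI) (auto simp: transpose_def vec_eq_iff)
  then have "(\<lambda>x. transpose (?G x)) \<in> borel_measurable M"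
    by (rule borel_measurable_bounded_linear[OF _ L2_measurable[OF G]])
  then have "(\<lambda>x. transpose (?G x)) \<in> L2 M"
    using G by (simp add: L2_def nt)
  then have "(1/2) *\<^sub>R (?G + (\<lambda>x. transpose (?G x))) \<in> L2 M"
    using G by (intro subspace_scale[OF L2_subspace] subspace_add[OF L2_subspace])
  then show ?thesis by (simp add: strain_def[abs_def] scaleR_fun_def plus_fun_def)
qed

end

section \<open>Traces\<close>

lemma nn_square_tendsto_add:
  fixes a b :: "nat \<Rightarrow> 'a \<Rightarrow> 'b::euclidean_space"
  assumes [measurable]: "\<And>n. a n \<in> borel_measurable N" "\<And>n. b n \<in> borel_measurable N"
    and a: "(\<lambda>n. \<integral>\<^sup>+ x. ennreal ((norm (a n x))\<^sup>2) \<partial>N) \<longlonglongrightarrow> 0"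
    and b: "(\<lambda>n. \<integral>\<^sup>+ x. ennreal ((norm (b n x))\<^sup>2) \<partial>N) \<longlonglongrightarrow> 0"
  shows "(\<lambda>n. \<integral>\<^sup>+ x. ennreal ((norm (a n x + b n x))\<^sup>2) \<partial>N) \<longlonglongrightarrow> 0"
proof (rule tendsto_sandwich)
  let ?A = "\<lambda>n. \<integral>\<^sup>+ x. ennreal ((norm (a n x))\<^sup>2) \<partial>N"
  let ?B = "\<lambda>n. \<integral>\<^sup>+ x. ennreal ((norm (b n x))\<^sup>2) \<partial>N"
  show "\<forall>\<^sub>F n in sequentially. 0 \<le> (\<integral>\<^sup>+ x. ennreal ((norm (a n x + b n x))\<^sup>2) \<partial>N)" by simp
  have "(\<integral>\<^sup>+ x. ennreal ((norm (a n x + b n x))\<^sup>2) \<partial>N) \<le> (?A n + ?A n) + (?B n + ?B n)" for n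
  proof -
    have "(\<integral>\<^sup>+ x. ennreal ((norm (a n x + b n x))\<^sup>2) \<partial>N) \<le>
      (\<integral>\<^sup>+ x. (ennreal ((norm (a n x))\<^sup>2) + ennreal ((norm (a n x))\<^sup>2)) +
        (ennreal ((norm (b n x))\<^sup>2) + ennreal ((norm (b n x))\<^sup>2)) \<partial>N)"
      using norm_add_square_le
      by (intro nn_integral_mono) (simp flip: ennreal_plus add: ennreal_leI)
    also have "\<dots> = (?A n + ?A n) + (?B n + ?B n)"
      by (simp add: nn_integral_add)
    finally show ?thesis .
  qed
  then show "\<forall>\<^sub>F n in sequentially.
      (\<integral>\<^sup>+ x. ennreal ((norm (a n x + b n x))\<^sup>2) \<partial>N) \<le> (?A n + ?A n) + (?B n + ?B n)" by simp
  show "(\<lambda>n. (?A n + ?A n) + (?B n + ?B n)) \<longlonglongrightarrow> 0"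
    using tendsto_add[OF tendsto_add[OF a a] tendsto_add[OF b b]] by simp
qed simp

lemma nn_square_tendsto_scale:
  fixes a :: "nat \<Rightarrow> 'a \<Rightarrow> 'b::euclidean_space"
  assumes [measurable]: "\<And>n. a n \<in> borel_measurable N"
    and a: "(\<lambda>n. \<integral>\<^sup>+ x. ennreal ((norm (a n x))\<^sup>2) \<partial>N) \<longlonglongrightarrow> 0"
  shows "(\<lambda>n. \<integral>\<^sup>+ x. ennreal ((norm (c *\<^sub>R a n x))\<^sup>2) \<partial>N) \<longlonglongrightarrow> 0"
proof -
  have "(\<integral>\<^sup>+ x. ennreal ((norm (c *\<^sub>R a n x))\<^sup>2) \<partial>N) = ennreal (c\<^sup>2) * (\<integral>\<^sup>+ x. ennreal ((norm (a n x))\<^sup>2) \<partial>N)" for n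
    by (subst nn_integral_cmult[symmetric]) (auto simp: power_mult_distrib ennreal_mult)
  then show ?thesis using ennreal_tendsto_cmult[OF _ a, of "ennreal (c\<^sup>2)"] by simp
qed

lemma sets_surface_on: "sets (surface_on S) = sets (restrict_space borel S)"
proof -
  have "sets (surface_measure :: (real^'n) measure) = sets borel"
    unfolding surface_measure_def hausdorff_measure_def
    using sets.sets_measure_of_eq[where M = "borel :: (real^'n) measure"] by simp
  then show ?thesis unfolding surface_on_def by (rule sets_restrict_space_cong)
qed

context bounded_open
begin

lemma H1_zero: "0 \<in> H1 \<Omega>"
proof -
  have "has_weak_gradient \<Omega> 0 0"
    using subspace_0[OF L2_subspace] by (simp add: has_weak_gradient_def)
  then show ?thesis using subspace_0[OF L2_subspace] by (auto simp: H1_def)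
qed

lemma weak_gradient_zero: "AE x in M. weak_gradient \<Omega> 0 x = 0"
  using weak_gradient_scale[OF H1_zero, of 0] by simp

lemma smooth_measurable:
  fixes \<phi> :: "real^'n \<Rightarrow> real^'n"
  assumes "\<And>i. smooth (\<lambda>x. \<phi> x $ i)"
  shows "\<phi> \<in> borel_measurable M" "(\<lambda>x. jacobian \<phi> (at x)) \<in> borel_measurable M"
    "\<phi> \<in> borel_measurable (surface_on S)"
proof -
  obtain g where g: "\<And>i j. smooth (g i j)" "\<And>x. \<phi> differentiable (at x)"
    "\<And>x. jacobian \<phi> (at x) = (\<chi> i j. g i j x)"
    using smooth_vector_jacobian[OF assms] by blast
  have c: "continuous_on UNIV \<phi>"
    using g(2) by (simp add: differentiable_imp_continuous_within continuous_on_eq_continuous_within)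
  then show "\<phi> \<in> borel_measurable M" by (rule continuous_measurable)
  have "continuous_on UNIV (\<lambda>x. \<chi> i j. g i j x)"
    by (intro continuous_on_vec_lambda smooth_continuous_on g(1))
  then show "(\<lambda>x. jacobian \<phi> (at x)) \<in> borel_measurable M"
    unfolding g(3) by (rule continuous_measurable)
  have "\<phi> \<in> borel_measurable (restrict_space borel S)"
    using c by (intro measurable_restrict_space1 borel_measurable_continuous_onI)
  then show "\<phi> \<in> borel_measurable (surface_on S)"
    by (simp add: measurable_cong_sets[OF sets_surface_on refl])
qed

lemma smooth_differentiable:
  fixes \<phi> :: "real^'n \<Rightarrow> real^'n"
  shows "(\<And>i. smooth (\<lambda>x. \<phi> x $ i)) \<Longrightarrow> \<phi> differentiable (at x)"
  by (rule smooth_vector_jacobian[of \<phi>]) auto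

text \<open>
  The sums of the approximating smooth functions approximate the sum; the weak gradient of the sum
  is the sum of the weak gradients only almost everywhere.
\<close>

lemma has_trace_add:
  assumes v: "v \<in> H1 \<Omega>" and w: "w \<in> H1 \<Omega>" and z: "has_trace \<Omega> v z" and y: "has_trace \<Omega> w y"
  shows "has_trace \<Omega> (v + w) (z + y)"
proof -
  let ?S = "surface_on (frontier \<Omega>)"
  obtain \<phi> where \<phi>: "\<And>n i. smooth (\<lambda>x. \<phi> n x $ i)"
    "(\<lambda>n. \<integral>\<^sup>+ x. ennreal ((norm (\<phi> n x - v x))\<^sup>2) \<partial>M) \<longlonglongrightarrow> 0"
    "(\<lambda>n. \<integral>\<^sup>+ x. ennreal ((norm (jacobian (\<phi> n) (at x) - weak_gradient \<Omega> v x))\<^sup>2) \<partial>M) \<longlonglongrightarrow> 0"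
    "(\<lambda>n. \<integral>\<^sup>+ x. ennreal ((norm (\<phi> n x - z x))\<^sup>2) \<partial>?S) \<longlonglongrightarrow> 0"
    using z unfolding has_trace_def by blast
  obtain \<psi> where \<psi>: "\<And>n i. smooth (\<lambda>x. \<psi> n x $ i)"
    "(\<lambda>n. \<integral>\<^sup>+ x. ennreal ((norm (\<psi> n x - w x))\<^sup>2) \<partial>M) \<longlonglongrightarrow> 0"
    "(\<lambda>n. \<integral>\<^sup>+ x. ennreal ((norm (jacobian (\<psi> n) (at x) - weak_gradient \<Omega> w x))\<^sup>2) \<partial>M) \<longlonglongrightarrow> 0"
    "(\<lambda>n. \<integral>\<^sup>+ x. ennreal ((norm (\<psi> n x - y x))\<^sup>2) \<partial>?S) \<longlonglongrightarrow> 0"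
    using y unfolding has_trace_def by blast
  have zy: "z \<in> L2 ?S" "y \<in> L2 ?S" using z y by (auto simp: has_trace_def)
  note m = smooth_measurable[OF \<phi>(1)] smooth_measurable[OF \<psi>(1)]
    L2_measurable[OF H1_L2[OF v]] L2_measurable[OF H1_L2[OF w]]
    L2_measurable[OF weak_gradient_L2[OF v]] L2_measurable[OF weak_gradient_L2[OF w]]
    L2_measurable[OF zy(1)] L2_measurable[OF zy(2)]
  show ?thesis
    unfolding has_trace_def
  proof (intro conjI exI[of _ "\<lambda>n x. \<phi> n x + \<psi> n x"] allI)
    show "z + y \<in> L2 ?S" using zy by (rule subspace_add[OF L2_subspace])
    show "smooth (\<lambda>x. (\<phi> n x + \<psi> n x) $ i)" for n i
      using smooth_add[OF \<phi>(1)[of n i] \<psi>(1)[of n i]] by simp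
    have "(\<lambda>n. \<integral>\<^sup>+ x. ennreal ((norm ((\<phi> n x - v x) + (\<psi> n x - w x)))\<^sup>2) \<partial>M) \<longlonglongrightarrow> 0"
      by (intro nn_square_tendsto_add \<phi>(2) \<psi>(2) borel_measurable_diff m)
    then show "(\<lambda>n. \<integral>\<^sup>+ x. ennreal ((norm (\<phi> n x + \<psi> n x - (v + w) x))\<^sup>2) \<partial>M) \<longlonglongrightarrow> 0"
      by (simp add: algebra_simps)
    have "(\<lambda>n. \<integral>\<^sup>+ x. ennreal ((norm ((\<phi> n x - z x) + (\<psi> n x - y x)))\<^sup>2) \<partial>?S) \<longlonglongrightarrow> 0"
      by (intro nn_square_tendsto_add \<phi>(4) \<psi>(4) borel_measurable_diff m)
    then show "(\<lambda>n. \<integral>\<^sup>+ x. ennreal ((norm (\<phi> n x + \<psi> n x - (z + y) x))\<^sup>2) \<partial>?S) \<longlonglongrightarrow> 0"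
      by (simp add: algebra_simps)
    have "(\<lambda>n. \<integral>\<^sup>+ x. ennreal ((norm ((jacobian (\<phi> n) (at x) - weak_gradient \<Omega> v x) +
        (jacobian (\<psi> n) (at x) - weak_gradient \<Omega> w x)))\<^sup>2) \<partial>M) \<longlonglongrightarrow> 0"
      by (intro nn_square_tendsto_add \<phi>(3) \<psi>(3) borel_measurable_diff m)
    moreover have "(\<integral>\<^sup>+ x. ennreal ((norm (jacobian (\<lambda>x. \<phi> n x + \<psi> n x) (at x) - weak_gradient \<Omega> (v + w) x))\<^sup>2) \<partial>M)
      = (\<integral>\<^sup>+ x. ennreal ((norm ((jacobian (\<phi> n) (at x) - weak_gradient \<Omega> v x) +
        (jacobian (\<psi> n) (at x) - weak_gradient \<Omega> w x)))\<^sup>2) \<partial>M)" for n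
    proof (rule nn_integral_cong_AE)
      show "AE x in M. ennreal ((norm (jacobian (\<lambda>x. \<phi> n x + \<psi> n x) (at x) - weak_gradient \<Omega> (v + w) x))\<^sup>2)
        = ennreal ((norm ((jacobian (\<phi> n) (at x) - weak_gradient \<Omega> v x) +
        (jacobian (\<psi> n) (at x) - weak_gradient \<Omega> w x)))\<^sup>2)"
        using weak_gradient_add[OF v w]
      proof eventually_elim
        case (elim x)
        show ?case
          unfolding elim jacobian_add[OF smooth_differentiable[OF \<phi>(1)] smooth_differentiable[OF \<psi>(1)]]
          by (simp add: algebra_simps)
      qed
    qed
    ultimately show "(\<lambda>n. \<integral>\<^sup>+ x. ennreal ((norm (jacobian (\<lambda>x. \<phi> n x + \<psi> n x) (at x) -
        weak_gradient \<Omega> (v + w) x))\<^sup>2) \<partial>M) \<longlonglongrightarrow> 0" by simp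
  qed
qed

lemma has_trace_scale:
  assumes v: "v \<in> H1 \<Omega>" and z: "has_trace \<Omega> v z"
  shows "has_trace \<Omega> (c *\<^sub>R v) (c *\<^sub>R z)"
proof -
  let ?S = "surface_on (frontier \<Omega>)"
  obtain \<phi> where \<phi>: "\<And>n i. smooth (\<lambda>x. \<phi> n x $ i)"
    "(\<lambda>n. \<integral>\<^sup>+ x. ennreal ((norm (\<phi> n x - v x))\<^sup>2) \<partial>M) \<longlonglongrightarrow> 0"
    "(\<lambda>n. \<integral>\<^sup>+ x. ennreal ((norm (jacobian (\<phi> n) (at x) - weak_gradient \<Omega> v x))\<^sup>2) \<partial>M) \<longlonglongrightarrow> 0"
    "(\<lambda>n. \<integral>\<^sup>+ x. ennreal ((norm (\<phi> n x - z x))\<^sup>2) \<partial>?S) \<longlonglongrightarrow> 0"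
    using z unfolding has_trace_def by blast
  have zL: "z \<in> L2 ?S" using z by (auto simp: has_trace_def)
  note m = smooth_measurable[OF \<phi>(1)] L2_measurable[OF H1_L2[OF v]]
    L2_measurable[OF weak_gradient_L2[OF v]] L2_measurable[OF zL]
  show ?thesis
    unfolding has_trace_def
  proof (intro conjI exI[of _ "\<lambda>n x. c *\<^sub>R \<phi> n x"] allI)
    show "c *\<^sub>R z \<in> L2 ?S" using zL by (rule subspace_scale[OF L2_subspace])
    show "smooth (\<lambda>x. (c *\<^sub>R \<phi> n x) $ i)" for n i
      using smooth_scale[OF \<phi>(1)[of n i]] by simp
    have "(\<lambda>n. \<integral>\<^sup>+ x. ennreal ((norm (c *\<^sub>R (\<phi> n x - v x)))\<^sup>2) \<partial>M) \<longlonglongrightarrow> 0"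
      by (intro nn_square_tendsto_scale \<phi>(2) borel_measurable_diff m)
    then show "(\<lambda>n. \<integral>\<^sup>+ x. ennreal ((norm (c *\<^sub>R \<phi> n x - (c *\<^sub>R v) x))\<^sup>2) \<partial>M) \<longlonglongrightarrow> 0"
      by (simp only: scaleR_diff_right scaleR_fun_apply)
    have "(\<lambda>n. \<integral>\<^sup>+ x. ennreal ((norm (c *\<^sub>R (\<phi> n x - z x)))\<^sup>2) \<partial>?S) \<longlonglongrightarrow> 0"
      by (intro nn_square_tendsto_scale \<phi>(4) borel_measurable_diff m)
    then show "(\<lambda>n. \<integral>\<^sup>+ x. ennreal ((norm (c *\<^sub>R \<phi> n x - (c *\<^sub>R z) x))\<^sup>2) \<partial>?S) \<longlonglongrightarrow> 0"
      by (simp only: scaleR_diff_right scaleR_fun_apply)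
    have "(\<lambda>n. \<integral>\<^sup>+ x. ennreal ((norm (c *\<^sub>R (jacobian (\<phi> n) (at x) - weak_gradient \<Omega> v x)))\<^sup>2) \<partial>M) \<longlonglongrightarrow> 0"
      by (intro nn_square_tendsto_scale \<phi>(3) borel_measurable_diff m)
    moreover have "(\<integral>\<^sup>+ x. ennreal ((norm (jacobian (\<lambda>x. c *\<^sub>R \<phi> n x) (at x) - weak_gradient \<Omega> (c *\<^sub>R v) x))\<^sup>2) \<partial>M)
      = (\<integral>\<^sup>+ x. ennreal ((norm (c *\<^sub>R (jacobian (\<phi> n) (at x) - weak_gradient \<Omega> v x)))\<^sup>2) \<partial>M)" for n
    proof (rule nn_integral_cong_AE)
      show "AE x in M. ennreal ((norm (jacobian (\<lambda>x. c *\<^sub>R \<phi> n x) (at x) - weak_gradient \<Omega> (c *\<^sub>R v) x))\<^sup>2)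
        = ennreal ((norm (c *\<^sub>R (jacobian (\<phi> n) (at x) - weak_gradient \<Omega> v x)))\<^sup>2)"
        using weak_gradient_scale[OF v, of c]
      proof eventually_elim
        case (elim x)
        show ?case
          unfolding elim jacobian_scale[OF smooth_differentiable[OF \<phi>(1)]]
          by (simp only: scaleR_diff_right)
      qed
    qed
    ultimately show "(\<lambda>n. \<integral>\<^sup>+ x. ennreal ((norm (jacobian (\<lambda>x. c *\<^sub>R \<phi> n x) (at x) -
        weak_gradient \<Omega> (c *\<^sub>R v) x))\<^sup>2) \<partial>M) \<longlonglongrightarrow> 0" by simp
  qed
qed

lemma has_trace_zero: "has_trace \<Omega> 0 0"
proof -
  let ?S = "surface_on (frontier \<Omega>)"
  have j: "jacobian (\<lambda>x. 0 :: real^'n) (at x) = (0 :: real^'n^'n)" for x :: "real^'n"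
    by (simp add: jacobian_def frechet_derivative_const matrix_def vec_eq_iff)
  have "(\<integral>\<^sup>+ x. ennreal ((norm (jacobian (\<lambda>x. 0 :: real^'n) (at x) - weak_gradient \<Omega> 0 x))\<^sup>2) \<partial>M) = (\<integral>\<^sup>+ x. 0 \<partial>M)"
  proof (rule nn_integral_cong_AE)
    show "AE x in M. ennreal ((norm (jacobian (\<lambda>x. 0 :: real^'n) (at x) - weak_gradient \<Omega> 0 x))\<^sup>2) = 0"
      using weak_gradient_zero by eventually_elim (simp add: j)
  qed
  then show ?thesis
    unfolding has_trace_def using subspace_0[OF L2_subspace, of ?S]
    by (intro conjI exI[of _ "\<lambda>n x. 0"] allI) (simp_all add: smooth_const)
qed

lemma V_space_H1: "v \<in> V_space \<Omega> \<Gamma>D \<Longrightarrow> v \<in> H1 \<Omega>"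
  by (simp add: V_space_def)

lemma V_space_subspace: "subspace (V_space \<Omega> \<Gamma>D)"
  unfolding subspace_def
proof (intro conjI ballI allI)
  show "0 \<in> V_space \<Omega> \<Gamma>D" using H1_zero has_trace_zero by (auto simp: V_space_def intro!: exI[of _ 0])
  fix v w :: "real^'n \<Rightarrow> real^'n" and c
  assume "v \<in> V_space \<Omega> \<Gamma>D"
  then obtain z where v: "v \<in> H1 \<Omega>" "has_trace \<Omega> v z" "AE x in surface_on \<Gamma>D. z x = 0"
    by (auto simp: V_space_def)
  have "AE x in surface_on \<Gamma>D. (c *\<^sub>R z) x = 0" using v(3) by eventually_elim simp
  then show "c *\<^sub>R v \<in> V_space \<Omega> \<Gamma>D"
    using H1_scale[OF v(1)] has_trace_scale[OF v(1,2)] unfolding V_space_def by blast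
  assume "w \<in> V_space \<Omega> \<Gamma>D"
  then obtain y where w: "w \<in> H1 \<Omega>" "has_trace \<Omega> w y" "AE x in surface_on \<Gamma>D. y x = 0"
    by (auto simp: V_space_def)
  have "AE x in surface_on \<Gamma>D. (z + y) x = 0" using v(3) w(3) by eventually_elim simp
  then show "v + w \<in> V_space \<Omega> \<Gamma>D"
    using H1_add[OF v(1) w(1)] has_trace_add[OF v(1) w(1) v(2) w(2)] unfolding V_space_def by blast
qed

end

section \<open>Dual norms, energies and loads\<close>

lemma dual_norm_bounded:
  fixes S :: "('a \<Rightarrow> 'b::real_vector) set"
  assumes F: "bounded_functional S N F"
    and S: "subspace S"
    and N: "\<And>v. v \<in> S \<Longrightarrow> 0 \<le> N v" "\<And>c v. v \<in> S \<Longrightarrow> N (c *\<^sub>R v) \<le> \<bar>c\<bar> * N v"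
  shows "0 \<le> dual_norm S N F" "\<And>v. v \<in> S \<Longrightarrow> \<bar>F v\<bar> \<le> dual_norm S N F * N v"
proof -
  obtain K where K: "\<And>v. v \<in> S \<Longrightarrow> \<bar>F v\<bar> \<le> K * N v"
    using F unfolding bounded_functional_def by blast
  have Fs: "F (c *\<^sub>R v) = c * F v" if "v \<in> S" for c v
    using F that unfolding bounded_functional_def scaleR_fun_def by blast
  have bdd: "bdd_above ((\<lambda>v. \<bar>F v\<bar>) ` {v \<in> S. N v \<le> 1})"
  proof (rule bdd_aboveI2)
    fix v assume v: "v \<in> {v \<in> S. N v \<le> 1}"
    then have "\<bar>F v\<bar> \<le> K * N v" using K by simp
    also have "\<dots> \<le> \<bar>K\<bar> * 1" using v N(1) by (intro mult_mono) auto
    finally show "\<bar>F v\<bar> \<le> \<bar>K\<bar>" by simp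
  qed
  have le: "\<bar>F v\<bar> \<le> dual_norm S N F" if "v \<in> S" "N v \<le> 1" for v
    unfolding dual_norm_def by (rule cSUP_upper2[OF bdd]) (use that in auto)
  have S0: "0 \<in> S" using S by (rule subspace_0)
  have "N 0 \<le> 0" using N(2)[OF S0, of 0] by simp
  then show "0 \<le> dual_norm S N F" using le[OF S0] by linarith
  fix v assume v: "v \<in> S"
  show "\<bar>F v\<bar> \<le> dual_norm S N F * N v"
  proof (cases "N v = 0")
    case True then show ?thesis using K[OF v] by simp
  next
    case False
    then have pos: "N v > 0" using N(1)[OF v] by simp
    have "N ((1 / N v) *\<^sub>R v) \<le> 1" using N(2)[OF v, of "1 / N v"] pos by simp
    from le[OF subspace_scale[OF S v] this] have "\<bar>F v\<bar> / N v \<le> dual_norm S N F"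
      using pos by (simp add: Fs[OF v] abs_mult)
    then show ?thesis using pos by (simp add: field_simps)
  qed
qed

lemma Linfty_mult_L2:
  assumes "g \<in> Linfty M" "f \<in> L2 M" shows "(\<lambda>x. g x * f x) \<in> L2 M"
proof -
  obtain K where K: "AE x in M. \<bar>g x\<bar> \<le> K" and g[measurable]: "g \<in> borel_measurable M"
    using assms(1) by (auto simp: Linfty_def)
  have f[measurable]: "f \<in> borel_measurable M" using assms(2) by (rule L2_measurable)
  have "integrable M (\<lambda>x. (norm (g x * f x))\<^sup>2)"
  proof (rule Bochner_Integration.integrable_bound)
    show "integrable M (\<lambda>x. K\<^sup>2 * (norm (f x))\<^sup>2)" using L2_integrable_square[OF assms(2)] by simp
    show "AE x in M. norm ((norm (g x * f x))\<^sup>2) \<le> norm (K\<^sup>2 * (norm (f x))\<^sup>2)"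
      using K
    proof eventually_elim
      case (elim x)
      then have "(g x)\<^sup>2 \<le> K\<^sup>2" by (metis abs_le_square_iff abs_of_nonneg abs_ge_zero order_trans)
      then show ?case by (simp add: power_mult_distrib abs_mult mult_right_mono)
    qed
  qed measurable
  then show ?thesis by (simp add: L2_def)
qed

lemma L2_matrix_iff:
  fixes f :: "'a \<Rightarrow> real^'m::finite^'k::finite"
  shows "f \<in> L2 M \<longleftrightarrow> (\<forall>i j. (\<lambda>x. f x $ i $ j) \<in> L2 M)"
proof
  assume f: "f \<in> L2 M"
  have bl: "bounded_linear (\<lambda>A :: real^'m^'k. A $ i $ j)" for i j
    by (rule bounded_linear_compose[OF bounded_linear_vec_nth bounded_linear_vec_nth])
  show "\<forall>i j. (\<lambda>x. f x $ i $ j) \<in> L2 M"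
  proof (intro allI)
    fix i j
    have m: "(\<lambda>x. f x $ i $ j) \<in> borel_measurable M"
      by (rule borel_measurable_bounded_linear[OF bl L2_measurable[OF f]])
    have "integrable M (\<lambda>x. (norm (f x $ i $ j))\<^sup>2)"
    proof (rule Bochner_Integration.integrable_bound[OF L2_integrable_square[OF f]])
      show "AE x in M. norm ((norm (f x $ i $ j))\<^sup>2) \<le> norm ((norm (f x))\<^sup>2)"
      proof (rule AE_I2)
        fix x
        have "\<bar>f x $ i $ j\<bar> \<le> norm (f x)"
          using component_le_norm_cart[of "f x $ i" j] Finite_Cartesian_Product.norm_nth_le[of "f x" i] by linarith
        from power_mono[OF this, of 2] show "norm ((norm (f x $ i $ j))\<^sup>2) \<le> norm ((norm (f x))\<^sup>2)" by simp
      qed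
    qed (use m in measurable)
    with m show "(\<lambda>x. f x $ i $ j) \<in> L2 M" by (simp add: L2_def)
  qed
next
  assume f: "\<forall>i j. (\<lambda>x. f x $ i $ j) \<in> L2 M"
  have m: "f \<in> borel_measurable M"
    using f by (subst borel_measurable_euclidean_space) (auto simp: Basis_vec_def inner_axis dest: L2_measurable)
  have "(norm (f x))\<^sup>2 = (\<Sum>i\<in>UNIV. \<Sum>j\<in>UNIV. (norm (f x $ i $ j))\<^sup>2)" for x
    unfolding power2_norm_eq_inner inner_vec_def by (simp add: power2_eq_square)
  moreover have "integrable M (\<lambda>x. \<Sum>i\<in>UNIV. \<Sum>j\<in>UNIV. (norm (f x $ i $ j))\<^sup>2)"
    by (intro Bochner_Integration.integrable_sum L2_integrable_square) (use f in blast)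
  ultimately show "f \<in> L2 M" using m by (simp add: L2_def)
qed

lemma tensor_apply_add: "tensor_apply A (\<sigma> + \<tau>) = tensor_apply A \<sigma> + tensor_apply A \<tau>"
  by (simp add: tensor_apply_def vec_eq_iff distrib_left sum.distrib)

lemma tensor_apply_scale: "tensor_apply A (c *\<^sub>R \<tau>) = c *\<^sub>R tensor_apply A \<tau>"
  by (simp add: tensor_apply_def vec_eq_iff sum_distrib_left mult_ac)

lemma sum_pairs: "(\<Sum>i\<in>UNIV. \<Sum>j\<in>UNIV. h i j) = (\<Sum>p\<in>UNIV. h (fst p) (snd p))"
  by (simp add: sum.cartesian_product split_beta)

lemma tensor_apply_symmetric:
  assumes "\<And>i j k l. A $ i $ j $ k $ l = A $ k $ l $ i $ j"
  shows "tensor_apply A \<sigma> \<bullet> \<tau> = tensor_apply A \<tau> \<bullet> \<sigma>"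
proof -
  have e: "tensor_apply A \<sigma> \<bullet> \<tau> = (\<Sum>p\<in>UNIV. \<Sum>q\<in>UNIV. A $ fst p $ snd p $ fst q $ snd q *
      \<sigma> $ fst q $ snd q * \<tau> $ fst p $ snd p)" for \<sigma> \<tau>
  proof -
    have "tensor_apply A \<sigma> $ i $ j = (\<Sum>q\<in>UNIV. A $ i $ j $ fst q $ snd q * \<sigma> $ fst q $ snd q)" for i j
      by (simp add: tensor_apply_def sum_pairs)
    moreover have "tensor_apply A \<sigma> \<bullet> \<tau> =
        (\<Sum>p\<in>UNIV. tensor_apply A \<sigma> $ fst p $ snd p * \<tau> $ fst p $ snd p)"
      by (simp add: inner_vec_def sum_pairs)
    ultimately show ?thesis by (simp add: sum_distrib_right)
  qed
  show ?thesis
    unfolding e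
  proof (subst sum.swap, intro sum.cong refl)
    fix p q :: "'a \<times> 'a"
    show "A $ fst q $ snd q $ fst p $ snd p * \<sigma> $ fst p $ snd p * \<tau> $ fst q $ snd q =
      A $ fst p $ snd p $ fst q $ snd q * \<tau> $ fst q $ snd q * \<sigma> $ fst p $ snd p"
      using assms[of "fst p" "snd p" "fst q" "snd q"] by simp
  qed
qed

context bounded_open
begin

lemma tensor_L2:
  assumes "material_tensor \<Omega> c A" "\<tau> \<in> L2 M"
  shows "(\<lambda>x. tensor_apply (A x) (\<tau> x)) \<in> L2 M"
proof -
  have "(\<Sum>k\<in>UNIV. \<Sum>l\<in>UNIV. (\<lambda>x. A x $ i $ j $ k $ l * \<tau> x $ k $ l)) \<in> L2 M" for i j
    using assms
    by (intro subspace_sum[OF L2_subspace] Linfty_mult_L2) (auto simp: material_tensor_def L2_matrix_iff[of \<tau>])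
  then have "(\<lambda>x. \<Sum>k\<in>UNIV. \<Sum>l\<in>UNIV. A x $ i $ j $ k $ l * \<tau> x $ k $ l) \<in> L2 M" for i j
    by (simp add: sum_fun_apply[abs_def] fun_eq_iff)
  then show ?thesis by (subst L2_matrix_iff) (simp add: tensor_apply_def)
qed

definition energy :: "(real^'n \<Rightarrow> real^'n^'n^'n^'n) \<Rightarrow> (real^'n \<Rightarrow> real^'n^'n) \<Rightarrow> (real^'n \<Rightarrow> real^'n^'n) \<Rightarrow> real" where
  "energy A \<sigma> \<tau> = L2_inner M (\<lambda>x. tensor_apply (A x) (\<sigma> x)) \<tau>"

lemma energy_add:
  assumes "material_tensor \<Omega> c A" "\<sigma> \<in> L2 M" "\<rho> \<in> L2 M" "\<tau> \<in> L2 M"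
  shows "energy A (\<sigma> + \<rho>) \<tau> = energy A \<sigma> \<tau> + energy A \<rho> \<tau>"
  using semi_inner.add_left[OF L2_semi_inner tensor_L2[OF assms(1,2)] tensor_L2[OF assms(1,3)] assms(4)]
  by (simp add: energy_def tensor_apply_add plus_fun_def)

lemma energy_scale:
  assumes "material_tensor \<Omega> c A" "\<sigma> \<in> L2 M" "\<tau> \<in> L2 M"
  shows "energy A (r *\<^sub>R \<sigma>) \<tau> = r * energy A \<sigma> \<tau>"
  using semi_inner.scale_left[OF L2_semi_inner tensor_L2[OF assms(1,2)] assms(3)]
  by (simp add: energy_def tensor_apply_scale scaleR_fun_def)

lemma energy_sym:
  assumes "material_tensor \<Omega> c A" "\<sigma> \<in> L2 M" "\<tau> \<in> L2 M"
  shows "energy A \<sigma> \<tau> = energy A \<tau> \<sigma>"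
  unfolding energy_def L2_inner_def
proof (rule integral_cong_AE)
  have "AE x in M. \<forall>i j k l. A x $ i $ j $ k $ l = A x $ j $ i $ l $ k \<and> A x $ i $ j $ k $ l = A x $ k $ l $ i $ j"
    using assms(1) unfolding material_tensor_def by blast
  then show "AE x in M. tensor_apply (A x) (\<sigma> x) \<bullet> \<tau> x = tensor_apply (A x) (\<tau> x) \<bullet> \<sigma> x"
    by eventually_elim (rule tensor_apply_symmetric, blast)
qed (use assms tensor_L2 in \<open>auto intro!: borel_measurable_inner intro: L2_measurable\<close>)

text \<open>
  In terms of \<open>\<epsilon>(u) - p\<close> the form \<open>a\<close> is a sum of two weighted \<open>L2\<close> products, which reduces
  bilinearity and symmetry of \<open>a\<close> to those of \<open>energy\<close>.
\<close>

definition elastic_strain :: "(real^'n \<Rightarrow> real^'n) \<times> (real^'n \<Rightarrow> real^'n^'n) \<Rightarrow> real^'n \<Rightarrow> real^'n^'n" where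
  "elastic_strain x = (\<lambda>y. strain \<Omega> (fst x) y - snd x y)"

lemma a_form_energy:
  "a_form \<Omega> \<C> \<H> x y = energy \<C> (elastic_strain x) (elastic_strain y) + energy \<H> (snd x) (snd y)"
  by (simp add: a_form_def energy_def elastic_strain_def stress_def[abs_def] split_beta)

lemma elastic_strain_L2:
  assumes "fst x \<in> H1 \<Omega>" "snd x \<in> L2 M" shows "elastic_strain x \<in> L2 M"
  using subspace_diff[OF L2_subspace strain_L2[OF assms(1)] assms(2)]
  by (simp add: elastic_strain_def fun_diff_def)

lemma elastic_strain_add:
  assumes "fst x \<in> H1 \<Omega>" "fst y \<in> H1 \<Omega>"
  shows "AE z in M. elastic_strain (x + y) z = (elastic_strain x + elastic_strain y) z"
  using strain_add[OF assms] by eventually_elim (simp add: elastic_strain_def)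

lemma elastic_strain_scale:
  assumes "fst x \<in> H1 \<Omega>"
  shows "AE z in M. elastic_strain (c *\<^sub>R x) z = (c *\<^sub>R elastic_strain x) z"
  using strain_scale[OF assms, of c] by eventually_elim (simp add: elastic_strain_def algebra_simps)

lemma energy_cong:
  assumes "material_tensor \<Omega> c A" "\<sigma> \<in> L2 M" "\<sigma>' \<in> L2 M" "\<tau> \<in> L2 M"
    and eq: "AE x in M. \<sigma> x = \<sigma>' x"
  shows "energy A \<sigma> \<tau> = energy A \<sigma>' \<tau>"
proof -
  have "AE x in M. tensor_apply (A x) (\<sigma> x) = tensor_apply (A x) (\<sigma>' x)"
    using eq by eventually_elim simp
  then show ?thesis
    unfolding energy_def using assms tensor_L2
    by (intro L2_inner_cong L2_measurable) auto
qed

lemma a_form_semi_inner: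
  assumes C: "material_tensor \<Omega> ce \<C>" and H: "material_tensor \<Omega> ch \<H>"
    and X: "subspace X" "\<And>x. x \<in> X \<Longrightarrow> fst x \<in> H1 \<Omega>" "\<And>x. x \<in> X \<Longrightarrow> snd x \<in> L2 M"
    and nonneg: "\<And>x. x \<in> X \<Longrightarrow> 0 \<le> a_form \<Omega> \<C> \<H> x x"
  shows "semi_inner X (a_form \<Omega> \<C> \<H>)"
proof
  show "subspace X" by fact
  fix x y z c assume x: "x \<in> X" and z: "z \<in> X"
  note E = elastic_strain_L2[OF X(2,3)]
  have cx: "c *\<^sub>R x \<in> X" using X(1) x by (rule subspace_scale)
  have "energy \<C> (elastic_strain (c *\<^sub>R x)) (elastic_strain z) = energy \<C> (c *\<^sub>R elastic_strain x) (elastic_strain z)"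
    by (rule energy_cong[OF C E[OF cx cx] subspace_scale[OF L2_subspace E[OF x x]] E[OF z z]
          elastic_strain_scale[OF X(2)[OF x]]])
  then show "a_form \<Omega> \<C> \<H> (c *\<^sub>R x) z = c * a_form \<Omega> \<C> \<H> x z"
    using energy_scale[OF C E[OF x x] E[OF z z]] energy_scale[OF H X(3)[OF x] X(3)[OF z]]
    by (simp add: a_form_energy distrib_left)
  assume y: "y \<in> X"
  have xy: "x + y \<in> X" using X(1) x y by (rule subspace_add)
  have "energy \<C> (elastic_strain (x + y)) (elastic_strain z) = energy \<C> (elastic_strain x + elastic_strain y) (elastic_strain z)"
    by (rule energy_cong[OF C E[OF xy xy] subspace_add[OF L2_subspace E[OF x x] E[OF y y]] E[OF z z]
          elastic_strain_add[OF X(2)[OF x] X(2)[OF y]]])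
  then show "a_form \<Omega> \<C> \<H> (x + y) z = a_form \<Omega> \<C> \<H> x z + a_form \<Omega> \<C> \<H> y z"
    using energy_add[OF C E[OF x x] E[OF y y] E[OF z z]] energy_add[OF H X(3)[OF x] X(3)[OF y] X(3)[OF z]]
    by (simp add: a_form_energy)
next
  fix x y assume x: "x \<in> X" and y: "y \<in> X"
  note E = elastic_strain_L2[OF X(2,3)]
  show "a_form \<Omega> \<C> \<H> x y = a_form \<Omega> \<C> \<H> y x"
    using energy_sym[OF C E[OF x x] E[OF y y]] energy_sym[OF H X(3)[OF x] X(3)[OF y]]
    by (simp add: a_form_energy)
qed (fact nonneg)

lemma L2_inner_scale: "L2_inner N (c *\<^sub>R h) (c *\<^sub>R h) = c\<^sup>2 * L2_inner N h h"
  by (simp add: L2_inner_def power2_eq_square mult.assoc)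

lemma norm_1_nonneg: "0 \<le> norm_1 \<Omega> v" by (simp add: norm_1_def)

lemma norm_1_square: "(norm_1 \<Omega> v)\<^sup>2 = L2_inner M v v + L2_inner M (strain \<Omega> v) (strain \<Omega> v)"
  by (simp add: norm_1_def flip: L2_norm_square)

lemma norm_1_scale:
  assumes "v \<in> H1 \<Omega>" shows "norm_1 \<Omega> (c *\<^sub>R v) = \<bar>c\<bar> * norm_1 \<Omega> v"
proof -
  have s: "strain \<Omega> v \<in> L2 M" "strain \<Omega> (c *\<^sub>R v) \<in> L2 M" using assms by (auto intro: strain_L2 H1_scale)
  have "L2_inner M (strain \<Omega> (c *\<^sub>R v)) (strain \<Omega> (c *\<^sub>R v)) = L2_inner M (c *\<^sub>R strain \<Omega> v) (c *\<^sub>R strain \<Omega> v)"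
    using strain_scale[OF assms, of c] s subspace_scale[OF L2_subspace s(1)]
    by (intro L2_inner_cong L2_measurable) auto
  then have "(norm_1 \<Omega> (c *\<^sub>R v))\<^sup>2 = c\<^sup>2 * (norm_1 \<Omega> v)\<^sup>2"
    by (simp add: norm_1_square L2_inner_scale s H1_L2[OF assms] distrib_left)
  then have "(norm_1 \<Omega> (c *\<^sub>R v))\<^sup>2 = (\<bar>c\<bar> * norm_1 \<Omega> v)\<^sup>2" by (simp add: power_mult_distrib)
  then show ?thesis by (rule power2_eq_imp_eq) (simp_all add: norm_1_nonneg)
qed

lemma norm_1_zero: "norm_1 \<Omega> 0 = 0"
  using norm_1_scale[OF H1_zero, of 0] by simp

lemma boundary_trace: "v \<in> V_space \<Omega> \<Gamma>D \<Longrightarrow> has_trace \<Omega> v (boundary_trace \<Omega> v)"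
  unfolding V_space_def boundary_trace_def by (auto intro: someI[of "has_trace \<Omega> v"])

lemma trace_in_trace_space:
  "v \<in> V_space \<Omega> \<Gamma>D \<Longrightarrow> has_trace \<Omega> v z \<Longrightarrow> z \<in> trace_space \<Omega> \<Gamma>D"
  unfolding trace_space_def has_neumann_trace_def by auto

lemma has_neumann_trace_scale:
  assumes "v \<in> H1 \<Omega>" "has_neumann_trace \<Omega> \<Gamma>D v w"
  shows "has_neumann_trace \<Omega> \<Gamma>D (c *\<^sub>R v) (c *\<^sub>R w)"
proof -
  obtain z where z: "has_trace \<Omega> v z" "AE x in surface_on (neumann_part \<Omega> \<Gamma>D). w x = z x"
    using assms(2) by (auto simp: has_neumann_trace_def)
  have "AE x in surface_on (neumann_part \<Omega> \<Gamma>D). (c *\<^sub>R w) x = (c *\<^sub>R z) x"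
    using z(2) by eventually_elim simp
  then show ?thesis unfolding has_neumann_trace_def using has_trace_scale[OF assms(1) z(1)] by blast
qed

lemma has_neumann_trace_add:
  assumes "v \<in> H1 \<Omega>" "has_neumann_trace \<Omega> \<Gamma>D v w" "v' \<in> H1 \<Omega>" "has_neumann_trace \<Omega> \<Gamma>D v' w'"
  shows "has_neumann_trace \<Omega> \<Gamma>D (v + v') (w + w')"
proof -
  obtain z where z: "has_trace \<Omega> v z" "AE x in surface_on (neumann_part \<Omega> \<Gamma>D). w x = z x"
    using assms(2) by (auto simp: has_neumann_trace_def)
  obtain z' where z': "has_trace \<Omega> v' z'" "AE x in surface_on (neumann_part \<Omega> \<Gamma>D). w' x = z' x"
    using assms(4) by (auto simp: has_neumann_trace_def)
  have "AE x in surface_on (neumann_part \<Omega> \<Gamma>D). (w + w') x = (z + z') x"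
    using z(2) z'(2) by eventually_elim simp
  then show ?thesis unfolding has_neumann_trace_def using has_trace_add[OF assms(1,3) z(1) z'(1)] by blast
qed

lemma trace_space_subspace: "subspace (trace_space \<Omega> \<Gamma>D)"
  unfolding subspace_def
proof (intro conjI ballI allI)
  show "0 \<in> trace_space \<Omega> \<Gamma>D"
    using trace_in_trace_space[OF subspace_0[OF V_space_subspace] has_trace_zero] .
  fix w w' :: "real^'n \<Rightarrow> real^'n" and c
  assume "w \<in> trace_space \<Omega> \<Gamma>D"
  then obtain v where v: "v \<in> V_space \<Omega> \<Gamma>D" "has_neumann_trace \<Omega> \<Gamma>D v w" by (auto simp: trace_space_def)
  show "c *\<^sub>R w \<in> trace_space \<Omega> \<Gamma>D"
    unfolding trace_space_def
    using has_neumann_trace_scale[OF V_space_H1[OF v(1)] v(2)] subspace_scale[OF V_space_subspace v(1)] by blast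
  assume "w' \<in> trace_space \<Omega> \<Gamma>D"
  then obtain v' where v': "v' \<in> V_space \<Omega> \<Gamma>D" "has_neumann_trace \<Omega> \<Gamma>D v' w'" by (auto simp: trace_space_def)
  show "w + w' \<in> trace_space \<Omega> \<Gamma>D"
    unfolding trace_space_def
    using has_neumann_trace_add[OF V_space_H1[OF v(1)] v(2) V_space_H1[OF v'(1)] v'(2)]
      subspace_add[OF V_space_subspace v(1) v'(1)] by blast
qed

lemma trace_norm_le:
  "v \<in> V_space \<Omega> \<Gamma>D \<Longrightarrow> has_neumann_trace \<Omega> \<Gamma>D v w \<Longrightarrow> trace_norm \<Omega> \<Gamma>D w \<le> norm_1 \<Omega> v"
  unfolding trace_norm_def
  by (rule cINF_lower) (auto intro!: bdd_belowI2[where m = 0] simp: norm_1_nonneg)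

lemma trace_norm_nonneg: "w \<in> trace_space \<Omega> \<Gamma>D \<Longrightarrow> 0 \<le> trace_norm \<Omega> \<Gamma>D w"
  unfolding trace_norm_def by (rule cINF_greatest) (auto simp: trace_space_def norm_1_nonneg)

lemma trace_norm_scale:
  assumes "w \<in> trace_space \<Omega> \<Gamma>D"
  shows "trace_norm \<Omega> \<Gamma>D (c *\<^sub>R w) \<le> \<bar>c\<bar> * trace_norm \<Omega> \<Gamma>D w"
proof -
  let ?E = "{v \<in> V_space \<Omega> \<Gamma>D. has_neumann_trace \<Omega> \<Gamma>D v w}"
  have le: "trace_norm \<Omega> \<Gamma>D (c *\<^sub>R w) \<le> \<bar>c\<bar> * norm_1 \<Omega> v" if "v \<in> ?E" for v
    using trace_norm_le[OF subspace_scale[OF V_space_subspace] has_neumann_trace_scale[OF V_space_H1]]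
      norm_1_scale[OF V_space_H1] that by (metis (mono_tags, lifting) mem_Collect_eq)
  have ne: "?E \<noteq> {}" using assms by (auto simp: trace_space_def)
  show ?thesis
  proof (cases "c = 0")
    case True
    then show ?thesis using le ne by auto
  next
    case False
    have "trace_norm \<Omega> \<Gamma>D (c *\<^sub>R w) / \<bar>c\<bar> \<le> trace_norm \<Omega> \<Gamma>D w"
      unfolding trace_norm_def[of _ _ w]
      by (rule cINF_greatest[OF ne]) (use le False in \<open>simp add: divide_le_eq mult.commute\<close>)
    then show ?thesis using False by (simp add: divide_le_eq mult.commute)
  qed
qed

text \<open>
  The surface load is applied to a chosen trace. Two traces of the same function differ by a trace
  of zero, whose trace norm is zero because the zero function extends it; so a bounded functional
  takes the same value on both, and linearity of traces up to this ambiguity suffices.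
\<close>

lemma load_linear_bounded:
  assumes f: "bounded_functional (V_space \<Omega> \<Gamma>D) (norm_1 \<Omega>) f"
    and g: "bounded_functional (trace_space \<Omega> \<Gamma>D) (trace_norm \<Omega> \<Gamma>D) g"
    and tr: "0 \<le> ctr" "\<And>v. v \<in> V_space \<Omega> \<Gamma>D \<Longrightarrow> trace_norm \<Omega> \<Gamma>D (boundary_trace \<Omega> v) \<le> ctr * norm_1 \<Omega> v"
  shows "\<And>v w. v \<in> V_space \<Omega> \<Gamma>D \<Longrightarrow> w \<in> V_space \<Omega> \<Gamma>D \<Longrightarrow> load \<Omega> f g (v + w) = load \<Omega> f g v + load \<Omega> f g w"
    and "\<And>c v. v \<in> V_space \<Omega> \<Gamma>D \<Longrightarrow> load \<Omega> f g (c *\<^sub>R v) = c * load \<Omega> f g v"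
    and "\<And>v. v \<in> V_space \<Omega> \<Gamma>D \<Longrightarrow> \<bar>load \<Omega> f g v\<bar> \<le>
      (dual_norm (V_space \<Omega> \<Gamma>D) (norm_1 \<Omega>) f + ctr * dual_norm (trace_space \<Omega> \<Gamma>D) (trace_norm \<Omega> \<Gamma>D) g) * norm_1 \<Omega> v"
    and "0 \<le> dual_norm (V_space \<Omega> \<Gamma>D) (norm_1 \<Omega>) f +
      ctr * dual_norm (trace_space \<Omega> \<Gamma>D) (trace_norm \<Omega> \<Gamma>D) g"
proof -
  let ?V = "V_space \<Omega> \<Gamma>D" and ?W = "trace_space \<Omega> \<Gamma>D" and ?t = "boundary_trace \<Omega>"
  note sV = V_space_subspace[of \<Gamma>D] and sW = trace_space_subspace[of \<Gamma>D]
  have f_add: "f (v + w) = f v + f w" if "v \<in> ?V" "w \<in> ?V" for v w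
    using f that unfolding bounded_functional_def plus_fun_def by blast
  have f_scale: "f (c *\<^sub>R v) = c * f v" if "v \<in> ?V" for c v
    using f that unfolding bounded_functional_def scaleR_fun_def by blast
  have g_add: "g (v + w) = g v + g w" if "v \<in> ?W" "w \<in> ?W" for v w
    using g that unfolding bounded_functional_def plus_fun_def by blast
  have g_scale: "g (c *\<^sub>R v) = c * g v" if "v \<in> ?W" for c v
    using g that unfolding bounded_functional_def scaleR_fun_def by blast
  have tW: "?t v \<in> ?W" if "v \<in> ?V" for v
    using trace_in_trace_space[OF that boundary_trace[OF that]] .
  have df: "\<bar>f v\<bar> \<le> dual_norm ?V (norm_1 \<Omega>) f * norm_1 \<Omega> v" if "v \<in> ?V" for v
    by (rule dual_norm_bounded(2)[OF f sV]) (auto simp: norm_1_nonneg norm_1_scale V_space_H1 that)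
  have dg: "0 \<le> dual_norm ?W (trace_norm \<Omega> \<Gamma>D) g"
    by (rule dual_norm_bounded(1)[OF g sW]) (auto intro: trace_norm_nonneg trace_norm_scale)
  have "0 \<le> dual_norm ?V (norm_1 \<Omega>) f"
    by (rule dual_norm_bounded(1)[OF f sV]) (auto simp: norm_1_nonneg norm_1_scale V_space_H1)
  then show "0 \<le> dual_norm ?V (norm_1 \<Omega>) f + ctr * dual_norm ?W (trace_norm \<Omega> \<Gamma>D) g"
    using dg tr(1) by simp
  have dg2: "\<bar>g w\<bar> \<le> dual_norm ?W (trace_norm \<Omega> \<Gamma>D) g * trace_norm \<Omega> \<Gamma>D w" if "w \<in> ?W" for w
    by (rule dual_norm_bounded(2)[OF g sW]) (auto intro: trace_norm_nonneg trace_norm_scale that)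
  have g_null: "g z = 0" if "has_trace \<Omega> 0 z" for z
  proof -
    have V0: "0 \<in> ?V" by (rule subspace_0[OF sV])
    have "has_neumann_trace \<Omega> \<Gamma>D 0 z" using that unfolding has_neumann_trace_def by auto
    from trace_norm_le[OF V0 this] have "trace_norm \<Omega> \<Gamma>D z \<le> 0" by (simp add: norm_1_zero)
    moreover have zW: "z \<in> ?W" by (rule trace_in_trace_space[OF V0 that])
    ultimately have "trace_norm \<Omega> \<Gamma>D z = 0" using trace_norm_nonneg by (simp add: antisym)
    then show ?thesis using dg2[OF zW] by simp
  qed
  \<comment> \<open>any two traces of a function carry the same surface load\<close>
  have g_unique: "g z = g y" if "v \<in> ?V" "has_trace \<Omega> v z" "has_trace \<Omega> v y" for v z y
  proof -
    have vH: "v \<in> H1 \<Omega>" using that(1) by (rule V_space_H1)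
    have "has_trace \<Omega> (v + (- 1) *\<^sub>R v) (z + (- 1) *\<^sub>R y)"
      by (intro has_trace_add has_trace_scale vH that H1_scale)
    then have "has_trace \<Omega> 0 (z - y)" by simp
    from g_null[OF this] have "g (z - y) = 0" .
    moreover have zy: "z \<in> ?W" "y \<in> ?W"
      by (rule trace_in_trace_space[OF that(1,2)], rule trace_in_trace_space[OF that(1,3)])
    have "g ((z - y) + y) = g (z - y) + g y" by (rule g_add[OF subspace_diff[OF sW zy] zy(2)])
    ultimately show ?thesis by simp
  qed
  show "load \<Omega> f g (v + w) = load \<Omega> f g v + load \<Omega> f g w" if "v \<in> ?V" "w \<in> ?V" for v w
  proof -
    have vw: "v + w \<in> ?V" using that by (rule subspace_add[OF sV])
    have "has_trace \<Omega> (v + w) (?t v + ?t w)"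
      using that by (intro has_trace_add boundary_trace V_space_H1)
    from g_unique[OF vw boundary_trace[OF vw] this] show ?thesis
      using that by (simp add: load_def f_add g_add tW)
  qed
  show "load \<Omega> f g (c *\<^sub>R v) = c * load \<Omega> f g v" if "v \<in> ?V" for c v
  proof -
    have cv: "c *\<^sub>R v \<in> ?V" using that by (rule subspace_scale[OF sV])
    have "has_trace \<Omega> (c *\<^sub>R v) (c *\<^sub>R ?t v)"
      using that by (intro has_trace_scale boundary_trace V_space_H1)
    from g_unique[OF cv boundary_trace[OF cv] this] show ?thesis
      using that by (simp add: load_def f_scale g_scale tW distrib_left)
  qed
  show "\<bar>load \<Omega> f g v\<bar> \<le> (dual_norm ?V (norm_1 \<Omega>) f + ctr * dual_norm ?W (trace_norm \<Omega> \<Gamma>D) g) * norm_1 \<Omega> v"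
    if "v \<in> ?V" for v
  proof -
    have "\<bar>load \<Omega> f g v\<bar> \<le> \<bar>f v\<bar> + \<bar>g (?t v)\<bar>" by (simp add: load_def abs_triangle_ineq)
    also have "\<dots> \<le> dual_norm ?V (norm_1 \<Omega>) f * norm_1 \<Omega> v + dual_norm ?W (trace_norm \<Omega> \<Gamma>D) g * trace_norm \<Omega> \<Gamma>D (?t v)"
      using df[OF that] dg2[OF tW[OF that]] by simp
    also have "dual_norm ?W (trace_norm \<Omega> \<Gamma>D) g * trace_norm \<Omega> \<Gamma>D (?t v) \<le> dual_norm ?W (trace_norm \<Omega> \<Gamma>D) g * (ctr * norm_1 \<Omega> v)"
      using tr(2)[OF that] dg by (rule mult_left_mono)
    finally show ?thesis by (simp add: algebra_simps)
  qed
qed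

end

section \<open>Tensor-product polynomials and Gauss points\<close>

definition multi_indices :: "nat \<Rightarrow> ('n::finite \<Rightarrow> nat) set" where
  "multi_indices k = {\<alpha>. \<forall>i. \<alpha> i \<le> k}"

lemma finite_multi_indices: "finite (multi_indices k :: ('n::finite \<Rightarrow> nat) set)"
proof -
  have "(multi_indices k :: ('n \<Rightarrow> nat) set) = (UNIV \<rightarrow>\<^sub>E {..k})" by (auto simp: multi_indices_def)
  moreover have "finite (UNIV \<rightarrow>\<^sub>E {..k} :: ('n \<Rightarrow> nat) set)" by (intro finite_PiE) auto
  ultimately show ?thesis by (simp only:)
qed

lemma multi_indices_mono: "k \<le> l \<Longrightarrow> multi_indices k \<subseteq> multi_indices l"
  by (auto simp: multi_indices_def intro: order_trans)

definition poly_coeffs :: "nat \<Rightarrow> (real^'n::finite \<Rightarrow> real) \<Rightarrow> ('n \<Rightarrow> nat) \<Rightarrow> real" where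
  "poly_coeffs k P = (SOME c. \<forall>x. P x = (\<Sum>\<alpha>\<in>multi_indices k. c \<alpha> * (\<Prod>i\<in>UNIV. (x $ i) ^ \<alpha> i)))"

lemma tensor_poly_expansion:
  assumes "P \<in> tensor_polys k"
  shows "P x = (\<Sum>\<alpha>\<in>multi_indices k. poly_coeffs k P \<alpha> * (\<Prod>i\<in>UNIV. (x $ i) ^ \<alpha> i))"
proof -
  have "\<exists>c. \<forall>x. P x = (\<Sum>\<alpha>\<in>multi_indices k. c \<alpha> * (\<Prod>i\<in>UNIV. (x $ i) ^ \<alpha> i))"
    using assms by (simp add: tensor_polys_def multi_indices_def)
  from someI_ex[OF this] show ?thesis unfolding poly_coeffs_def by blast
qed

lemma tensor_polys_subspace: "subspace (tensor_polys k :: (real^'n::finite \<Rightarrow> real) set)"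
  unfolding subspace_def
proof (intro conjI ballI allI)
  show "0 \<in> tensor_polys k" by (auto simp: tensor_polys_def intro!: exI[of _ "\<lambda>_. 0"])
  fix P Q :: "real^'n \<Rightarrow> real" and r
  assume P: "P \<in> tensor_polys k"
  then obtain c where c: "\<forall>x. P x = (\<Sum>\<alpha>\<in>{\<alpha>. \<forall>i. \<alpha> i \<le> k}. c \<alpha> * (\<Prod>i\<in>UNIV. (x $ i) ^ \<alpha> i))"
    unfolding tensor_polys_def by blast
  show "r *\<^sub>R P \<in> tensor_polys k"
    unfolding tensor_polys_def
    by (intro CollectI exI[of _ "\<lambda>\<alpha>. r * c \<alpha>"]) (simp add: c sum_distrib_left mult.assoc)
  assume "Q \<in> tensor_polys k"
  then obtain d where d: "\<forall>x. Q x = (\<Sum>\<alpha>\<in>{\<alpha>. \<forall>i. \<alpha> i \<le> k}. d \<alpha> * (\<Prod>i\<in>UNIV. (x $ i) ^ \<alpha> i))"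
    unfolding tensor_polys_def by blast
  show "P + Q \<in> tensor_polys k"
    unfolding tensor_polys_def
    by (intro CollectI exI[of _ "\<lambda>\<alpha>. c \<alpha> + d \<alpha>"]) (simp add: c d sum.distrib distrib_right)
qed

lemma tensor_polys_add: "P \<in> tensor_polys k \<Longrightarrow> Q \<in> tensor_polys k \<Longrightarrow> (\<lambda>y. P y + Q y) \<in> tensor_polys k"
  using subspace_add[OF tensor_polys_subspace] unfolding plus_fun_def by blast

lemma tensor_polys_scale: "P \<in> tensor_polys k \<Longrightarrow> (\<lambda>y. c * P y) \<in> tensor_polys k"
  using subspace_scale[OF tensor_polys_subspace] unfolding scaleR_fun_def real_scaleR_def by blast

lemma tensor_polys_zero: "(\<lambda>y. 0) \<in> tensor_polys k"
  using subspace_0[OF tensor_polys_subspace] unfolding zero_fun_def by blast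

lemma tensor_poly_combination_zero:
  assumes P: "\<And>x. x \<in> J \<Longrightarrow> P x \<in> tensor_polys k"
    and zero: "\<And>\<alpha>. \<alpha> \<in> multi_indices k \<Longrightarrow> (\<Sum>x\<in>J. a x * poly_coeffs k (P x) \<alpha>) = 0"
  shows "(\<Sum>x\<in>J. a x * P x y) = 0"
proof -
  have "(\<Sum>x\<in>J. a x * P x y) =
      (\<Sum>x\<in>J. \<Sum>\<alpha>\<in>multi_indices k. a x * poly_coeffs k (P x) \<alpha> * (\<Prod>i\<in>UNIV. (y $ i) ^ \<alpha> i))"
    by (rule sum.cong) (simp_all add: tensor_poly_expansion[OF P, of _ y] sum_distrib_left mult.assoc)
  also have "\<dots> = (\<Sum>\<alpha>\<in>multi_indices k. (\<Sum>x\<in>J. a x * poly_coeffs k (P x) \<alpha>) * (\<Prod>i\<in>UNIV. (y $ i) ^ \<alpha> i))"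
    by (subst sum.swap) (simp add: sum_distrib_right)
  also have "\<dots> = 0" by (simp add: zero)
  finally show ?thesis .
qed

lemma degree_funpow_pderiv:
  "degree ((pderiv ^^ m) p) = degree p - m" for p :: "real poly"
  by (induction m) (auto simp: degree_pderiv)

text \<open>
  The \<open>n\<close>-th derivative of \<open>(x\<^sup>2 - 1)\<^sup>n\<close> has degree \<open>n\<close>, and for \<open>n = 0\<close> it is the constant
  one; so it is nonzero and has finitely many roots.
\<close>

lemma finite_gauss_points: "finite (gauss_points n :: (real^'n::finite) set)"
proof -
  have "(pderiv ^^ n) ([:- 1, 0, 1:] ^ n :: real poly) \<noteq> 0"
  proof (cases "n = 0")
    case False
    have "degree ((pderiv ^^ n) ([:- 1, 0, 1:] ^ n :: real poly)) = n"
      by (simp add: degree_funpow_pderiv degree_power_eq)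
    then show ?thesis using False by auto
  qed simp
  then have fin: "finite (gauss_legendre_nodes n)"
    unfolding gauss_legendre_nodes_def by (rule poly_roots_finite)
  have "gauss_points n \<subseteq> vec_lambda ` (UNIV \<rightarrow>\<^sub>E gauss_legendre_nodes n :: ('n \<Rightarrow> real) set)"
  proof
    fix x :: "real^'n" assume "x \<in> gauss_points n"
    then have "($) x \<in> (UNIV \<rightarrow>\<^sub>E gauss_legendre_nodes n)" by (auto simp: gauss_points_def)
    then show "x \<in> vec_lambda ` (UNIV \<rightarrow>\<^sub>E gauss_legendre_nodes n)"
      by (intro image_eqI[of _ _ "($) x"]) auto
  qed
  then show ?thesis using fin by (meson finite_PiE finite finite_imageI finite_subset)
qed

section \<open>Finite element spaces\<close>

lemma represents_on_add:
  assumes "represents_on \<Omega> F T P v" "represents_on \<Omega> F T Q w"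
  shows "represents_on \<Omega> F T (P + Q) (v + w)"
  using assms unfolding represents_on_def by eventually_elim simp

lemma represents_on_scale:
  assumes "represents_on \<Omega> F T P v"
  shows "represents_on \<Omega> F T (c *\<^sub>R P) (c *\<^sub>R v)"
  using assms unfolding represents_on_def by eventually_elim simp

lemma represents_on_zero: "represents_on \<Omega> F T 0 0"
  by (simp add: represents_on_def)

lemma deviatoric_subspace: "subspace deviatoric_matrices"
  by (simp add: subspace_def deviatoric_matrices_def sym_matrices_def trace_def transpose_def
      vec_eq_iff sum.distrib flip: sum_distrib_left)

lemma Q_space_subspace:
  fixes \<Omega> :: "(real^'n::finite) set"
  shows "subspace (Q_space \<Omega>)"
  unfolding subspace_def
proof (intro conjI ballI allI)
  show "0 \<in> Q_space \<Omega>"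
    by (simp add: Q_space_def subspace_0[OF L2_subspace] subspace_0[OF deviatoric_subspace])
  fix p q :: "real^'n \<Rightarrow> real^'n^'n" and c
  assume p: "p \<in> Q_space \<Omega>"
  then have p': "AE x in lebesgue_on \<Omega>. p x \<in> deviatoric_matrices" by (simp add: Q_space_def)
  have "AE x in lebesgue_on \<Omega>. (c *\<^sub>R p) x \<in> deviatoric_matrices"
    using p' by eventually_elim (simp add: subspace_scale[OF deviatoric_subspace])
  then show "c *\<^sub>R p \<in> Q_space \<Omega>" using p by (simp add: Q_space_def subspace_scale[OF L2_subspace])
  assume q: "q \<in> Q_space \<Omega>"
  then have "AE x in lebesgue_on \<Omega>. q x \<in> deviatoric_matrices" by (simp add: Q_space_def)
  with p' have "AE x in lebesgue_on \<Omega>. (p + q) x \<in> deviatoric_matrices"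
    by eventually_elim (simp add: subspace_add[OF deviatoric_subspace])
  then show "p + q \<in> Q_space \<Omega>" using p q by (simp add: Q_space_def subspace_add[OF L2_subspace])
qed

lemma matrix_polys_subspace:
  "subspace {P :: real^'n::finite \<Rightarrow> real^'m^'k. \<forall>i j. (\<lambda>y. P y $ i $ j) \<in> tensor_polys d}"
  by (auto simp: subspace_def intro: tensor_polys_add tensor_polys_scale tensor_polys_zero)

lemma vector_polys_subspace:
  "subspace {P :: real^'n::finite \<Rightarrow> real^'m. \<forall>i. (\<lambda>y. P y $ i) \<in> tensor_polys d}"
  by (auto simp: subspace_def intro: tensor_polys_add tensor_polys_scale tensor_polys_zero)

lemma piecewise_subspace:
  assumes S: "subspace S" and W: "\<And>T. subspace (W T)"
  shows "subspace {w \<in> S. \<forall>T\<in>\<T>. \<exists>P. P \<in> W T \<and> represents_on \<Omega> F T P w}"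
  unfolding subspace_def
proof (intro conjI ballI allI)
  show "0 \<in> {w \<in> S. \<forall>T\<in>\<T>. \<exists>P. P \<in> W T \<and> represents_on \<Omega> F T P w}"
    using subspace_0[OF S] subspace_0[OF W] represents_on_zero by blast
  fix v w c
  assume v: "v \<in> {w \<in> S. \<forall>T\<in>\<T>. \<exists>P. P \<in> W T \<and> represents_on \<Omega> F T P w}"
  then show "c *\<^sub>R v \<in> {w \<in> S. \<forall>T\<in>\<T>. \<exists>P. P \<in> W T \<and> represents_on \<Omega> F T P w}"
    using subspace_scale[OF S] subspace_scale[OF W] represents_on_scale by blast
  assume w: "w \<in> {w \<in> S. \<forall>T\<in>\<T>. \<exists>P. P \<in> W T \<and> represents_on \<Omega> F T P w}"
  show "v + w \<in> {w \<in> S. \<forall>T\<in>\<T>. \<exists>P. P \<in> W T \<and> represents_on \<Omega> F T P w}"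
  proof (intro CollectI conjI ballI)
    show "v + w \<in> S" using v w by (intro subspace_add[OF S]) auto
    fix T assume "T \<in> \<T>"
    then obtain P Q where "P \<in> W T" "represents_on \<Omega> F T P v" "Q \<in> W T" "represents_on \<Omega> F T Q w"
      using v w by blast
    then show "\<exists>R. R \<in> W T \<and> represents_on \<Omega> F T R (v + w)"
      by (intro exI[of _ "P + Q"] conjI subspace_add[OF W] represents_on_add)
  qed
qed

lemma Q_hp_subspace: "subspace (Q_hp \<Omega> \<T> F deg)"
  using piecewise_subspace[OF Q_space_subspace matrix_polys_subspace] by (simp add: Q_hp_def)

lemma Q_hp_Q_space: "q \<in> Q_hp \<Omega> \<T> F deg \<Longrightarrow> q \<in> Q_space \<Omega>"
  by (simp add: Q_hp_def)

lemma V_hp_V_space: "v \<in> V_hp \<Omega> \<Gamma>D \<T> F deg \<Longrightarrow> v \<in> V_space \<Omega> \<Gamma>D"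
  by (simp add: V_hp_def)

lemma Q_space_L2: "q \<in> Q_space \<Omega> \<Longrightarrow> q \<in> L2 (lebesgue_on \<Omega>)"
  by (simp add: Q_space_def)

locale meshed_domain = bounded_open \<Omega> for \<Omega> :: "(real^'n::finite) set" +
  fixes \<T> :: "(real^'n) set set" and F :: "(real^'n) set \<Rightarrow> real^'n \<Rightarrow> real^'n"
  assumes finite_mesh: "finite \<T>" and covering: "\<Omega> \<subseteq> \<Union>\<T>"
begin

lemma V_hp_subspace: "subspace (V_hp \<Omega> \<Gamma>D \<T> F deg)"
  using piecewise_subspace[OF V_space_subspace vector_polys_subspace] by (simp add: V_hp_def)

text \<open>
  Every point of \<open>\<Omega>\<close> lies in an element, so a combination of piecewise mapped polynomials
  vanishes if the same combination of the polynomials vanishes on each element; hence polynomial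
  coefficients are degrees of freedom that detect null functions.
\<close>

lemma combination_zero:
  fixes w :: "'x \<Rightarrow> real^'n \<Rightarrow> 'b::real_vector"
  assumes "finite J"
    and rep: "\<And>x T. x \<in> J \<Longrightarrow> T \<in> \<T> \<Longrightarrow> represents_on \<Omega> F T (P x T) (w x)"
    and zero: "\<And>T y. T \<in> \<T> \<Longrightarrow> (\<Sum>x\<in>J. a x *\<^sub>R P x T y) = 0"
  shows "AE z in M. (\<Sum>x\<in>J. a x *\<^sub>R w x z) = 0"
proof -
  have "AE z in M. \<forall>T\<in>\<T>. \<forall>x\<in>J. z \<in> T \<longrightarrow> w x z = P x T (the_inv_into ref_cell (F T) z)"
    using rep unfolding represents_on_def
    by (intro AE_finite_allI finite_mesh \<open>finite J\<close>) auto
  moreover have "AE z in M. z \<in> \<Omega>" by (intro AE_I2) simp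
  ultimately show ?thesis
  proof eventually_elim
    case (elim z)
    then obtain T where T: "T \<in> \<T>" "z \<in> T" using covering by auto
    have "(\<Sum>x\<in>J. a x *\<^sub>R w x z) = (\<Sum>x\<in>J. a x *\<^sub>R P x T (the_inv_into ref_cell (F T) z))"
      using elim(1) T by (intro sum.cong) auto
    then show ?case using zero[OF T(1)] by simp
  qed
qed

text \<open>
  A function vanishing almost everywhere has the weak gradient zero, since the defining integrals
  only see it up to null sets.
\<close>

lemma strain_null:
  assumes "v \<in> H1 \<Omega>" "AE x in M. v x = 0"
  shows "AE x in M. strain \<Omega> v x = 0"
proof -
  have "has_weak_gradient \<Omega> v 0"
    unfolding has_weak_gradient_def
  proof (intro conjI allI impI)
    fix \<phi> i j
    have "(LINT x|M. v x $ i * frechet_derivative \<phi> (at x) (axis j 1)) = 0"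
      by (rule integral_eq_zero_AE) (use assms(2) in \<open>eventually_elim, simp\<close>)
    then show "(LINT x|M. v x $ i * frechet_derivative \<phi> (at x) (axis j 1)) = - (LINT x|M. 0 x $ i $ j * \<phi> x)"
      by simp
  qed (rule subspace_0[OF L2_subspace])
  from has_weak_gradient_unique[OF weak_gradient[OF assms(1)] this]
  show ?thesis by eventually_elim (simp add: strain_def transpose_def vec_eq_iff)
qed

lemma norm_VQ_square: "(norm_VQ \<Omega> v q)\<^sup>2 = (norm_1 \<Omega> v)\<^sup>2 + (L2_norm M q)\<^sup>2"
  by (simp add: norm_VQ_def)

lemma norm_VQ_nonneg: "0 \<le> norm_VQ \<Omega> v q" by (simp add: norm_VQ_def)

lemma norm_1_le_norm_VQ: "norm_1 \<Omega> v \<le> norm_VQ \<Omega> v q"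
  unfolding norm_VQ_def by (rule real_le_rsqrt) simp

lemma norm_VQ_0: "norm_VQ \<Omega> 0 q = L2_norm M q"
  by (simp add: norm_VQ_def norm_1_zero L2_norm_def)

lemma norm_VQ_eq_0_iff:
  assumes "v \<in> H1 \<Omega>" "q \<in> L2 M"
  shows "norm_VQ \<Omega> v q = 0 \<longleftrightarrow> (AE x in M. v x = 0) \<and> (AE x in M. q x = 0)"
proof -
  have nn: "0 \<le> L2_inner M h h" for h :: "real^'n \<Rightarrow> 'b::euclidean_space"
    by (simp add: L2_inner_def)
  have "norm_VQ \<Omega> v q = 0 \<longleftrightarrow> (norm_VQ \<Omega> v q)\<^sup>2 = 0" by simp
  also have "\<dots> \<longleftrightarrow> L2_inner M v v + L2_inner M (strain \<Omega> v) (strain \<Omega> v) + L2_inner M q q = 0"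
    by (simp add: norm_VQ_square norm_1_square L2_norm_square)
  also have "\<dots> \<longleftrightarrow> L2_inner M v v = 0 \<and> L2_inner M (strain \<Omega> v) (strain \<Omega> v) = 0 \<and> L2_inner M q q = 0"
    using nn[of v] nn[of "strain \<Omega> v"] nn[of q] by linarith
  also have "\<dots> \<longleftrightarrow> (AE x in M. v x = 0) \<and> (AE x in M. strain \<Omega> v x = 0) \<and> (AE x in M. q x = 0)"
    using assms by (simp add: L2_inner_self_eq_0_iff H1_L2 strain_L2)
  also have "\<dots> \<longleftrightarrow> (AE x in M. v x = 0) \<and> (AE x in M. q x = 0)"
    using strain_null[OF assms(1)] by blast
  finally show ?thesis .
qed

definition rep_V :: "((real^'n) set \<Rightarrow> nat) \<Rightarrow> (real^'n \<Rightarrow> real^'n) \<Rightarrow> (real^'n) set \<Rightarrow> real^'n \<Rightarrow> real^'n" where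
  "rep_V deg v T = (SOME P. (\<forall>i. (\<lambda>y. P y $ i) \<in> tensor_polys (deg T)) \<and> represents_on \<Omega> F T P v)"

definition rep_Q :: "((real^'n) set \<Rightarrow> nat) \<Rightarrow> (real^'n \<Rightarrow> real^'n^'n) \<Rightarrow> (real^'n) set \<Rightarrow> real^'n \<Rightarrow> real^'n^'n" where
  "rep_Q deg q T = (SOME P. (\<forall>i j. (\<lambda>y. P y $ i $ j) \<in> tensor_polys (deg T - 1)) \<and> represents_on \<Omega> F T P q)"

lemma rep_V:
  assumes "v \<in> V_hp \<Omega> \<Gamma>D \<T> F deg" "T \<in> \<T>"
  shows "(\<lambda>y. rep_V deg v T y $ i) \<in> tensor_polys (deg T)" "represents_on \<Omega> F T (rep_V deg v T) v"
proof -
  have "\<exists>P. (\<forall>i. (\<lambda>y. P y $ i) \<in> tensor_polys (deg T)) \<and> represents_on \<Omega> F T P v"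
    using assms by (auto simp: V_hp_def)
  from someI_ex[OF this] show "(\<lambda>y. rep_V deg v T y $ i) \<in> tensor_polys (deg T)"
    "represents_on \<Omega> F T (rep_V deg v T) v" unfolding rep_V_def by blast+
qed

lemma rep_Q:
  assumes "q \<in> Q_hp \<Omega> \<T> F deg" "T \<in> \<T>"
  shows "(\<lambda>y. rep_Q deg q T y $ i $ j) \<in> tensor_polys (deg T - 1)" "represents_on \<Omega> F T (rep_Q deg q T) q"
proof -
  have "\<exists>P. (\<forall>i j. (\<lambda>y. P y $ i $ j) \<in> tensor_polys (deg T - 1)) \<and> represents_on \<Omega> F T P q"
    using assms by (auto simp: Q_hp_def)
  from someI_ex[OF this] show "(\<lambda>y. rep_Q deg q T y $ i $ j) \<in> tensor_polys (deg T - 1)"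
    "represents_on \<Omega> F T (rep_Q deg q T) q" unfolding rep_Q_def by blast+
qed

text \<open>
  Indices of polynomial coefficients on the elements: the component \<open>(i, None)\<close> stands for the
  \<open>i\<close>-th entry of a vector, \<open>(i, Some j)\<close> for the entry \<open>(i, j)\<close> of a matrix. Matrix entries have the
  smaller degree \<open>deg T - 1\<close> and use only part of the indices.
\<close>

definition degrees_of_freedom ::
  "((real^'n) set \<Rightarrow> nat) \<Rightarrow> ((real^'n) set \<times> ('n \<times> 'n option) \<times> ('n \<Rightarrow> nat)) set" where
  "degrees_of_freedom deg = (SIGMA T:\<T>. UNIV \<times> multi_indices (deg T))"

lemma finite_degrees_of_freedom: "finite (degrees_of_freedom deg)"
  unfolding degrees_of_freedom_def
  by (intro finite_SigmaI finite_mesh finite_cartesian_product finite_multi_indices finite)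

lemma V_hp_Q_hp_finite_rank:
  assumes a: "semi_inner (V_hp \<Omega> \<Gamma>D \<T> F deg \<times> Q_hp \<Omega> \<T> F deg) a"
    and null: "\<And>v q. v \<in> V_hp \<Omega> \<Gamma>D \<T> F deg \<Longrightarrow> q \<in> Q_hp \<Omega> \<T> F deg \<Longrightarrow>
      AE x in M. v x = 0 \<Longrightarrow> AE x in M. q x = 0 \<Longrightarrow> a (v, q) (v, q) = 0"
  shows "finite_semi_inner (V_hp \<Omega> \<Gamma>D \<T> F deg \<times> Q_hp \<Omega> \<T> F deg) a"
proof -
  let ?X = "V_hp \<Omega> \<Gamma>D \<T> F deg \<times> Q_hp \<Omega> \<T> F deg"
  interpret semi_inner ?X a by fact
  define \<kappa> where "\<kappa> x \<iota> = (case \<iota> of (T, (i, None), \<alpha>) \<Rightarrow> poly_coeffs (deg T) (\<lambda>y. rep_V deg (fst x) T y $ i) \<alpha>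
     | (T, (i, Some j), \<alpha>) \<Rightarrow> poly_coeffs (deg T - 1) (\<lambda>y. rep_Q deg (snd x) T y $ i $ j) \<alpha>)"
    for x :: "(real^'n \<Rightarrow> real^'n) \<times> (real^'n \<Rightarrow> real^'n^'n)" and \<iota> :: "(real^'n) set \<times> ('n \<times> 'n option) \<times> ('n \<Rightarrow> nat)"
  have "card E \<le> card (degrees_of_freedom deg)" if "orthonormal E" for E
  proof (rule orthonormal_card_le[OF finite_degrees_of_freedom _ that])
    fix J and c :: "_ \<Rightarrow> real"
    assume J: "finite J" "J \<subseteq> ?X" and zero: "\<forall>\<iota>\<in>degrees_of_freedom deg. (\<Sum>x\<in>J. c x * \<kappa> x \<iota>) = 0"
    let ?s = "\<Sum>x\<in>J. c x *\<^sub>R x"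
    have "(\<Sum>x\<in>J. c x *\<^sub>R rep_V deg (fst x) T y) = 0" if T: "T \<in> \<T>" for T y
    proof -
      have "(\<Sum>x\<in>J. c x * rep_V deg (fst x) T y $ i) = 0" for i
      proof (rule tensor_poly_combination_zero[where P = "\<lambda>x y. rep_V deg (fst x) T y $ i"])
        show "(\<lambda>y. rep_V deg (fst x) T y $ i) \<in> tensor_polys (deg T)" if "x \<in> J" for x
          using that J T by (intro rep_V(1)) auto
        fix \<alpha> :: "'n \<Rightarrow> nat" assume "\<alpha> \<in> multi_indices (deg T)"
        then have "(T, (i, None), \<alpha>) \<in> degrees_of_freedom deg" using T by (simp add: degrees_of_freedom_def)
        from zero[rule_format, OF this] show "(\<Sum>x\<in>J. c x * poly_coeffs (deg T) (\<lambda>y. rep_V deg (fst x) T y $ i) \<alpha>) = 0"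
          by (simp add: \<kappa>_def)
      qed
      then show ?thesis by (simp add: vec_eq_iff)
    qed
    then have "AE z in M. (\<Sum>x\<in>J. c x *\<^sub>R fst x z) = 0"
      using J by (intro combination_zero[where P = "\<lambda>x. rep_V deg (fst x)"] rep_V(2)) auto
    then have v: "AE z in M. fst ?s z = 0" by (simp add: fst_sum sum_fun_apply)
    have "(\<Sum>x\<in>J. c x *\<^sub>R rep_Q deg (snd x) T y) = 0" if T: "T \<in> \<T>" for T y
    proof -
      have "(\<Sum>x\<in>J. c x * rep_Q deg (snd x) T y $ i $ j) = 0" for i j
      proof (rule tensor_poly_combination_zero[where P = "\<lambda>x y. rep_Q deg (snd x) T y $ i $ j"])
        show "(\<lambda>y. rep_Q deg (snd x) T y $ i $ j) \<in> tensor_polys (deg T - 1)" if "x \<in> J" for x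
          using that J T by (intro rep_Q(1)) auto
        fix \<alpha> :: "'n \<Rightarrow> nat" assume "\<alpha> \<in> multi_indices (deg T - 1)"
        then have "(T, (i, Some j), \<alpha>) \<in> degrees_of_freedom deg"
          using T multi_indices_mono[of "deg T - 1" "deg T"] by (auto simp: degrees_of_freedom_def)
        from zero[rule_format, OF this] show "(\<Sum>x\<in>J. c x * poly_coeffs (deg T - 1) (\<lambda>y. rep_Q deg (snd x) T y $ i $ j) \<alpha>) = 0"
          by (simp add: \<kappa>_def)
      qed
      then show ?thesis by (simp add: vec_eq_iff)
    qed
    then have "AE z in M. (\<Sum>x\<in>J. c x *\<^sub>R snd x z) = 0"
      using J by (intro combination_zero[where P = "\<lambda>x. rep_Q deg (snd x)"] rep_Q(2)) auto
    then have q: "AE z in M. snd ?s z = 0" by (simp add: snd_sum sum_fun_apply)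
    have "?s \<in> ?X" using J by (intro mem_sum mem(2)) auto
    then show "a ?s ?s = 0" using null[of "fst ?s" "snd ?s"] v q by (auto simp: mem_Times_iff)
  qed
  then show ?thesis by unfold_locales auto
qed

text \<open>
  Multipliers together with polynomials representing them on the elements. Carrying the polynomials
  along makes their values at the Gauss points linear functions of the data.
\<close>

definition multiplier_data ::
  "((real^'n) set \<Rightarrow> nat) \<Rightarrow> ((real^'n \<Rightarrow> real^'n^'n) \<times> ((real^'n) set \<Rightarrow> real^'n \<Rightarrow> real^'n^'n)) set" where
  "multiplier_data deg = {z. fst z \<in> Q_hp \<Omega> \<T> F deg \<and> (\<forall>T\<in>\<T>.
     (\<forall>i j. (\<lambda>y. snd z T y $ i $ j) \<in> tensor_polys (deg T - 1)) \<and> represents_on \<Omega> F T (snd z T) (fst z))}"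

text \<open>
  Convergence in this form means convergence in \<open>L2\<close> and at all Gauss points.
\<close>

definition multiplier_form ::
  "((real^'n) set \<Rightarrow> nat) \<Rightarrow> (real^'n \<Rightarrow> real^'n^'n) \<times> ((real^'n) set \<Rightarrow> real^'n \<Rightarrow> real^'n^'n) \<Rightarrow>
     (real^'n \<Rightarrow> real^'n^'n) \<times> ((real^'n) set \<Rightarrow> real^'n \<Rightarrow> real^'n^'n) \<Rightarrow> real" where
  "multiplier_form deg z w = L2_inner M (fst z) (fst w) +
     (\<Sum>T\<in>\<T>. \<Sum>y\<in>gauss_points (deg T). snd z T y \<bullet> snd w T y)"

lemma multiplier_data_subspace: "subspace (multiplier_data deg)"
  unfolding subspace_def
proof (intro conjI ballI allI)
  show "0 \<in> multiplier_data deg"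
    by (simp add: multiplier_data_def subspace_0[OF Q_hp_subspace] represents_on_zero tensor_polys_zero)
  fix z w :: "(real^'n \<Rightarrow> real^'n^'n) \<times> ((real^'n) set \<Rightarrow> real^'n \<Rightarrow> real^'n^'n)" and c
  assume z: "z \<in> multiplier_data deg"
  then show "c *\<^sub>R z \<in> multiplier_data deg"
    by (simp add: multiplier_data_def subspace_scale[OF Q_hp_subspace] represents_on_scale tensor_polys_scale)
  assume "w \<in> multiplier_data deg"
  with z show "z + w \<in> multiplier_data deg"
    by (simp add: multiplier_data_def subspace_add[OF Q_hp_subspace] represents_on_add tensor_polys_add)
qed

lemma multiplier_data_L2: "z \<in> multiplier_data deg \<Longrightarrow> fst z \<in> L2 M"
  by (auto simp: multiplier_data_def dest: Q_hp_Q_space Q_space_L2)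

lemma multiplier_form_semi_inner: "semi_inner (multiplier_data deg) (multiplier_form deg)"
proof
  show "subspace (multiplier_data deg)" by (rule multiplier_data_subspace)
  fix x y z c
  assume "x \<in> multiplier_data deg" "z \<in> multiplier_data deg"
  note L = this[THEN multiplier_data_L2]
  show "multiplier_form deg (c *\<^sub>R x) z = c * multiplier_form deg x z"
    using semi_inner.scale_left[OF L2_semi_inner L]
    by (simp add: multiplier_form_def distrib_left sum_distrib_left)
  assume "y \<in> multiplier_data deg"
  note Ly = this[THEN multiplier_data_L2]
  show "multiplier_form deg (x + y) z = multiplier_form deg x z + multiplier_form deg y z"
    using semi_inner.add_left[OF L2_semi_inner L(1) Ly L(2)]
    by (simp add: multiplier_form_def inner_add_left sum.distrib)
next
  fix x y
  show "multiplier_form deg x y = multiplier_form deg y x"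
    by (simp add: multiplier_form_def L2_inner_def inner_commute)
next
  fix x
  show "0 \<le> multiplier_form deg x x"
    by (simp add: multiplier_form_def L2_inner_def sum_nonneg)
qed

lemma multiplier_form_finite: "finite_semi_inner (multiplier_data deg) (multiplier_form deg)"
proof -
  let ?Z = "multiplier_data deg"
  interpret semi_inner ?Z "multiplier_form deg" by (rule multiplier_form_semi_inner)
  define \<kappa> where "\<kappa> z \<iota> = (case \<iota> of (T, (i, j), \<alpha>) \<Rightarrow> poly_coeffs (deg T - 1) (\<lambda>y. snd z T y $ i $ the j) \<alpha>)"
    for z :: "(real^'n \<Rightarrow> real^'n^'n) \<times> ((real^'n) set \<Rightarrow> real^'n \<Rightarrow> real^'n^'n)"
      and \<iota> :: "(real^'n) set \<times> ('n \<times> 'n option) \<times> ('n \<Rightarrow> nat)"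
  have "card E \<le> card (degrees_of_freedom deg)" if "orthonormal E" for E
  proof (rule orthonormal_card_le[OF finite_degrees_of_freedom _ that])
    fix J and c :: "_ \<Rightarrow> real"
    assume J: "finite J" "J \<subseteq> ?Z" and zero: "\<forall>\<iota>\<in>degrees_of_freedom deg. (\<Sum>x\<in>J. c x * \<kappa> x \<iota>) = 0"
    let ?s = "\<Sum>x\<in>J. c x *\<^sub>R x"
    have P: "(\<Sum>x\<in>J. c x *\<^sub>R snd x T y) = 0" if T: "T \<in> \<T>" for T y
    proof -
      have "(\<Sum>x\<in>J. c x * snd x T y $ i $ j) = 0" for i j
      proof (rule tensor_poly_combination_zero[where P = "\<lambda>x y. snd x T y $ i $ j"])
        show "(\<lambda>y. snd x T y $ i $ j) \<in> tensor_polys (deg T - 1)" if "x \<in> J" for x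
          using that J T by (auto simp: multiplier_data_def)
        fix \<alpha> :: "'n \<Rightarrow> nat" assume "\<alpha> \<in> multi_indices (deg T - 1)"
        then have "(T, (i, Some j), \<alpha>) \<in> degrees_of_freedom deg"
          using T multi_indices_mono[of "deg T - 1" "deg T"] by (auto simp: degrees_of_freedom_def)
        from zero[rule_format, OF this] show "(\<Sum>x\<in>J. c x * poly_coeffs (deg T - 1) (\<lambda>y. snd x T y $ i $ j) \<alpha>) = 0"
          by (simp add: \<kappa>_def)
      qed
      then show ?thesis by (simp add: vec_eq_iff)
    qed
    then have "AE z in M. (\<Sum>x\<in>J. c x *\<^sub>R fst x z) = 0"
      using J by (intro combination_zero[where P = "snd"]) (auto simp: multiplier_data_def)
    then have "AE z in M. fst ?s z = 0" by (simp add: fst_sum sum_fun_apply)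
    moreover have "?s \<in> ?Z" using J by (intro mem_sum mem(2)) auto
    ultimately have "L2_inner M (fst ?s) (fst ?s) = 0"
      using L2_inner_self_eq_0_iff multiplier_data_L2 by blast
    moreover have "snd ?s T y = 0" if "T \<in> \<T>" for T y
      using P[OF that] by (simp add: snd_sum sum_fun_apply)
    ultimately show "multiplier_form deg ?s ?s = 0" by (simp add: multiplier_form_def)
  qed
  then show ?thesis by unfold_locales auto
qed

definition admissible_data ::
  "((real^'n) set \<Rightarrow> nat) \<Rightarrow> real \<Rightarrow> ((real^'n \<Rightarrow> real^'n^'n) \<times> ((real^'n) set \<Rightarrow> real^'n \<Rightarrow> real^'n^'n)) set" where
  "admissible_data deg \<sigma>y = {z \<in> multiplier_data deg. \<forall>T\<in>\<T>. \<forall>y\<in>gauss_points (deg T). norm (snd z T y) \<le> \<sigma>y}"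

lemma Lambda_hp_eq: "Lambda_hp \<Omega> \<T> F deg \<sigma>y = fst ` admissible_data deg \<sigma>y"
proof (intro equalityI subsetI)
  fix \<mu> assume \<mu>: "\<mu> \<in> Lambda_hp \<Omega> \<T> F deg \<sigma>y"
  then have "\<forall>T\<in>\<T>. \<exists>P. (\<forall>i j. (\<lambda>y. P y $ i $ j) \<in> tensor_polys (deg T - 1)) \<and> represents_on \<Omega> F T P \<mu> \<and>
     (\<forall>y\<in>gauss_points (deg T). norm (P y) \<le> \<sigma>y)" by (simp add: Lambda_hp_def)
  from bchoice[OF this] obtain P where P: "\<forall>T\<in>\<T>. (\<forall>i j. (\<lambda>y. P T y $ i $ j) \<in> tensor_polys (deg T - 1)) \<and>
     represents_on \<Omega> F T (P T) \<mu> \<and> (\<forall>y\<in>gauss_points (deg T). norm (P T y) \<le> \<sigma>y)" ..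
  then have "(\<mu>, P) \<in> admissible_data deg \<sigma>y"
    using \<mu> by (auto simp: admissible_data_def multiplier_data_def Lambda_hp_def)
  then show "\<mu> \<in> fst ` admissible_data deg \<sigma>y" by force
next
  fix \<mu> assume "\<mu> \<in> fst ` admissible_data deg \<sigma>y"
  then obtain P where "(\<mu>, P) \<in> admissible_data deg \<sigma>y" by force
  then have "\<mu> \<in> Q_hp \<Omega> \<T> F deg" and P: "\<And>T. T \<in> \<T> \<Longrightarrow>
      (\<forall>i j. (\<lambda>y. P T y $ i $ j) \<in> tensor_polys (deg T - 1)) \<and> represents_on \<Omega> F T (P T) \<mu> \<and>
      (\<forall>y\<in>gauss_points (deg T). norm (P T y) \<le> \<sigma>y)"
    by (auto simp: admissible_data_def multiplier_data_def)
  then show "\<mu> \<in> Lambda_hp \<Omega> \<T> F deg \<sigma>y" unfolding Lambda_hp_def by blast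
qed

lemma admissible_data_convex: "convex (admissible_data deg \<sigma>y)"
proof (rule convexI)
  fix z w :: "(real^'n \<Rightarrow> real^'n^'n) \<times> ((real^'n) set \<Rightarrow> real^'n \<Rightarrow> real^'n^'n)" and s t :: real
  assume z: "z \<in> admissible_data deg \<sigma>y" and w: "w \<in> admissible_data deg \<sigma>y" and st: "0 \<le> s" "0 \<le> t" "s + t = 1"
  have "s *\<^sub>R z + t *\<^sub>R w \<in> multiplier_data deg"
    using z w by (intro subspace_add subspace_scale multiplier_data_subspace) (auto simp: admissible_data_def)
  moreover have "norm (s *\<^sub>R snd z T y + t *\<^sub>R snd w T y) \<le> \<sigma>y" if "T \<in> \<T>" "y \<in> gauss_points (deg T)" for T y
  proof -
    have "snd z T y \<in> cball 0 \<sigma>y" "snd w T y \<in> cball 0 \<sigma>y" using z w that by (auto simp: admissible_data_def)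
    from convexD[OF convex_cball this st] show ?thesis by simp
  qed
  ultimately show "s *\<^sub>R z + t *\<^sub>R w \<in> admissible_data deg \<sigma>y" by (simp add: admissible_data_def)
qed

lemma admissible_data_closed:
  assumes k: "\<And>i::nat. k i \<in> admissible_data deg \<sigma>y" and z: "z \<in> multiplier_data deg"
    and lim: "(\<lambda>i. multiplier_form deg (k i - z) (k i - z)) \<longlonglongrightarrow> 0"
  shows "z \<in> admissible_data deg \<sigma>y"
proof -
  have "norm (snd z T y) \<le> \<sigma>y" if T: "T \<in> \<T>" and y: "y \<in> gauss_points (deg T)" for T y
  proof -
    have le: "(norm (snd (k i) T y - snd z T y))\<^sup>2 \<le> multiplier_form deg (k i - z) (k i - z)" for i
    proof -
      let ?d = "snd (k i - z)"
      have "(norm (?d T y))\<^sup>2 \<le> (\<Sum>y\<in>gauss_points (deg T). (norm (?d T y))\<^sup>2)"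
        by (rule member_le_sum[OF y]) (auto simp: finite_gauss_points)
      also have "\<dots> \<le> (\<Sum>T\<in>\<T>. \<Sum>y\<in>gauss_points (deg T). (norm (?d T y))\<^sup>2)"
        by (rule member_le_sum[OF T]) (auto simp: finite_mesh intro!: sum_nonneg)
      also have "\<dots> \<le> multiplier_form deg (k i - z) (k i - z)"
        by (simp add: multiplier_form_def power2_norm_eq_inner L2_inner_def)
      finally show ?thesis by simp
    qed
    have "(\<lambda>i. (norm (snd (k i) T y - snd z T y))\<^sup>2) \<longlonglongrightarrow> 0"
      by (rule tendsto_sandwich[OF _ _ tendsto_const lim]) (use le in auto)
    then have "(\<lambda>i. sqrt ((norm (snd (k i) T y - snd z T y))\<^sup>2)) \<longlonglongrightarrow> sqrt 0"
      by (rule tendsto_real_sqrt)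
    then have "(\<lambda>i. norm (snd (k i) T y - snd z T y)) \<longlonglongrightarrow> 0" by simp
    then have "(\<lambda>i. snd (k i) T y - snd z T y) \<longlonglongrightarrow> 0" by (rule tendsto_norm_zero_cancel)
    then have "(\<lambda>i. snd (k i) T y) \<longlonglongrightarrow> snd z T y" by (rule LIM_zero_cancel)
    then have "(\<lambda>i. norm (snd (k i) T y)) \<longlonglongrightarrow> norm (snd z T y)" by (rule tendsto_norm)
    moreover have "norm (snd (k i) T y) \<le> \<sigma>y" for i using k[of i] T y by (simp add: admissible_data_def)
    ultimately show ?thesis by (intro LIMSEQ_le_const2[of _ "norm (snd z T y)"]) auto
  qed
  then show ?thesis using z by (simp add: admissible_data_def)
qed

end

theorem theorem5:
  fixes \<Omega> \<Gamma>D :: "(real^'n::finite) set"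
    and \<C> \<H> :: "real^'n \<Rightarrow> real^'n^'n^'n^'n"
    and f g :: "(real^'n \<Rightarrow> real^'n) \<Rightarrow> real"
    and \<T> :: "(real^'n) set set"
    and F :: "(real^'n) set \<Rightarrow> real^'n \<Rightarrow> real^'n"
    and deg :: "(real^'n) set \<Rightarrow> nat"
    and ce ch \<sigma>y ctr ca \<alpha> \<kappa>h \<kappa>p :: real
  assumes dim: "CARD('n) \<in> {2, 3}"
    and domain: "polyhedral_domain \<Omega>" "lipschitz_boundary \<Omega>"
    and dirichlet: "\<Gamma>D \<subseteq> frontier \<Omega>" "\<Gamma>D \<in> sets borel" "emeasure surface_measure \<Gamma>D > 0"
    and elasticity: "ce > 0" "material_tensor \<Omega> ce \<C>"
    and hardening: "ch > 0" "material_tensor \<Omega> ch \<H>"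
    and yield_stress: "\<sigma>y > 0"
    and trace_constant: "ctr > 0"
      "\<And>v. v \<in> V_space \<Omega> \<Gamma>D \<Longrightarrow> trace_norm \<Omega> \<Gamma>D (boundary_trace \<Omega> v) \<le> ctr * norm_1 \<Omega> v"
    and volume_load: "bounded_functional (V_space \<Omega> \<Gamma>D) (norm_1 \<Omega>) f"
    and surface_load: "bounded_functional (trace_space \<Omega> \<Gamma>D) (trace_norm \<Omega> \<Gamma>D) g"
    and continuity: "ca > 0"
      "\<And>u p v q. u \<in> V_space \<Omega> \<Gamma>D \<Longrightarrow> p \<in> Q_space \<Omega> \<Longrightarrow> v \<in> V_space \<Omega> \<Gamma>D \<Longrightarrow> q \<in> Q_space \<Omega> \<Longrightarrow>
         a_form \<Omega> \<C> \<H> (u, p) (v, q) \<le> ca * norm_VQ \<Omega> u p * norm_VQ \<Omega> v q"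
    and ellipticity: "\<alpha> > 0"
      "\<And>v q. v \<in> V_space \<Omega> \<Gamma>D \<Longrightarrow> q \<in> Q_space \<Omega> \<Longrightarrow>
         \<alpha> * (norm_VQ \<Omega> v q)\<^sup>2 \<le> a_form \<Omega> \<C> \<H> (v, q) (v, q)"
    and mesh: "fe_mesh \<Omega> \<T> F" "comparable_on_neighbors \<kappa>h \<T> diameter"
    and degrees: "\<And>T. T \<in> \<T> \<Longrightarrow> deg T \<ge> 1"
      "comparable_on_neighbors \<kappa>p \<T> (\<lambda>T. real (deg T))"
    and jacobian_det: "\<And>T. T \<in> \<T> \<Longrightarrow> deg T \<ge> 2 \<Longrightarrow>
         (\<lambda>y. det (jacobian (F T) (at y))) \<in> tensor_polys 1"
  shows "\<exists>u p lam. discrete_solution \<Omega> \<Gamma>D \<C> \<H> f g \<sigma>y \<T> F deg u p lam \<and>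
           (\<forall>u' p' lam'. discrete_solution \<Omega> \<Gamma>D \<C> \<H> f g \<sigma>y \<T> F deg u' p' lam' \<longrightarrow>
              (AE x in lebesgue_on \<Omega>. u' x = u x \<and> p' x = p x \<and> lam' x = lam x)) \<and>
           norm_VQ \<Omega> u p \<le> 1 / \<alpha> *
             (dual_norm (V_space \<Omega> \<Gamma>D) (norm_1 \<Omega>) f +
              ctr * dual_norm (trace_space \<Omega> \<Gamma>D) (trace_norm \<Omega> \<Gamma>D) g) \<and>
           L2_norm (lebesgue_on \<Omega>) lam \<le> ca / \<alpha> *
             (dual_norm (V_space \<Omega> \<Gamma>D) (norm_1 \<Omega>) f +
              ctr * dual_norm (trace_space \<Omega> \<Gamma>D) (trace_norm \<Omega> \<Gamma>D) g)"
proof -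
  have "\<Omega> \<subseteq> \<Union>\<T>" using mesh(1) closure_subset by (auto simp: fe_mesh_def)
  then interpret meshed_domain \<Omega> \<T> F
    using domain(1) mesh(1) by unfold_locales (auto simp: polyhedral_domain_def fe_mesh_def)
  let ?V = "V_hp \<Omega> \<Gamma>D \<T> F deg" and ?Q = "Q_hp \<Omega> \<T> F deg" and ?\<Lambda> = "Lambda_hp \<Omega> \<T> F deg \<sigma>y"
  let ?X = "?V \<times> ?Q" and ?Z = "multiplier_data deg" and ?K = "admissible_data deg \<sigma>y"
  let ?a = "a_form \<Omega> \<C> \<H>" and ?n = "multiplier_form deg" and ?N = "\<lambda>x. norm_VQ \<Omega> (fst x) (snd x)"
  define R where "R = dual_norm (V_space \<Omega> \<Gamma>D) (norm_1 \<Omega>) f +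
    ctr * dual_norm (trace_space \<Omega> \<Gamma>D) (trace_norm \<Omega> \<Gamma>D) g"
  have XV: "fst x \<in> V_space \<Omega> \<Gamma>D" "fst x \<in> H1 \<Omega>" "snd x \<in> Q_space \<Omega>" "snd x \<in> L2 M" if "x \<in> ?X" for x
  proof -
    show V: "fst x \<in> V_space \<Omega> \<Gamma>D" and Q: "snd x \<in> Q_space \<Omega>"
      using that by (auto intro: V_hp_V_space Q_hp_Q_space)
    show "fst x \<in> H1 \<Omega>" by (rule V_space_H1[OF V])
    show "snd x \<in> L2 M" by (rule Q_space_L2[OF Q])
  qed
  have sX: "subspace ?X" by (intro subspace_Times V_hp_subspace Q_hp_subspace)
  have elliptic: "\<alpha> * (?N x)\<^sup>2 \<le> ?a x x" if "x \<in> ?X" for x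
    using ellipticity(2)[OF XV(1,3)[OF that]] by simp
  have continuous: "?a x y \<le> ca * ?N x * ?N y" if "x \<in> ?X" "y \<in> ?X" for x y
    using continuity(2)[OF XV(1)[OF that(1)] XV(3)[OF that(1)] XV(1)[OF that(2)] XV(3)[OF that(2)]] by simp
  \<comment> \<open>\<open>a\<close> is an inner product on the discrete space by ellipticity\<close>
  have semi: "semi_inner ?X ?a"
  proof (rule a_form_semi_inner[OF elasticity(2) hardening(2) sX])
    show "0 \<le> ?a x x" if "x \<in> ?X" for x
      by (rule order_trans[OF _ elliptic[OF that]]) (use \<open>\<alpha> > 0\<close> in simp)
  qed (use XV in auto)
  then have fin: "finite_semi_inner ?X ?a"
  proof (rule V_hp_Q_hp_finite_rank)
    fix v q assume vq: "v \<in> ?V" "q \<in> ?Q" "AE x in M. v x = 0" "AE x in M. q x = 0"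
    then have x: "(v, q) \<in> ?X" by simp
    have "norm_VQ \<Omega> v q = 0" using norm_VQ_eq_0_iff XV(2,4)[OF x] vq(3,4) by simp
    then show "?a (v, q) (v, q) = 0"
      using continuous[OF x x] semi_inner.nonneg[OF semi x] by simp
  qed
  interpret a: finite_semi_inner ?X ?a by (rule fin)
  have load: "load \<Omega> f g (v + w) = load \<Omega> f g v + load \<Omega> f g w" "load \<Omega> f g (c *\<^sub>R v) = c * load \<Omega> f g v"
      "\<bar>load \<Omega> f g v\<bar> \<le> R * norm_1 \<Omega> v"
    if "v \<in> V_space \<Omega> \<Gamma>D" "w \<in> V_space \<Omega> \<Gamma>D" for v w c
    using load_linear_bounded[OF volume_load surface_load less_imp_le[OF trace_constant(1)] trace_constant(2)] that
    by (simp_all add: R_def)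
  have R_nonneg: "0 \<le> R"
    using load_linear_bounded(4)[OF volume_load surface_load less_imp_le[OF trace_constant(1)] trace_constant(2)]
    by (simp add: R_def)
  have load_0: "load \<Omega> f g 0 = 0"
    using load(2)[of 0 0 0] subspace_0[OF V_space_subspace] by simp
  have N_sq: "(?N x)\<^sup>2 \<le> ?a x x / \<alpha>" if "x \<in> ?X" for x
    using elliptic[OF that] \<open>\<alpha> > 0\<close> by (simp add: field_simps)
  have L2_le_N: "L2_norm M (snd x) \<le> ?N x" for x :: "(real^'n \<Rightarrow> real^'n) \<times> (real^'n \<Rightarrow> real^'n^'n)"
    unfolding norm_VQ_def by (rule real_le_rsqrt) simp
  have pairing: "\<bar>L2_inner M p q\<bar> \<le> L2_norm M p * L2_norm M q" if "p \<in> L2 M" "q \<in> L2 M"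
    for p q :: "real^'n \<Rightarrow> real^'n^'n"
    using semi_inner.Cauchy_Schwarz[OF L2_semi_inner that] by (simp add: L2_norm_eq_sqrt)
  \<comment> \<open>testing with \<open>(0, lam)\<close>, on which the load vanishes; the sign is moved into the test function because continuity bounds \<open>a\<close> only from above\<close>
  have multiplier_bound: "L2_norm M lam \<le> ca * ?N x"
    if x: "x \<in> ?X" and lam: "lam \<in> ?Q" and eq: "\<forall>y\<in>?X. ?a x y + L2_inner M lam (snd y) = load \<Omega> f g (fst y)" for x lam
  proof -
    have y: "(0, lam) \<in> ?X" using lam subspace_0[OF V_hp_subspace] by simp
    then have y': "(- 1) *\<^sub>R (0, lam) \<in> ?X" by (rule a.mem(2))
    have "(L2_norm M lam)\<^sup>2 = - ?a x (0, lam)"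
      using eq[rule_format, OF y] by (simp add: L2_norm_square load_0)
    also have "\<dots> = ?a x ((- 1) *\<^sub>R (0, lam))" using a.scale_right[OF y x, of "- 1"] by simp
    also have "\<dots> \<le> ca * ?N x * ?N ((- 1) *\<^sub>R (0, lam))" by (rule continuous[OF x y'])
    also have "?N ((- 1) *\<^sub>R (0, lam)) = L2_norm M lam"
    proof -
      have "fst ((- 1 :: real) *\<^sub>R (0 :: real^'n \<Rightarrow> real^'n, lam)) = 0" by simp
      then show ?thesis by (simp only: norm_VQ_0) (simp add: L2_norm_def)
    qed
    finally have *: "L2_norm M lam * L2_norm M lam \<le> (ca * ?N x) * L2_norm M lam" by (simp add: power2_eq_square)
    have "0 \<le> ca * ?N x" using \<open>ca > 0\<close> norm_VQ_nonneg by simp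
    moreover have "0 \<le> L2_norm M lam" by (simp add: L2_norm_def)
    ultimately show ?thesis
      using mult_right_le_imp_le[OF *] by (cases "L2_norm M lam = 0") auto
  qed
  have Lambda_Q: "lam \<in> ?Q" if "lam \<in> ?\<Lambda>" for lam using that by (simp add: Lambda_hp_def)
  have Lambda_0: "0 \<in> ?\<Lambda>"
    unfolding Lambda_hp_eq
    by (rule image_eqI[of _ _ 0])
       (use \<open>\<sigma>y > 0\<close> subspace_0[OF multiplier_data_subspace] in \<open>auto simp: admissible_data_def\<close>)
  have ZL: "z \<in> ?Z \<Longrightarrow> fst z \<in> L2 M" for z by (rule multiplier_data_L2)
  have n_ge: "L2_inner M (fst z) (fst z) \<le> ?n z z" for z
    by (simp add: multiplier_form_def sum_nonneg)
  have "\<exists>z\<in>?K. \<exists>x\<in>?X. (\<forall>y\<in>?X. ?a x y + L2_inner M (fst z) (snd y) = load \<Omega> f g (fst y)) \<and>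
      (\<forall>w\<in>?K. L2_inner M (fst (w - z)) (snd x) \<le> 0)"
  proof (rule mixed_problem_solvable[OF fin multiplier_form_finite,
        where L = "\<lambda>y. load \<Omega> f g (fst y)" and b = "\<lambda>z y. L2_inner M (fst z) (snd y)"
        and \<beta> = "1 / sqrt \<alpha>" and \<gamma> = "\<Sum>T\<in>\<T>. \<Sum>y\<in>(gauss_points (deg T) :: (real^'n) set). \<sigma>y\<^sup>2" and \<delta> = "ca\<^sup>2 / \<alpha>"])
    fix x y c assume x: "x \<in> ?X"
    show "load \<Omega> f g (fst (c *\<^sub>R x)) = c * load \<Omega> f g (fst x)" using load(2) XV(1)[OF x] by simp
    show "load \<Omega> f g (fst x) = 0" if "?a x x = 0"
    proof -
      have "?N x = 0" using N_sq[OF x] that by simp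
      then have "norm_1 \<Omega> (fst x) = 0" using norm_1_le_norm_VQ[of "fst x" "snd x"] norm_1_nonneg[of "fst x"] by simp
      then show ?thesis using load(3)[OF XV(1)[OF x] XV(1)[OF x]] by simp
    qed
    assume y: "y \<in> ?X"
    show "load \<Omega> f g (fst (x + y)) = load \<Omega> f g (fst x) + load \<Omega> f g (fst y)"
      using load(1) XV(1)[OF x] XV(1)[OF y] by simp
  next
    fix z w x y c assume z: "z \<in> ?Z" and x: "x \<in> ?X"
    note zL = ZL[OF z] and xL = XV(4)[OF x]
    show "L2_inner M (fst (c *\<^sub>R z)) (snd x) = c * L2_inner M (fst z) (snd x)"
      using semi_inner.scale_left[OF L2_semi_inner zL xL] by simp
    show "L2_inner M (fst z) (snd (c *\<^sub>R x)) = c * L2_inner M (fst z) (snd x)"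
      using semi_inner.scale_right[OF L2_semi_inner xL zL] by simp
    show "L2_inner M (fst (z + w)) (snd x) = L2_inner M (fst z) (snd x) + L2_inner M (fst w) (snd x)" if "w \<in> ?Z"
      using semi_inner.add_left[OF L2_semi_inner zL ZL[OF that] xL] by simp
    show "L2_inner M (fst z) (snd (x + y)) = L2_inner M (fst z) (snd x) + L2_inner M (fst z) (snd y)" if "y \<in> ?X"
      using semi_inner.add_right[OF L2_semi_inner xL XV(4)[OF that] zL] by simp
    show "\<bar>L2_inner M (fst z) (snd x)\<bar> \<le> 1 / sqrt \<alpha> * sqrt (?n z z) * sqrt (?a x x)"
    proof -
      have "\<bar>L2_inner M (fst z) (snd x)\<bar> \<le> L2_norm M (fst z) * L2_norm M (snd x)" by (rule pairing[OF zL xL])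
      also have "\<dots> \<le> sqrt (?n z z) * sqrt (?a x x / \<alpha>)"
      proof (rule mult_mono)
        show "L2_norm M (fst z) \<le> sqrt (?n z z)" unfolding L2_norm_eq_sqrt by (rule real_sqrt_le_mono[OF n_ge])
        show "L2_norm M (snd x) \<le> sqrt (?a x x / \<alpha>)"
          using L2_le_N[of x] real_le_rsqrt[OF N_sq[OF x]] by linarith
      qed (use semi_inner.nonneg[OF multiplier_form_semi_inner z] in \<open>auto simp: L2_norm_def\<close>)
      finally show ?thesis by (simp add: real_sqrt_divide mult_ac)
    qed
  next
    show "?K \<subseteq> ?Z" by (auto simp: admissible_data_def)
    show "?K \<noteq> {}" using Lambda_0 unfolding Lambda_hp_eq by blast
    show "convex ?K" by (rule admissible_data_convex)
    show "0 \<le> ca\<^sup>2 / \<alpha>" using \<open>\<alpha> > 0\<close> by simp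
    show "z \<in> ?K" if "\<And>i::nat. k i \<in> ?K" "z \<in> ?Z" "(\<lambda>i. ?n (k i - z) (k i - z)) \<longlonglongrightarrow> 0" for k z
      using that by (rule admissible_data_closed)
    fix z x assume z: "z \<in> ?K" and x: "x \<in> ?X"
      and eq: "\<forall>y\<in>?X. ?a x y + L2_inner M (fst z) (snd y) = load \<Omega> f g (fst y)"
    have "fst z \<in> ?Q" using z Lambda_Q unfolding Lambda_hp_eq by blast
    from multiplier_bound[OF x this eq] have "(L2_norm M (fst z))\<^sup>2 \<le> (ca * ?N x)\<^sup>2"
      by (rule power_mono) (simp add: L2_norm_def)
    also have "\<dots> \<le> ca\<^sup>2 * (?a x x / \<alpha>)"
      unfolding power_mult_distrib by (rule mult_left_mono[OF N_sq[OF x]]) simp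
    finally have 1: "L2_inner M (fst z) (fst z) \<le> ca\<^sup>2 / \<alpha> * ?a x x" by (simp add: L2_norm_square)
    have "(\<Sum>T\<in>\<T>. \<Sum>y\<in>gauss_points (deg T). snd z T y \<bullet> snd z T y) \<le> (\<Sum>T\<in>\<T>. \<Sum>y\<in>(gauss_points (deg T) :: (real^'n) set). \<sigma>y\<^sup>2)"
    proof (intro sum_mono)
      fix T and y :: "real^'n" assume "T \<in> \<T>" "y \<in> gauss_points (deg T)"
      then have "norm (snd z T y) \<le> \<sigma>y" using z by (simp add: admissible_data_def)
      then show "snd z T y \<bullet> snd z T y \<le> \<sigma>y\<^sup>2"
        by (simp add: power_mono flip: power2_norm_eq_inner)
    qed
    with 1 show "?n z z \<le> (\<Sum>T\<in>\<T>. \<Sum>y\<in>(gauss_points (deg T) :: (real^'n) set). \<sigma>y\<^sup>2) + ca\<^sup>2 / \<alpha> * ?a x x"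
      by (simp add: multiplier_form_def)
  qed
  then obtain z x where z: "z \<in> ?K" and x: "x \<in> ?X"
    and eq: "\<forall>y\<in>?X. ?a x y + L2_inner M (fst z) (snd y) = load \<Omega> f g (fst y)"
    and ineq: "\<forall>w\<in>?K. L2_inner M (fst (w - z)) (snd x) \<le> 0" by blast
  let ?sol = "\<lambda>x lam. x \<in> ?X \<and> lam \<in> ?\<Lambda> \<and>
    (\<forall>y\<in>?X. ?a x y + L2_inner M lam (snd y) = load \<Omega> f g (fst y)) \<and>
    (\<forall>\<mu>\<in>?\<Lambda>. L2_inner M (\<mu> - lam) (snd x) \<le> 0)"
  have sol_iff: "discrete_solution \<Omega> \<Gamma>D \<C> \<H> f g \<sigma>y \<T> F deg u p lam \<longleftrightarrow> ?sol (u, p) lam" for u p lam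
    unfolding discrete_solution_def fun_diff_def by auto
  have sol: "?sol x (fst z)"
    using z x eq ineq unfolding Lambda_hp_eq by auto
  have lamL: "lam \<in> L2 M" if "lam \<in> ?\<Lambda>" for lam
    by (rule Q_space_L2[OF Q_hp_Q_space[OF Lambda_Q[OF that]]])
  \<comment> \<open>testing with the solution; its multiplier term is nonnegative since \<open>0\<close> is admissible\<close>
  have bound_x: "?N x \<le> 1 / \<alpha> * R"
  proof -
    have lam: "fst z \<in> ?\<Lambda>" using sol by blast
    have "0 \<le> L2_inner M (fst z) (snd x)"
    proof -
      have "L2_inner M (0 - fst z) (snd x) \<le> 0" using sol Lambda_0 by blast
      moreover have "L2_inner M (0 - fst z) (snd x) = - L2_inner M (fst z) (snd x)"
        using semi_inner.scale_left[OF L2_semi_inner lamL[OF lam] XV(4)[OF x], of "- 1"] by simp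
      ultimately show ?thesis by simp
    qed
    then have "\<alpha> * (?N x)\<^sup>2 \<le> load \<Omega> f g (fst x)"
      using elliptic[OF x] eq[rule_format, OF x] by linarith
    also have "\<dots> \<le> R * norm_1 \<Omega> (fst x)" using load(3)[OF XV(1)[OF x] XV(1)[OF x]] by simp
    also have "\<dots> \<le> R * ?N x"
      by (rule mult_left_mono[OF norm_1_le_norm_VQ R_nonneg])
    finally have *: "(\<alpha> * ?N x) * ?N x \<le> R * ?N x" by (simp add: power2_eq_square mult.assoc)
    have "\<alpha> * ?N x \<le> R"
      using mult_right_le_imp_le[OF *] R_nonneg norm_VQ_nonneg[of "fst x" "snd x"]
      by (cases "?N x = 0") auto
    then show ?thesis using \<open>\<alpha> > 0\<close> by (simp add: field_simps)
  qed
  have bound_lam: "L2_norm M (fst z) \<le> ca / \<alpha> * R"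
  proof -
    have "L2_norm M (fst z) \<le> ca * ?N x" using multiplier_bound[OF x _ eq] sol Lambda_Q by blast
    also have "\<dots> \<le> ca * (1 / \<alpha> * R)" using bound_x \<open>ca > 0\<close> by (intro mult_left_mono) auto
    finally show ?thesis by simp
  qed
  \<comment> \<open>the two inequalities make the multiplier term of the error equation, tested with the error, nonnegative\<close>
  have unique: "AE y in M. fst x' y = fst x y \<and> snd x' y = snd x y \<and> lam' y = fst z y" if s': "?sol x' lam'" for x' lam'
  proof -
    let ?d = "x' - x" and ?l = "lam' - fst z"
    have x': "x' \<in> ?X" and d: "?d \<in> ?X" using s' x by (auto intro: a.mem(3))
    have L: "lam' \<in> L2 M" "fst z \<in> L2 M" using s' sol lamL by blast+
    note X4 = XV(4)[OF x] XV(4)[OF x'] XV(4)[OF d]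
    have l: "?l \<in> ?Q" using s' sol by (intro subspace_diff[OF Q_hp_subspace] Lambda_Q) blast+
    have err: "?a ?d y + L2_inner M ?l (snd y) = 0" if y: "y \<in> ?X" for y
    proof -
      have "?a x' y + L2_inner M lam' (snd y) = ?a x y + L2_inner M (fst z) (snd y)"
        using s' eq y by auto
      then show ?thesis
        using a.diff_left[OF x' x y] semi_inner.diff_left[OF L2_semi_inner L XV(4)[OF y]] by simp
    qed
    have "0 \<le> L2_inner M ?l (snd ?d)"
    proof -
      have "L2_inner M (lam' - fst z) (snd x) \<le> 0" "L2_inner M (fst z - lam') (snd x') \<le> 0"
        using s' sol by blast+
      moreover have "L2_inner M (fst z - lam') (snd x') = - L2_inner M ?l (snd x')"
        using semi_inner.diff_left[OF L2_semi_inner L X4(2)] semi_inner.diff_left[OF L2_semi_inner L(2,1) X4(2)] by simp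
      moreover have "L2_inner M ?l (snd ?d) = L2_inner M ?l (snd x') - L2_inner M ?l (snd x)"
        using semi_inner.diff_right[OF L2_semi_inner X4(2) X4(1) subspace_diff[OF L2_subspace L]] by simp
      ultimately show ?thesis by linarith
    qed
    then have "\<alpha> * (?N ?d)\<^sup>2 \<le> 0" using err[OF d] elliptic[OF d] by linarith
    then have N0: "?N ?d = 0" using \<open>\<alpha> > 0\<close> by (simp add: mult_le_0_iff)
    then have ae: "AE y in M. fst ?d y = 0" "AE y in M. snd ?d y = 0"
      using norm_VQ_eq_0_iff[OF XV(2)[OF d] XV(4)[OF d]] by blast+
    have y: "(0, ?l) \<in> ?X" using l subspace_0[OF V_hp_subspace] by simp
    have "?a ?d ?d = 0" using continuous[OF d d] a.nonneg[OF d] N0 by simp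
    then have "?a ?d (0, ?l) = 0" by (rule a.null_left[OF d y])
    then have "L2_inner M ?l ?l = 0" using err[OF y] by simp
    then have "AE y in M. ?l y = 0"
      using L2_inner_self_eq_0_iff[OF subspace_diff[OF L2_subspace L]] by blast
    with ae show ?thesis by eventually_elim simp
  qed
  show ?thesis
  proof (intro exI conjI allI impI)
    show "discrete_solution \<Omega> \<Gamma>D \<C> \<H> f g \<sigma>y \<T> F deg (fst x) (snd x) (fst z)"
      unfolding sol_iff using sol by simp
    show "AE y in M. u' y = fst x y \<and> p' y = snd x y \<and> lam' y = fst z y"
      if "discrete_solution \<Omega> \<Gamma>D \<C> \<H> f g \<sigma>y \<T> F deg u' p' lam'" for u' p' lam'
      using unique[OF that[unfolded sol_iff]] by simp
  qed (use bound_x bound_lam in \<open>simp_all add: R_def\<close>)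
qed

end
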